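(* Let $A=(-\tfrac{\pi}{2},+\tfrac{\pi}{2})$, let $X\subset\mathbb{C}_x$ be a domain and let $S\subset\mathbb{C}_\hbar$ be a sectorial domain at the origin with opening $A$. Consider the Riccati equation $$\hbar\,\partial_x f=af^2+bf+c,$$ where $a=\sum_k a_k(x)\hbar^k$, $b=\sum_k b_k(x)\hbar^k$, $c=\sum_k c_k(x)\hbar^k$ are polynomials in $\hbar$ whose coefficients are holomorphic functions on $X$. Let $D_0:=b_0^2-4a_0c_0$, assumed not identically zero. Let $x_0\in X$ with $D_0(x_0)\neq0$, fix a square-root branch $\sqrt{D_0}$ near $x_0$, and put $\Phi(x):=\int_{x_0}^x\sqrt{D_0(t)}\,dt$. Suppose that $x_0$ has a neighbourhood $W\subset X$ which is mapped by $\Phi$ to a horizontal strip $H=\{z : -r<\operatorname{Im}(z)<r\}$ for some $r>0$ (see the context), that $a_0$ is nonvanishing on $W$, and that all the coefficients $a_k,b_k,c_k$ are bounded on $W$ by $\sqrt{D_0}$, i.e. the functions $|a_k/\sqrt{D_0}|$, $|b_k/\sqrt{D_0}|$, $|c_k/\sqrt{D_0}|$ are bounded on $W$ for all $k$. Then there are a neighbourhood $U_0\subset X$ of $x_0$ and a sectorial domain $S_0\subset S$ with the same opening $A$ such that the Riccati equation has a unique pair of holomorphic solutions $f_\pm$ on $U_0\times S_0$ which are Gevrey asymptotic to the formal solutions $\hat f_\pm$ as $\hbar\to0$ along the closed arc $\bar A$, uniformly for all $x\in U_0$. Moreover, $f_\pm$ is the uniform Borel resummation of the formal solution $\hat f_\pm$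 (in the direction $\theta=0$) on $U_0 \times S_0$: $f_\pm=\mathcal{S}[\hat f_\pm]$.
   Context: Sectorial domains. Let $[\mathbb{C}_\hbar:0]=[0,\infty)\times(\mathbb{R}/2\pi\mathbb{Z})$ be the real-oriented blowup of $\mathbb{C}_\hbar$ at $0$ (polar coordinates). A sectorial domain with opening $A$ is a simply connected domain $S\subset\mathbb{C}_\hbar\setminus\{0\}$ whose closure in $[\mathbb{C}_\hbar:0]$ meets the circle $\{0\}\times\mathbb{R}/2\pi\mathbb{Z}$ in the closed arc $\bar A$, of nonzero length; $A$ is the corresponding open arc. Strip neighbourhood. "$W$ is mapped by $\Phi$ to $H$" means: the local inverse of $\Phi$ near $0=\Phi(x_0)$ continues analytically to a holomorphic map $\Psi:H\to X$ with $\Psi(0)=x_0$, and $W=\Psi(H)$. Then $\Psi$ is a local biholomorphism, $D_0$ has no zeros on $W$, and $\sqrt{D_0}$ extends to a univalued holomorphic function on $W$. Formal solutions. $f_0^\pm:=\frac{-b_0\pm\sqrt{D_0}}{2a_0}$, and $\hat f_\pm=\sum_{k\ge0}f_k^\pm(x)\hbar^k$ is the unique formal power series with holomorphic coefficients solving the Riccati equation order by order in $\hbar$ with leading term $f_0^\pm$. Gevrey asymptotics. $f\simeq\hat f$ as $\hbar\to0$ along $\bar A$ uniformly for $x\in U_0$ means: there are $C,M>0$ such that $\big|f(x,\hbar)-\sum_{k=0}^{n-1}f_k(x)\hbar^k\big|\le CM^n n!\,|\hbar|^n$ for all $n\ge0$, all $x\in U_0$ and all sufficiently small $\hbar\in S_0$.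 Uniform Borel resummation. $f=\mathcal{S}[\hat f]$ uniformly on $U_0$ means: the formal Borel transform $\hat\phi(x,\xi)=\sum_{k\ge0}\frac{1}{k!}f_{k+1}(x)\xi^k$ converges uniformly for $x \in U_0$ and $\xi$ in some disc around $0$; it continues analytically to a holomorphic function $\phi$ on $U_0\times\Xi$ for some tubular neighbourhood $\Xi=\{\xi:\operatorname{dist}(\xi,\mathbb{R}_+)<\epsilon\}$ with $|\phi(x,\xi)|\le Ke^{L|\xi|}$ on $U_0\times\Xi$ for some constants $K,L>0$; and $f(x,\hbar)=f_0(x)+\int_0^{+\infty}e^{-\xi/\hbar}\phi(x,\xi)\,d\xi$, the integral converging uniformly for $x\in U_0$.
   Formalization: The sectorial domain S is additionally assumed to contain a Borel disc {Re(1/ħ) > 1/R} for some R > 0; without such a condition S can be so thin near arg ħ = ±π/2 that uniqueness of the Gevrey-asymptotic solutions fails. *)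

theory Defs
  imports
    "HOL-Complex_Analysis.Complex_Analysis"
    "HOL-Computational_Algebra.Computational_Algebra"
begin

text \<open>The real-oriented blowup of the plane at 0 is modelled as
  \<open>{0..} \<times> sphere 0 1\<close> inside \<open>real \<times> complex\<close>, the unit circle playing the role of
  R/2 pi Z. As this is a closed set, closures may be taken in \<open>real \<times> complex\<close>.\<close>

definition blowup_lift :: "complex \<Rightarrow> real \<times> complex" where
  "blowup_lift z = (norm z, sgn z)"

text \<open>The opening is the open arc from angle \<open>\<alpha>\<close> to angle \<open>\<beta>\<close>.
  Library simple connectedness includes path-connectedness.\<close>

definition sectorial_domain :: "complex set \<Rightarrow> real \<Rightarrow> real \<Rightarrow> bool" where
  "sectorial_domain S \<alpha> \<beta> \<longleftrightarrow>
     open S \<and> simply_connected S \<and> 0 \<notin> S \<and> \<alpha> < \<beta> \<and> \<beta> \<le> \<alpha> + 2 * pi \<and>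
     closure (blowup_lift ` S) \<inter> ({0} \<times> sphere 0 1) = {0} \<times> cis ` {\<alpha>..\<beta>}"

definition Borel_disc :: "real \<Rightarrow> complex set" where
  "Borel_disc R = {h. Re (1 / h) > 1 / R}"

text \<open>A polynomial in the small parameter whose coefficients are holomorphic functions on
  \<open>X\<close>, given as a family of polynomials indexed by the points of \<open>X\<close>.\<close>

definition holomorphic_poly_on :: "(complex \<Rightarrow> complex poly) \<Rightarrow> complex set \<Rightarrow> bool" where
  "holomorphic_poly_on a X \<longleftrightarrow>
     (\<forall>k. (\<lambda>x. coeff (a x) k) holomorphic_on X) \<and> (\<exists>N. \<forall>x\<in>X. degree (a x) \<le> N)"

definition disc0 ::
  "(complex \<Rightarrow> complex poly) \<Rightarrow> (complex \<Rightarrow> complex poly) \<Rightarrow> (complex \<Rightarrow> complex poly) \<Rightarrow>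
   complex \<Rightarrow> complex" where
  "disc0 a b c x = (coeff (b x) 0)\<^sup>2 - 4 * coeff (a x) 0 * coeff (c x) 0"

definition horizontal_strip :: "real \<Rightarrow> complex set" where
  "horizontal_strip r = {z. - r < Im z \<and> Im z < r}"

text \<open>\<open>W\<close> is mapped to \<open>H\<close> by \<open>\<Phi>\<close>, where only the germ of \<open>\<Phi>\<close> at \<open>x0\<close> matters and
  \<open>\<Phi> x0 = 0\<close>.\<close>

definition mapped_onto ::
  "complex set \<Rightarrow> (complex \<Rightarrow> complex) \<Rightarrow> complex \<Rightarrow> complex set \<Rightarrow> complex set \<Rightarrow> bool" where
  "mapped_onto X \<Phi> x0 W H \<longleftrightarrow>
     (\<exists>\<Psi>. \<Psi> holomorphic_on H \<and> \<Psi> ` H \<subseteq> X \<and> \<Psi> 0 = x0 \<and>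
          (\<forall>\<^sub>F z in nhds 0. \<Phi> (\<Psi> z) = z) \<and> W = \<Psi> ` H)"

text \<open>Joint holomorphy in two variables: complex-linear Frechet derivative.\<close>

definition holomorphic2_on :: "(complex \<times> complex \<Rightarrow> complex) \<Rightarrow> (complex \<times> complex) set \<Rightarrow> bool" where
  "holomorphic2_on f D \<longleftrightarrow>
     (\<forall>p\<in>D. \<exists>A B. (f has_derivative (\<lambda>(u, v). A * u + B * v)) (at p within D))"

definition Riccati_solution ::
  "(complex \<Rightarrow> complex poly) \<Rightarrow> (complex \<Rightarrow> complex poly) \<Rightarrow> (complex \<Rightarrow> complex poly) \<Rightarrow>
   complex set \<Rightarrow> complex set \<Rightarrow> (complex \<times> complex \<Rightarrow> complex) \<Rightarrow> bool" where
  "Riccati_solution a b c U S f \<longleftrightarrow>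
     holomorphic2_on f (U \<times> S) \<and>
     (\<forall>x\<in>U. \<forall>h\<in>S. h * deriv (\<lambda>y. f (y, h)) x =
        poly (a x) h * (f (x, h))\<^sup>2 + poly (b x) h * f (x, h) + poly (c x) h)"

text \<open>A formal power series in the small parameter is the sequence of its coefficients;
  \<open>fps_X\<close> stands for the small parameter.\<close>

definition formal_Riccati_solution ::
  "(complex \<Rightarrow> complex poly) \<Rightarrow> (complex \<Rightarrow> complex poly) \<Rightarrow> (complex \<Rightarrow> complex poly) \<Rightarrow>
   complex set \<Rightarrow> (complex \<Rightarrow> complex) \<Rightarrow> (nat \<Rightarrow> complex \<Rightarrow> complex) \<Rightarrow> bool" where
  "formal_Riccati_solution a b c U f0 F \<longleftrightarrow>
     (\<forall>k. F k holomorphic_on U) \<and> (\<forall>x\<in>U. F 0 x = f0 x) \<and>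
     (\<forall>x\<in>U. fps_X * Abs_fps (\<lambda>k. deriv (F k) x) =
        fps_of_poly (a x) * (Abs_fps (\<lambda>k. F k x))\<^sup>2
        + fps_of_poly (b x) * Abs_fps (\<lambda>k. F k x) + fps_of_poly (c x))"

definition the_formal_Riccati_solution ::
  "(complex \<Rightarrow> complex poly) \<Rightarrow> (complex \<Rightarrow> complex poly) \<Rightarrow> (complex \<Rightarrow> complex poly) \<Rightarrow>
   complex set \<Rightarrow> (complex \<Rightarrow> complex) \<Rightarrow> (nat \<Rightarrow> complex \<Rightarrow> complex) \<Rightarrow> bool" where
  "the_formal_Riccati_solution a b c U f0 F \<longleftrightarrow>
     formal_Riccati_solution a b c U f0 F \<and>
     (\<forall>G. formal_Riccati_solution a b c U f0 G \<longrightarrow> (\<forall>k. \<forall>x\<in>U. G k x = F k x))"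

definition Gevrey_asymptotic ::
  "(complex \<times> complex \<Rightarrow> complex) \<Rightarrow> (nat \<Rightarrow> complex \<Rightarrow> complex) \<Rightarrow> complex set \<Rightarrow> complex set \<Rightarrow> bool" where
  "Gevrey_asymptotic f F U S \<longleftrightarrow>
     (\<exists>C>0. \<exists>M>0. \<exists>\<delta>>0. \<forall>n. \<forall>x\<in>U. \<forall>h\<in>S. norm h < \<delta> \<longrightarrow>
        norm (f (x, h) - (\<Sum>k<n. F k x * h ^ k)) \<le> C * M ^ n * fact n * norm h ^ n)"

definition tube :: "real \<Rightarrow> complex set" where
  "tube \<epsilon> = {\<xi>. infdist \<xi> (complex_of_real ` {0..}) < \<epsilon>}"

text \<open>Uniform Borel resummation in the direction 0. The radius \<open>\<rho>\<close> of the disc of convergence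
  is taken to be at most \<open>\<epsilon>\<close>, so that the disc lies inside the tube; this loses nothing since
  \<open>\<rho>\<close> may be decreased. The last clause contains both the uniform convergence of the
  Laplace integral and the value of its limit.\<close>

definition uniform_Borel_resummation ::
  "(complex \<times> complex \<Rightarrow> complex) \<Rightarrow> (nat \<Rightarrow> complex \<Rightarrow> complex) \<Rightarrow> complex set \<Rightarrow> complex set \<Rightarrow> bool" where
  "uniform_Borel_resummation f F U S \<longleftrightarrow>
     (\<exists>\<phi> \<epsilon> \<rho> K L. 0 < \<rho> \<and> \<rho> \<le> \<epsilon> \<and> 0 < K \<and> 0 < L \<and>
        uniform_limit (U \<times> ball 0 \<rho>) (\<lambda>n (x, \<xi>). \<Sum>k<n. F (Suc k) x / fact k * \<xi> ^ k) \<phi> sequentially \<and>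
        holomorphic2_on \<phi> (U \<times> tube \<epsilon>) \<and>
        (\<forall>x\<in>U. \<forall>\<xi>\<in>tube \<epsilon>. norm (\<phi> (x, \<xi>)) \<le> K * exp (L * norm \<xi>)) \<and>
        (\<forall>h\<in>S. uniform_limit U
           (\<lambda>T x. F 0 x + integral {0..T} (\<lambda>t. exp (- complex_of_real t / h) * \<phi> (x, complex_of_real t)))
           (\<lambda>x. f (x, h)) at_top))"

end

theory Submission
  imports Defs
begin

text \<open>
In the coordinate \<open>z = \<Phi> x\<close> the equation becomes \<open>h g' = A g\<^sup>2 + B g + C\<close> on a horizontal
strip. The coefficients \<open>A\<^sub>k = \<Psi>' a\<^sub>k(\<Psi>)\<close>, and likewise \<open>B\<^sub>k\<close> and \<open>C\<^sub>k\<close>, are bounded there and the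
leading discriminant \<open>B\<^sub>0\<^sup>2 - 4 A\<^sub>0 C\<^sub>0\<close> is 1. The reflection \<open>z \<mapsto> -z\<close> exchanges the two leading
roots, so it is enough to treat the root \<open>f0\<close> with \<open>2 A\<^sub>0 f0 + B\<^sub>0 = 1\<close>.

Bounded coefficients do not make \<open>f0\<close> bounded, because \<open>A\<^sub>0\<close> may come arbitrarily close to zero.
The remedy is projective. The substitution \<open>v = E\<^sup>2 y / (1 + A\<^sub>0 y)\<close> with \<open>y = g - f0\<close> sends \<open>f0\<close> to 0 and
the other leading root to infinity, and for \<open>E' = - A\<^sub>0 f0' E\<close> it gives
\<open>h v' = v + h (\<alpha> v\<^sup>2 + \<beta> v + \<gamma>)\<close> (\<open>Moebius_to_Riccati\<close>). The pair \<open>(E, E f0)\<close> solves a linear system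
with bounded coefficients. Hence the logarithm of \<open>\<tau> = |E|\<^sup>2 (1 + |f0|\<^sup>2)\<close> is Lipschitz, and relative
to this weight the new coefficients are bounded: \<open>\<gamma> = O(\<tau>)\<close>, \<open>\<beta> = O(1)\<close>, \<open>\<alpha> = O(1/\<tau>)\<close>
(\<open>\<tau>_log_Lipschitz\<close>, \<open>coeffs_bound\<close>).

Write \<open>v\<close> as the Laplace integral of a function \<open>\<phi>(z, \<xi>)\<close>. Integration along the characteristics
\<open>z + \<xi> = const\<close> turns the equation for \<open>\<phi>\<close> into a fixed point problem with convolutions in \<open>\<xi>\<close>.
The norm with weight \<open>\<tau>(z) exp(L |\<xi>|) / (1 + |\<xi>|\<^sup>2)\<close> is submultiplicative under convolution up to
a constant, and the Lipschitz property of \<open>ln \<tau>\<close> lets the factor \<open>exp(L |\<xi>|)\<close> absorb the shift in \<open>z\<close>.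
So the problem is a contraction for large \<open>L\<close> (\<open>Borel_solution_exists\<close>). Fubini's theorem on a
triangle leads back from \<open>\<phi>\<close> to the differential equation (\<open>Laplace_solves_Riccati\<close>).
Near \<open>z = 0\<close> the substitution is undone by a linear convolution equation
(\<open>linear_convolution_equation\<close>), which puts \<open>g - f0\<close> itself into the form of a Laplace integral
(\<open>local_Borel_solution\<close>).

Holomorphy and exponential growth on a tube give the Gevrey estimates on a Borel disc, by repeated
integration by parts (\<open>Borel_sum_Gevrey\<close>). The asymptotic expansion of an exact solution is a
formal solution, and the recursion for the coefficients has at most one solution
(\<open>formal_Riccati_solution_of_Gevrey\<close>, \<open>formal_Riccati_solution_unique\<close>). Finally, two functions on a
Borel disc with the same Gevrey expansion differ by \<open>O(exp(-c / |h|))\<close>, and such a function vanishes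
(\<open>exponential_decay_halfplane_zero\<close>, \<open>Gevrey_asymptotic_unique\<close>).
\<close>

section \<open>Holomorphic functions of two variables\<close>

text \<open>Cauchy's formula on a fixed circle expresses the derivative as an integral that
  depends continuously on the parameter and the point.\<close>

lemma continuous_deriv_param:
  fixes f :: "'a::metric_space \<Rightarrow> complex \<Rightarrow> complex"
  assumes U: "open U" and cont: "continuous_on (T \<times> U) (\<lambda>(t, x). f t x)"
    and hol: "\<And>t. t \<in> T \<Longrightarrow> f t holomorphic_on U"
  shows "continuous_on (T \<times> U) (\<lambda>(t, x). deriv (f t) x)"
proof -
  have *: "continuous (at (t0, x0) within T \<times> U) (\<lambda>(t, x). deriv (f t) x)"
    if t0: "t0 \<in> T" and x0: "x0 \<in> U" for t0 x0
  proof -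
    obtain e where e: "e > 0" "cball x0 e \<subseteq> U"
      using U x0 open_contains_cball by blast
    define I where "I = (\<lambda>p s. f (fst p) (circlepath x0 e s) / (circlepath x0 e s - snd p)\<^sup>2
        * (2 * pi * \<i> * e * exp (2 * of_real pi * \<i> * of_real s)))"
    have circ: "circlepath x0 e s \<in> sphere x0 e" for s
      using e by (simp add: circlepath dist_norm norm_mult)
    have eq: "deriv (f t) x = 1 / (2 * of_real pi * \<i>) * integral {0..1} (I (t, x))"
      if "t \<in> T" "x \<in> ball x0 e" for t x
    proof -
      have "f t holomorphic_on cball x0 e"
        using hol[OF that(1)] e(2) holomorphic_on_subset by blast
      then have c: "continuous_on (cball x0 e) (f t)" and h: "f t holomorphic_on ball x0 e"
        by (auto intro: holomorphic_on_imp_continuous_on holomorphic_on_subset)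
      have "deriv (f t) x = 1 / (2 * of_real pi * \<i>) *
          contour_integral (circlepath x0 e) (\<lambda>u. f t u / (u - x)^2)"
        by (intro DERIV_imp_deriv Cauchy_derivative_integral_circlepath(2)[OF c h that(2)])
      then show ?thesis
        by (simp add: contour_integral_integral vector_derivative_circlepath I_def)
    qed
    have "continuous_on ((T \<times> ball x0 e) \<times> cbox 0 (1::real)) (\<lambda>(p, s). I p s)"
    proof -
      have "continuous_on ((T \<times> ball x0 e) \<times> cbox 0 (1::real)) ((\<lambda>(t, x). f t x) \<circ>
           (\<lambda>q. (fst (fst q), circlepath x0 e (snd q))))"
        unfolding circlepath
        apply (intro continuous_on_compose continuous_intros)
        apply (rule continuous_on_subset[OF cont])
        using e(2) circ[unfolded circlepath] by (force simp: )
      then have 1: "continuous_on ((T \<times> ball x0 e) \<times> cbox 0 (1::real))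
           (\<lambda>q. f (fst (fst q)) (circlepath x0 e (snd q)))"
        by (simp add: o_def)
      have 2: "circlepath x0 e s - x \<noteq> 0" if "x \<in> ball x0 e" for s x
        using circ[of s] that by auto
      show ?thesis
        unfolding I_def split_beta
        by (intro continuous_intros 1) (use 2 in \<open>auto simp: circlepath intro!: continuous_intros\<close>)
    qed
    from integral_continuous_on_param[OF this]
    have "continuous_on (T \<times> ball x0 e)
       (\<lambda>p. 1 / (2 * of_real pi * \<i>) * integral {0..1} (I p))"
      by (intro continuous_intros) auto
    then have "continuous_on (T \<times> ball x0 e) (\<lambda>(t, x). deriv (f t) x)"
      by (rule continuous_on_eq) (auto simp: eq)
    then have "continuous (at (t0, x0) within T \<times> ball x0 e) (\<lambda>(t, x). deriv (f t) x)"
      using t0 e(1) by (auto simp: continuous_on_eq_continuous_within)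
    moreover have "at (t0, x0) within T \<times> ball x0 e = at (t0, x0) within T \<times> U"
      by (rule at_within_nhd[where S = "UNIV \<times> ball x0 e"])
         (use e in \<open>auto intro!: open_Times\<close>)
    ultimately show ?thesis by simp
  qed
  then show ?thesis by (auto simp: continuous_on_eq_continuous_within)
qed

lemma holomorphic2_onI_open:
  assumes "\<And>x y. (x, y) \<in> D \<Longrightarrow> \<exists>A B. (f has_derivative (\<lambda>(u, v). A * u + B * v)) (at (x, y))"
  shows "holomorphic2_on f D"
  unfolding holomorphic2_on_def using assms by (metis has_derivative_at_withinI surj_pair)

lemma holomorphic2_on_subset:
  "holomorphic2_on f D \<Longrightarrow> D' \<subseteq> D \<Longrightarrow> holomorphic2_on f D'"
  unfolding holomorphic2_on_def by (meson has_derivative_subset subsetD)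

lemma holomorphic2_on_cong:
  assumes "holomorphic2_on f D" "\<And>p. p \<in> D \<Longrightarrow> f p = g p"
  shows "holomorphic2_on g D"
  using assms unfolding holomorphic2_on_def by (metis has_derivative_transform)

lemma holomorphic2_on_imp_continuous_on:
  "holomorphic2_on f D \<Longrightarrow> continuous_on D f"
  unfolding holomorphic2_on_def
  by (meson continuous_on_eq_continuous_within has_derivative_continuous)

text \<open>Osgood's lemma. Joint continuity makes one partial derivative jointly continuous, and
  this together with the existence of the other one gives complex differentiability in both
  variables.\<close>

lemma osgood:
  assumes D: "open D" and cont: "continuous_on D f"
    and h1: "\<And>x y. (x, y) \<in> D \<Longrightarrow> (\<lambda>x. f (x, y)) field_differentiable (at x)"
    and h2: "\<And>x y. (x, y) \<in> D \<Longrightarrow> (\<lambda>y. f (x, y)) field_differentiable (at y)"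
  shows "holomorphic2_on f D"
proof (rule holomorphic2_onI_open)
  fix x0 y0 assume p: "(x0, y0) \<in> D"
  obtain U V where UV: "open U" "open V" "x0 \<in> U" "y0 \<in> V" "U \<times> V \<subseteq> D"
    using D p by (rule open_prod_elim) auto
  obtain e where e: "e > 0" "ball y0 e \<subseteq> V" using UV open_contains_ball by blast
  let ?V = "ball y0 e"
  have sub: "U \<times> ?V \<subseteq> D" using UV e by auto
  have c: "continuous_on (U \<times> ?V) (\<lambda>(x, y). deriv (\<lambda>y. f (x, y)) y)"
  proof (rule continuous_deriv_param)
    show "continuous_on (U \<times> ?V) (\<lambda>(t, x). f (t, x))"
      using continuous_on_subset[OF cont sub] by simp
    show "(\<lambda>y. f (t, y)) holomorphic_on ?V" if "t \<in> U" for t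
      unfolding holomorphic_on_def
    proof
      fix x assume "x \<in> ?V"
      then have "(t, x) \<in> D" using sub that by auto
      then show "(\<lambda>y. f (t, y)) field_differentiable at x within ?V"
        by (rule field_differentiable_at_within[OF h2])
    qed
  qed auto
  have "((\<lambda>(x, y). f (x, y)) has_derivative
       (\<lambda>(tx, ty). deriv (\<lambda>x. f (x, y0)) x0 * tx + blinfun_apply (blinfun_mult_right (deriv (\<lambda>y. f (x0, y)) y0)) ty))
       (at (x0, y0) within U \<times> ?V)"
  proof (rule has_derivative_partialsI)
    show "((\<lambda>x. f (x, y0)) has_derivative (*) (deriv (\<lambda>x. f (x, y0)) x0)) (at x0 within U)"
      using h1[OF p] field_differentiable_derivI has_field_derivative_def
      by (blast intro: has_derivative_at_withinI)
    show "((\<lambda>y. f (x, y)) has_derivative blinfun_apply (blinfun_mult_right (deriv (\<lambda>y. f (x, y)) y)))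
        (at y within ?V)" if "x \<in> U" "y \<in> ?V" for x y
    proof -
      have "((\<lambda>y. f (x, y)) has_field_derivative (deriv (\<lambda>y. f (x, y)) y)) (at y)"
        using h2[of x y] sub that field_differentiable_derivI by blast
      then show ?thesis
        by (simp add: has_field_derivative_def has_derivative_at_withinI blinfun_mult_right.rep_eq)
    qed
    have "continuous (at (x0, y0) within U \<times> ?V) (\<lambda>(x, y). deriv (\<lambda>y. f (x, y)) y)"
      using c UV e by (auto simp: continuous_on_eq_continuous_within)
    from bounded_linear.continuous[OF bounded_linear_blinfun_mult_right this]
    show "continuous (at (x0, y0) within U \<times> ?V) (\<lambda>(x, y). blinfun_mult_right (deriv (\<lambda>y. f (x, y)) y))"
      by (simp add: case_prod_unfold)
  qed (use e in auto)
  moreover have "at (x0, y0) within U \<times> ?V = at (x0, y0)"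
    using UV e by (intro at_within_open open_Times) auto
  ultimately show "\<exists>A B. (f has_derivative (\<lambda>(u, v). A * u + B * v)) (at (x0, y0))"
    by (auto simp: blinfun_mult_right.rep_eq)
qed

lemma holomorphic2_onE:
  assumes "holomorphic2_on f D" "p \<in> D"
  obtains A B where "(f has_derivative (\<lambda>w. A * fst w + B * snd w)) (at p within D)"
proof -
  from assms obtain A B where "(f has_derivative (\<lambda>(u, v). A * u + B * v)) (at p within D)"
    unfolding holomorphic2_on_def by blast
  then have "(f has_derivative (\<lambda>w. A * fst w + B * snd w)) (at p within D)"
    by (simp add: case_prod_unfold)
  then show ?thesis by (rule that)
qed

lemma holomorphic2_onI:
  assumes "\<And>p. p \<in> D \<Longrightarrow> \<exists>A B. (f has_derivative (\<lambda>w. A * fst w + B * snd w)) (at p within D)"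
  shows "holomorphic2_on f D"
  using assms unfolding holomorphic2_on_def split_beta by blast

named_theorems hol2_intros

lemma holomorphic2_on_fst [hol2_intros]: "holomorphic2_on fst D"
proof (rule holomorphic2_onI)
  fix p :: "complex \<times> complex"
  have "(fst has_derivative (\<lambda>w. 1 * fst w + 0 * snd w)) (at p within D)"
    by (auto intro!: derivative_eq_intros)
  then show "\<exists>A B. (fst has_derivative (\<lambda>w. A * fst w + B * snd w)) (at p within D)" by blast
qed

lemma holomorphic2_on_snd [hol2_intros]: "holomorphic2_on snd D"
proof (rule holomorphic2_onI)
  fix p :: "complex \<times> complex"
  have "(snd has_derivative (\<lambda>w. 0 * fst w + 1 * snd w)) (at p within D)"
    by (auto intro!: derivative_eq_intros)
  then show "\<exists>A B. (snd has_derivative (\<lambda>w. A * fst w + B * snd w)) (at p within D)" by blast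
qed

lemma holomorphic2_on_compose:
  assumes g: "holomorphic2_on g D'" and p: "holomorphic2_on p D" and q: "holomorphic2_on q D"
    and sub: "\<And>w. w \<in> D \<Longrightarrow> (p w, q w) \<in> D'"
  shows "holomorphic2_on (\<lambda>w. g (p w, q w)) D"
proof (rule holomorphic2_onI)
  fix w assume w: "w \<in> D"
  obtain A B where AB: "(p has_derivative (\<lambda>w. A * fst w + B * snd w)) (at w within D)"
    using holomorphic2_onE[OF p w] .
  obtain A' B' where AB': "(q has_derivative (\<lambda>w. A' * fst w + B' * snd w)) (at w within D)"
    using holomorphic2_onE[OF q w] .
  obtain A2 B2 where AB2: "(g has_derivative (\<lambda>w. A2 * fst w + B2 * snd w)) (at (p w, q w) within D')"
    using holomorphic2_onE[OF g sub[OF w]] .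
  have "((\<lambda>w. g (p w, q w)) has_derivative (\<lambda>w. (\<lambda>w. A2 * fst w + B2 * snd w)
         (A * fst w + B * snd w, A' * fst w + B' * snd w))) (at w within D)"
    by (rule has_derivative_in_compose[OF has_derivative_Pair[OF AB AB'] has_derivative_subset[OF AB2]])
       (use sub in auto)
  then have "((\<lambda>w. g (p w, q w)) has_derivative
      (\<lambda>w. (A2 * A + B2 * A') * fst w + (A2 * B + B2 * B') * snd w)) (at w within D)"
    by (simp add: algebra_simps)
  then show "\<exists>A B. ((\<lambda>w. g (p w, q w)) has_derivative (\<lambda>w. A * fst w + B * snd w)) (at w within D)"
    by blast
qed

lemma holomorphic2_on_compose1:
  assumes g: "g holomorphic_on U" and U: "open U" and p: "holomorphic2_on p D"
    and sub: "\<And>w. w \<in> D \<Longrightarrow> p w \<in> U"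
  shows "holomorphic2_on (\<lambda>w. g (p w)) D"
proof (rule holomorphic2_onI)
  fix w assume w: "w \<in> D"
  obtain A B where AB: "(p has_derivative (\<lambda>w. A * fst w + B * snd w)) (at w within D)"
    using holomorphic2_onE[OF p w] .
  have "(g has_derivative (*) (deriv g (p w))) (at (p w))"
    using holomorphic_derivI[OF g U sub[OF w]] by (simp add: has_field_derivative_def)
  from has_derivative_compose[OF AB this]
  have "((\<lambda>w. g (p w)) has_derivative
      (\<lambda>x. (deriv g (p w) * A) * fst x + (deriv g (p w) * B) * snd x)) (at w within D)"
    by (simp add: algebra_simps)
  then show "\<exists>A B. ((\<lambda>w. g (p w)) has_derivative (\<lambda>w. A * fst w + B * snd w)) (at w within D)"
    by blast
qed

lemma holomorphic2_on_const [hol2_intros]: "holomorphic2_on (\<lambda>_. c) D"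
  using holomorphic2_on_compose1[of "\<lambda>_. c" UNIV fst D] by (simp add: holomorphic2_on_fst)

lemma holomorphic2_on_add_aux: "holomorphic2_on (\<lambda>w. fst w + snd w) UNIV"
proof (rule holomorphic2_onI)
  fix p :: "complex \<times> complex"
  have "((\<lambda>w. fst w + snd w) has_derivative (\<lambda>w. 1 * fst w + 1 * snd w)) (at p)"
    by (auto intro!: derivative_eq_intros)
  then show "\<exists>A B. ((\<lambda>w. fst w + snd w) has_derivative (\<lambda>w. A * fst w + B * snd w)) (at p)" by blast
qed

lemma holomorphic2_on_mult_aux: "holomorphic2_on (\<lambda>w. fst w * snd w) UNIV"
proof (rule holomorphic2_onI)
  fix p :: "complex \<times> complex"
  have "((\<lambda>w. fst w * snd w) has_derivative (\<lambda>w. snd p * fst w + fst p * snd w)) (at p)"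
    by (auto intro!: derivative_eq_intros simp: algebra_simps)
  then show "\<exists>A B. ((\<lambda>w. fst w * snd w) has_derivative (\<lambda>w. A * fst w + B * snd w)) (at p)" by blast
qed

lemma holomorphic2_on_add [hol2_intros]:
  "holomorphic2_on f D \<Longrightarrow> holomorphic2_on g D \<Longrightarrow> holomorphic2_on (\<lambda>w. f w + g w) D"
  using holomorphic2_on_compose[OF holomorphic2_on_add_aux, of f D g] by simp

lemma holomorphic2_on_mult [hol2_intros]:
  "holomorphic2_on f D \<Longrightarrow> holomorphic2_on g D \<Longrightarrow> holomorphic2_on (\<lambda>w. f w * g w) D"
  using holomorphic2_on_compose[OF holomorphic2_on_mult_aux, of f D g] by simp

lemma holomorphic2_on_minus [hol2_intros]:
  "holomorphic2_on f D \<Longrightarrow> holomorphic2_on (\<lambda>w. - f w) D"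
  using holomorphic2_on_mult[OF holomorphic2_on_const[of "-1"], of f D] by simp

lemma holomorphic2_on_diff [hol2_intros]:
  "holomorphic2_on f D \<Longrightarrow> holomorphic2_on g D \<Longrightarrow> holomorphic2_on (\<lambda>w. f w - g w) D"
  using holomorphic2_on_add[OF _ holomorphic2_on_minus, of f D g] by simp

lemma holomorphic2_on_power [hol2_intros]:
  "holomorphic2_on f D \<Longrightarrow> holomorphic2_on (\<lambda>w. f w ^ n) D"
  by (induction n) (auto intro: holomorphic2_on_const holomorphic2_on_mult)

lemma holomorphic2_on_sum [hol2_intros]:
  "(\<And>i. i \<in> I \<Longrightarrow> holomorphic2_on (f i) D) \<Longrightarrow> holomorphic2_on (\<lambda>w. \<Sum>i\<in>I. f i w) D"
  by (induction I rule: infinite_finite_induct) (auto intro: holomorphic2_on_const holomorphic2_on_add)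

lemma holomorphic2_on_curve:
  assumes f: "holomorphic2_on f D" and g: "g holomorphic_on U" and h: "h holomorphic_on U"
    and sub: "\<And>t. t \<in> U \<Longrightarrow> (g t, h t) \<in> D"
  shows "(\<lambda>t. f (g t, h t)) holomorphic_on U"
proof (rule holomorphic_onI)
  fix t assume t: "t \<in> U"
  obtain A B where AB: "(f has_derivative (\<lambda>w. A * fst w + B * snd w)) (at (g t, h t) within D)"
    using holomorphic2_onE[OF f sub[OF t]] .
  obtain g' where g': "(g has_derivative (*) g') (at t within U)"
    using g t by (auto simp: holomorphic_on_def field_differentiable_def has_field_derivative_def)
  obtain h' where h': "(h has_derivative (*) h') (at t within U)"
    using h t by (auto simp: holomorphic_on_def field_differentiable_def has_field_derivative_def)
  have "((\<lambda>t. f (g t, h t)) has_derivative (\<lambda>w. (\<lambda>w. A * fst w + B * snd w)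
         (g' * w, h' * w))) (at t within U)"
    by (rule has_derivative_in_compose[OF has_derivative_Pair[OF g' h'] has_derivative_subset[OF AB]])
       (use sub in auto)
  then have "((\<lambda>t. f (g t, h t)) has_derivative (*) (A * g' + B * h')) (at t within U)"
    by (rule has_derivative_eq_rhs) (auto simp: algebra_simps)
  then show "(\<lambda>t. f (g t, h t)) field_differentiable at t within U"
    by (auto simp: field_differentiable_def has_field_derivative_def)
qed

lemma holomorphic2_on_slice1:
  assumes "holomorphic2_on f D" "\<And>t. t \<in> U \<Longrightarrow> (t, y) \<in> D"
  shows "(\<lambda>t. f (t, y)) holomorphic_on U"
  using assms by (intro holomorphic2_on_curve[OF assms(1) holomorphic_on_ident holomorphic_on_const])

lemma holomorphic2_on_slice2:
  assumes "holomorphic2_on f D" "\<And>t. t \<in> U \<Longrightarrow> (x, t) \<in> D"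
  shows "(\<lambda>t. f (x, t)) holomorphic_on U"
  using assms by (intro holomorphic2_on_curve[OF assms(1) holomorphic_on_const holomorphic_on_ident])

lemma holomorphic2_on_integral:
  fixes a b :: real
  assumes D: "open D" and cont: "continuous_on (D \<times> {a..b}) (\<lambda>(p, s). G s p)"
    and hol: "\<And>s. s \<in> {a..b} \<Longrightarrow> holomorphic2_on (G s) D"
  shows "holomorphic2_on (\<lambda>p. integral {a..b} (\<lambda>s. G s p)) D"
proof -
  have slice: "(\<lambda>x. integral (cbox a b) (\<lambda>s. G s (g x, h x))) holomorphic_on ball c e"
    if gh: "g holomorphic_on ball c e" "h holomorphic_on ball c e"
      and sub: "\<And>t. t \<in> ball c e \<Longrightarrow> (g t, h t) \<in> D" for g h c e
  proof -
    have hol': "(\<lambda>x. G s (g x, h x)) holomorphic_on ball c e" if "s \<in> {a..b}" for s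
      by (rule holomorphic2_on_curve[OF hol[OF that] gh sub])
    have "continuous_on ({a..b} \<times> ball c e) ((\<lambda>(p, s). G s p) \<circ> (\<lambda>q. ((g (snd q), h (snd q)), fst q)))"
      apply (intro continuous_on_compose continuous_intros)
        apply (rule continuous_on_compose2[OF holomorphic_on_imp_continuous_on[OF gh(1)]],
            auto intro: continuous_intros)[1]
       apply (rule continuous_on_compose2[OF holomorphic_on_imp_continuous_on[OF gh(2)]],
            auto intro: continuous_intros)[1]
      apply (rule continuous_on_subset[OF cont])
      using sub by auto
    then have c1: "continuous_on ({a..b} \<times> ball c e) (\<lambda>(s, x). G s (g x, h x))"
      by (simp add: o_def split_beta)
    have c2: "continuous_on ({a..b} \<times> ball c e) (\<lambda>(s, x). deriv (\<lambda>x. G s (g x, h x)) x)"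
      by (rule continuous_deriv_param[OF _ c1 hol']) auto
    show ?thesis
    proof (rule leibniz_rule_holomorphic)
      show "((\<lambda>x. G t (g x, h x)) has_field_derivative deriv (\<lambda>x. G t (g x, h x)) x) (at x within ball c e)"
        if "x \<in> ball c e" "t \<in> cbox a b" for x t
        using holomorphic_derivI[OF hol' _ that(1)] that(2) has_field_derivative_at_within by auto
      show "(\<lambda>s. G s (g x, h x)) integrable_on cbox a b" if "x \<in> ball c e" for x
      proof -
        have "continuous_on (cbox a b) (\<lambda>s. (\<lambda>(s, x). G s (g x, h x)) (s, x))"
          by (rule continuous_on_compose2[OF c1]) (use that in \<open>auto intro!: continuous_intros\<close>)
        then show ?thesis by (intro integrable_continuous) simp
      qed
      have "continuous_on (ball c e \<times> {a..b}) ((\<lambda>(s, x). deriv (\<lambda>x. G s (g x, h x)) x) \<circ> (\<lambda>q. (snd q, fst q)))"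
        by (intro continuous_on_compose continuous_intros continuous_on_subset[OF c2]) auto
      then show "continuous_on (ball c e \<times> cbox a b) (\<lambda>(x, t). deriv (\<lambda>x. G t (g x, h x)) x)"
        by (simp add: o_def split_beta)
    qed auto
  qed
  show ?thesis
  proof (rule osgood[OF D])
    show "continuous_on D (\<lambda>p. integral {a..b} (\<lambda>s. G s p))"
      using integral_continuous_on_param[of D a b "\<lambda>p s. G s p"] cont by simp
  next
    fix x y assume "(x, y) \<in> D"
    then obtain U V where UV: "open U" "open V" "x \<in> U" "y \<in> V" "U \<times> V \<subseteq> D"
      using D by (metis mem_Sigma_iff open_prod_elim)
    obtain e where e: "e > 0" "ball x e \<subseteq> U" using UV open_contains_ball by blast
    have "(\<lambda>x. integral (cbox a b) (\<lambda>s. G s (x, y))) holomorphic_on ball x e"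
      by (rule slice) (use UV e in \<open>auto intro: holomorphic_intros\<close>)
    then show "(\<lambda>x. integral {a..b} (\<lambda>s. G s (x, y))) field_differentiable at x"
      using e holomorphic_on_imp_differentiable_at[of _ "ball x e" x] by simp
    obtain e where e: "e > 0" "ball y e \<subseteq> V" using UV open_contains_ball by blast
    have "(\<lambda>y. integral (cbox a b) (\<lambda>s. G s (x, y))) holomorphic_on ball y e"
      by (rule slice) (use UV e in \<open>auto intro: holomorphic_intros\<close>)
    then show "(\<lambda>y. integral {a..b} (\<lambda>s. G s (x, y))) field_differentiable at y"
      using e holomorphic_on_imp_differentiable_at[of _ "ball y e" y] by simp
  qed
qed

text \<open>By Osgood's lemma, the theorem of Weierstrass for one variable, applied to the slices,
  is enough.\<close>

lemma holomorphic2_on_uniform_limit: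
  assumes D: "open D" and hol: "\<And>n::nat. holomorphic2_on (f n) D"
    and lim: "\<And>p. p \<in> D \<Longrightarrow> \<exists>N. open N \<and> p \<in> N \<and> N \<subseteq> D \<and> uniform_limit N f g sequentially"
  shows "holomorphic2_on g D"
proof -
  have slice: "(\<lambda>t. g (a t, b t)) holomorphic_on U"
    if U: "open U" and ab: "a holomorphic_on U" "b holomorphic_on U"
      and sub: "\<And>t. t \<in> U \<Longrightarrow> (a t, b t) \<in> D" for a b U
  proof (rule holomorphic_uniform_sequence[OF U, where f = "\<lambda>n t. f n (a t, b t)"])
    show "(\<lambda>t. f n (a t, b t)) holomorphic_on U" for n
      by (rule holomorphic2_on_curve[OF hol ab sub])
    fix t assume t: "t \<in> U"
    obtain N where N: "open N" "(a t, b t) \<in> N" "N \<subseteq> D" "uniform_limit N f g sequentially"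
      using lim[OF sub[OF t]] by blast
    have "continuous_on U (\<lambda>t. (a t, b t))"
      using ab by (intro continuous_on_Pair holomorphic_on_imp_continuous_on)
    then have "open ((\<lambda>t. (a t, b t)) -` N \<inter> U)"
      using U N(1) continuous_on_open_vimage by blast
    moreover have "t \<in> (\<lambda>t. (a t, b t)) -` N \<inter> U" using t N(2) by simp
    ultimately obtain d where d: "d > 0" "cball t d \<subseteq> (\<lambda>t. (a t, b t)) -` N \<inter> U"
      unfolding open_contains_cball by blast
    then show "\<exists>d>0. cball t d \<subseteq> U \<and>
        uniform_limit (cball t d) (\<lambda>n t. f n (a t, b t)) (\<lambda>t. g (a t, b t)) sequentially"
      using uniform_limit_compose'[OF N(4), of "\<lambda>t. (a t, b t)" "cball t d"]
      by (intro exI[of _ d]) auto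
  qed
  have op: "open {x. (x, y) \<in> D}" "open {y. (x, y) \<in> D}" for x y
    using open_vimage[OF D, of "\<lambda>x. (x, y)"] open_vimage[OF D, of "\<lambda>y. (x, y)"]
    by (auto simp: vimage_def continuous_on_Pair continuous_on_const continuous_on_id)
  show ?thesis
  proof (rule osgood[OF D])
    show "continuous_on D g"
      unfolding continuous_on_eq_continuous_at[OF D]
    proof
      fix p assume "p \<in> D"
      then obtain N where N: "open N" "p \<in> N" "N \<subseteq> D" "uniform_limit N f g sequentially"
        using lim by blast
      have "continuous_on N g"
        by (intro uniform_limit_theorem[OF _ N(4)] always_eventually allI
              continuous_on_subset[OF holomorphic2_on_imp_continuous_on[OF hol] N(3)]) auto
      then show "isCont g p" using N continuous_on_eq_continuous_at by blast
    qed
  next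
    fix x y assume p: "(x, y) \<in> D"
    show "(\<lambda>x. g (x, y)) field_differentiable at x"
      by (rule holomorphic_on_imp_differentiable_at[OF slice[OF op(1)[of y]] op(1)])
         (use p in \<open>auto intro: holomorphic_intros\<close>)
    show "(\<lambda>y. g (x, y)) field_differentiable at y"
      by (rule holomorphic_on_imp_differentiable_at[OF slice[OF op(2)[of x]] op(2)])
         (use p in \<open>auto intro: holomorphic_intros\<close>)
  qed
qed

section \<open>Borel discs and Watson's uniqueness\<close>

lemma Borel_disc_eq_ball:
  assumes "R > 0"
  shows "Borel_disc R = ball (complex_of_real (R / 2)) (R / 2)"
proof (intro set_eqI)
  fix h :: complex
  show "h \<in> Borel_disc R \<longleftrightarrow> h \<in> ball (complex_of_real (R / 2)) (R / 2)"
  proof (cases "h = 0")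
    case True
    then show ?thesis using assms by (simp add: Borel_disc_def)
  next
    case False
    have "(cmod (h - of_real (R / 2)))\<^sup>2 = (cmod h)\<^sup>2 - R * Re h + (R / 2)\<^sup>2"
      unfolding cmod_power2 by (simp add: power2_eq_square algebra_simps)
    moreover have "h \<in> ball (complex_of_real (R / 2)) (R / 2) \<longleftrightarrow>
        (cmod (h - of_real (R / 2)))\<^sup>2 < (R / 2)\<^sup>2"
      using assms power_mono_iff[of "R / 2" "cmod (h - of_real (R / 2))" 2]
      by (auto simp: dist_norm norm_minus_commute not_le[symmetric] simp del: not_le)
    moreover have "h \<in> Borel_disc R \<longleftrightarrow> (cmod h)\<^sup>2 < R * Re h"
    proof -
      have "Re (1 / h) = Re h / (cmod h)\<^sup>2" by (simp add: Re_divide cmod_power2)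
      moreover have "(cmod h)\<^sup>2 > 0" using False by simp
      ultimately show ?thesis
        using assms by (simp add: Borel_disc_def divide_less_eq less_divide_eq mult.commute)
    qed
    ultimately show ?thesis by simp
  qed
qed

lemma Borel_disc_mono: "0 < R \<Longrightarrow> R \<le> R' \<Longrightarrow> Borel_disc R \<subseteq> Borel_disc R'"
proof
  fix h assume R: "0 < R" "R \<le> R'" and h: "h \<in> Borel_disc R"
  have "1 / R' \<le> 1 / R" using R by (simp add: frac_le)
  then show "h \<in> Borel_disc R'" using h unfolding Borel_disc_def by simp
qed

lemma Borel_disc_nz: "h \<in> Borel_disc R \<Longrightarrow> R > 0 \<Longrightarrow> h \<noteq> 0"
  by (auto simp: Borel_disc_def)

lemma Borel_disc_Re_pos: "h \<in> Borel_disc R \<Longrightarrow> R > 0 \<Longrightarrow> Re h > 0"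
proof -
  assume h: "h \<in> Borel_disc R" "R > 0"
  then have "0 < 1 / R" "1 / R < Re (1 / h)" by (auto simp: Borel_disc_def)
  then have "0 < Re (1 / h)" by linarith
  moreover have "Re (1 / h) = Re h / (cmod h)\<^sup>2" by (simp add: Re_divide cmod_power2)
  ultimately show "Re h > 0"
    using zero_le_power2[of "cmod h"] by (simp add: zero_less_divide_iff)
qed

lemma cis_half_circle: "cis ` {- pi / 2..pi / 2} = {u. cmod u = 1 \<and> Re u \<ge> 0}"
proof (intro equalityI subsetI)
  fix u assume "u \<in> {u. cmod u = 1 \<and> Re u \<ge> 0}"
  then have u: "cmod u = 1" "Re u \<ge> 0" "u \<noteq> 0" by auto
  have "\<bar>Im (Ln u)\<bar> \<le> pi / 2" using u Re_Ln_pos_le[of u] by simp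
  moreover have "cis (Im (Ln u)) = u"
    using u(1,3) by (metis Arg_eq_Im_Ln cis_Arg_unique Arg_def cis_Arg norm_one sgn_div_norm div_by_1 scaleR_one inverse_1)
  ultimately show "u \<in> cis ` {- pi / 2..pi / 2}"
    by (intro image_eqI[of _ _ "Im (Ln u)"]) auto
next
  fix u assume "u \<in> cis ` {- pi / 2..pi / 2}"
  then show "u \<in> {u. cmod u = 1 \<and> Re u \<ge> 0}" by (auto intro!: cos_ge_zero)
qed

text \<open>A Borel disc is a round disc tangent to the imaginary axis at 0, so it is approached
  in every direction of the closed right half plane.\<close>

lemma sectorial_domain_Borel_disc:
  assumes R: "R > 0"
  shows "sectorial_domain (Borel_disc R) (- pi / 2) (pi / 2)"
proof -
  let ?B = "blowup_lift ` Borel_disc R"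
  have sub: "?B \<subseteq> {0..} \<times> {u. Re u \<ge> 0}"
    using Borel_disc_Re_pos[OF _ R] by (force simp: blowup_lift_def Re_sgn intro: divide_nonneg_nonneg)
  have "closed ({0::real..} \<times> {u. Re u \<ge> 0})"
    by (intro closed_Times closed_halfspace_Re_ge) auto
  with sub have "closure ?B \<subseteq> {0..} \<times> {u. Re u \<ge> 0}" by (rule closure_minimal)
  then have 1: "closure ?B \<inter> ({0} \<times> sphere 0 1) \<subseteq> {0} \<times> cis ` {- pi / 2..pi / 2}"
    unfolding cis_half_circle by auto
  have inner: "(0, u) \<in> closure ?B" if u: "cmod u = 1" "Re u > 0" for u
    unfolding closure_approachable
  proof (intro allI impI)
    fix e :: real assume e: "e > 0"
    define t where "t = min (e / 2) (R * Re u / 2)"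
    have t: "t > 0" "t < e" "t < R * Re u" using e R u by (auto simp: t_def min_def)
    have "1 / (of_real t * u) = cnj u / of_real t"
      using u complex_div_cnj[of 1 u] by (simp flip: divide_divide_eq_left add: mult.commute)
    then have "Re (1 / (of_real t * u)) = Re u / t" by simp
    moreover have "1 / R < Re u / t" using t R by (simp add: divide_less_eq less_divide_eq mult.commute)
    ultimately have "of_real t * u \<in> Borel_disc R"
      unfolding Borel_disc_def by simp
    moreover have "dist (blowup_lift (of_real t * u)) (0, u) < e"
    proof -
      have "blowup_lift (of_real t * u) = (t, u)"
        using t u by (simp add: blowup_lift_def norm_mult sgn_mult sgn_of_real) (simp add: sgn_div_norm)
      then show ?thesis using t by (simp add: dist_Pair_Pair)
    qed
    ultimately show "\<exists>y\<in>?B. dist y (0, u) < e" by blast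
  qed
  have 2: "(0, u) \<in> closure ?B" if u: "cmod u = 1" "Re u \<ge> 0" for u
  proof -
    have "((\<lambda>s::real. (0::real, sgn (u + of_real s))) \<longlongrightarrow> (0, sgn (u + of_real 0))) (at_right 0)"
      by (intro tendsto_intros) (use u in auto)
    moreover have "sgn (u + of_real 0) = u" using u by (simp add: sgn_div_norm)
    ultimately have "((\<lambda>s::real. (0::real, sgn (u + of_real s))) \<longlongrightarrow> (0, u)) (at_right 0)" by simp
    moreover have "\<forall>\<^sub>F s in at_right 0. (0, sgn (u + of_real s)) \<in> closure ?B"
      unfolding eventually_at_right_field
    proof (intro exI[of _ 1] conjI allI impI)
      fix s :: real assume s: "0 < s" "s < 1"
      then have "Re (u + of_real s) > 0" using u by simp
      then have "u + of_real s \<noteq> 0" by (metis zero_complex.simps(1) less_irrefl)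
      with \<open>Re (u + of_real s) > 0\<close> show "(0, sgn (u + of_real s)) \<in> closure ?B"
        by (intro inner) (auto simp: norm_sgn Re_sgn)
    qed auto
    ultimately show ?thesis
      by (intro Lim_in_closed_set[of "closure ?B"]) auto
  qed
  have 3: "{0} \<times> cis ` {- pi / 2..pi / 2} \<subseteq> closure ?B \<inter> ({0} \<times> sphere 0 1)"
    unfolding cis_half_circle using 2 by auto
  show ?thesis
    unfolding sectorial_domain_def
  proof (intro conjI)
    show "closure ?B \<inter> ({0} \<times> sphere 0 1) = {0} \<times> cis ` {- pi / 2..pi / 2}"
      using 1 3 by blast
    show "simply_connected (Borel_disc R)"
      unfolding Borel_disc_eq_ball[OF R] by (intro convex_imp_simply_connected) simp
    show "open (Borel_disc R)" unfolding Borel_disc_eq_ball[OF R] by simp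
    show "0 \<notin> Borel_disc R" using Borel_disc_nz R by blast
  qed (use pi_gt_zero in linarith)+
qed

text \<open>The harmonic measure of a large half disc gives the boundary parts at distance \<open>\<approx> t\<close>
  the weight \<open>dt / t\<^sup>2\<close>, so \<open>\<integral> |w|\<close> diverges logarithmically in its radius and
  \<open>ln |D| \<le> C - c |w|\<close> on the boundary forces \<open>D = 0\<close> inside. The proof replaces harmonic
  measure by the explicit comparison function \<open>exp (k u (ln \<rho> - Ln (1 + u)))\<close>, where the
  shift by 1 avoids the singularity of the logarithm.\<close>

lemma exponential_decay_halfplane_zero:
  fixes D :: "complex \<Rightarrow> complex"
  assumes hol: "D holomorphic_on {w. Re w > s}" and c: "c > 0" and s: "s \<ge> 0"
    and bd: "\<And>w. Re w > s \<Longrightarrow> cmod (D w) \<le> C * exp (- c * cmod w)"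
    and w0: "Re w0 > s"
  shows "D w0 = 0"
proof (rule ccontr)
  assume nz: "D w0 \<noteq> 0"
  define s' where "s' = (s + Re w0) / 2"
  have s': "s < s'" "s' < Re w0" "s' \<ge> 0" using w0 s by (auto simp: s'_def)
  define u0 where "u0 = w0 - of_real s'"
  have u0: "Re u0 > 0" using s' by (simp add: u0_def)
  define k where "k = 2 * c / pi"
  have k: "k > 0" using c by (simp add: k_def)
  have kc: "k * (x * (pi / 2)) = c * x" for x by (simp add: k_def)
  define E where "E = (\<lambda>u. D (of_real s' + u))"
  have C: "C \<ge> 0"
  proof -
    have "0 \<le> C * exp (- c * cmod w0)" using bd[OF w0] norm_ge_zero order_trans by blast
    then show ?thesis by (simp add: zero_le_mult_iff)
  qed
  have E: "cmod (E u) \<le> C * exp (- (c * cmod u))" if "Re u \<ge> 0" for u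
  proof -
    have "(cmod u)\<^sup>2 \<le> (cmod (of_real s' + u))\<^sup>2"
      unfolding cmod_power2 using that s'(3) by (simp add: power2_eq_square algebra_simps)
    then have "cmod u \<le> cmod (of_real s' + u)" by (rule power2_le_imp_le) simp
    then have "exp (- c * cmod (of_real s' + u)) \<le> exp (- (c * cmod u))" using c by simp
    then show ?thesis
      using bd[of "of_real s' + u"] that s' mult_left_mono[OF _ C] unfolding E_def
      by (smt (verit) plus_complex.simps(1) Re_complex_of_real)
  qed
  have key: "cmod (E u0) * exp (k * (Re u0 * ln \<rho> - Re (u0 * Ln (1 + u0)))) \<le> C"
    if \<rho>: "\<rho> > cmod u0" for \<rho>
  proof -
    have \<rho>0: "\<rho> > 0" using \<rho> norm_ge_zero order.strict_trans1 by blast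
    define S where "S = {u. Re u > 0} \<inter> ball 0 \<rho>"
    define G where "G = (\<lambda>u. E u * exp (of_real k * (u * (of_real (ln \<rho>) - Ln (1 + u)))))"
    have opS: "open S" unfolding S_def by (intro open_Int open_halfspace_Re_gt) auto
    have clS: "closure S \<subseteq> {u. Re u \<ge> 0} \<inter> cball 0 \<rho>"
      unfolding S_def by (intro closure_minimal closed_Int closed_halfspace_Re_ge closed_cball) auto
    have nonpos: "1 + u \<notin> \<real>\<^sub>\<le>\<^sub>0" if "Re u \<ge> 0" for u
      using that by (auto simp: complex_nonpos_Reals_iff)
    have "E holomorphic_on {u. Re u > s - s'}"
      unfolding E_def using hol
      by (intro holomorphic_on_compose_gen[where g = D and f = "\<lambda>u. of_real s' + u", unfolded o_def])
         (auto intro!: holomorphic_intros)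
    then have holE: "E holomorphic_on {u. Re u \<ge> 0}"
      using s' by (elim holomorphic_on_subset) auto
    have holG: "G holomorphic_on {u. Re u \<ge> 0}"
      unfolding G_def by (intro holomorphic_intros holE) (use nonpos in auto)
    have Reex: "Re (of_real k * (u * (of_real (ln \<rho>) - Ln (1 + u))))
        = k * (Re u * (ln \<rho> - ln (cmod (1 + u))) + Im u * Im (Ln (1 + u)))" if "Re u \<ge> 0" for u
    proof -
      have "1 + u \<noteq> 0" using nonpos[OF that] by auto
      then show ?thesis by (simp add: Re_Ln algebra_simps)
    qed
    have Imb: "Im u * Im (Ln (1 + u)) \<le> cmod u * (pi / 2)" if "Re u \<ge> 0" for u
    proof -
      have "1 + u \<noteq> 0" using nonpos[OF that] by auto
      then have "\<bar>Im (Ln (1 + u))\<bar> < pi / 2" using that by (subst Re_Ln_pos_lt) auto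
      then have "\<bar>Im u\<bar> * \<bar>Im (Ln (1 + u))\<bar> \<le> cmod u * (pi / 2)"
        by (intro mult_mono abs_Im_le_cmod) auto
      then show ?thesis by (metis abs_le_D1 abs_mult)
    qed
    \<comment> \<open>The term with \<open>ln \<rho> - ln |1 + u|\<close> vanishes on the imaginary axis and is nonpositive
      on the arc, and \<open>|Im (Ln (1 + u))| < \<pi> / 2\<close> on both. So the exponent is at most
      \<open>c |u|\<close>.\<close>
    have fr: "cmod (G u) \<le> C" if "u \<in> frontier S" for u
    proof -
      have u: "Re u \<ge> 0" "cmod u \<le> \<rho>" using that clS by (auto simp: frontier_def)
      have "u \<notin> S" using that opS by (simp add: frontier_def interior_open)
      then have cases: "Re u = 0 \<or> cmod u = \<rho>" using u by (auto simp: S_def)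
      have "Re u * (ln \<rho> - ln (cmod (1 + u))) \<le> 0"
      proof (cases "Re u = 0")
        case False
        with cases have "cmod u = \<rho>" by simp
        have "(cmod u)\<^sup>2 \<le> (cmod (1 + u))\<^sup>2"
          unfolding cmod_power2 using u(1) by (simp add: power2_eq_square algebra_simps)
        then have "\<rho> \<le> cmod (1 + u)" using \<open>cmod u = \<rho>\<close> by (metis power2_le_imp_le norm_ge_zero)
        then have "ln \<rho> \<le> ln (cmod (1 + u))" using \<rho>0 by (intro ln_mono) auto
        then show ?thesis using u(1) by (simp add: mult_nonneg_nonpos)
      qed simp
      then have "Re u * (ln \<rho> - ln (cmod (1 + u))) + Im u * Im (Ln (1 + u)) \<le> cmod u * (pi / 2)"
        using Imb[OF u(1)] by linarith
      then have "k * (Re u * (ln \<rho> - ln (cmod (1 + u))) + Im u * Im (Ln (1 + u))) \<le> c * cmod u"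
        using k by (metis kc mult_left_mono less_imp_le)
      then have "cmod (G u) \<le> (C * exp (- (c * cmod u))) * exp (c * cmod u)"
        unfolding G_def norm_mult norm_exp_eq_Re Reex[OF u(1)]
        by (intro mult_mono E u) (use C in auto)
      then show ?thesis by (simp add: mult.assoc flip: exp_add)
    qed
    have "cmod (G u0) \<le> C"
    proof (rule maximum_modulus_frontier[where S = S and f = G])
      have "S \<subseteq> {u. Re u \<ge> 0}" by (auto simp: S_def)
      then show "G holomorphic_on interior S"
        using holG opS by (simp add: interior_open holomorphic_on_subset)
      show "continuous_on (closure S) G"
        using holomorphic_on_imp_continuous_on[OF holG] clS continuous_on_subset by blast
      show "bounded S" unfolding S_def by (simp add: bounded_Int)
      show "u0 \<in> S" using u0 \<rho> by (simp add: S_def)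
    qed (use fr in auto)
    then show ?thesis
      using Reex[of u0] u0 unfolding G_def norm_mult norm_exp_eq_Re by (simp add: algebra_simps)
  qed
  have E0: "cmod (E u0) > 0" using nz by (simp add: E_def u0_def)
  have "filterlim (\<lambda>\<rho>. cmod (E u0) * exp (k * (Re u0 * ln \<rho> - Re (u0 * Ln (1 + u0))))) at_top at_top"
    using E0 k u0 by real_asymp
  then have "\<forall>\<^sub>F \<rho> in at_top. cmod (E u0) * exp (k * (Re u0 * ln \<rho> - Re (u0 * Ln (1 + u0)))) > C"
    by (simp add: filterlim_at_top_dense)
  moreover have "\<forall>\<^sub>F \<rho> in at_top. \<rho> > cmod u0" by (rule eventually_gt_at_top)
  ultimately have "\<forall>\<^sub>F \<rho>::real in at_top. False"
    by eventually_elim (use key in fastforce)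
  then show False by simp
qed

text \<open>Optimal truncation without choosing \<open>n\<close>: the bounds are divided by \<open>(2 M / w)\<^sup>n n!\<close> and
  summed to an exponential series.\<close>

lemma factorial_bounds_imp_exponential_decay:
  fixes d :: real
  assumes M: "M > 0" and w: "w > 0" and C: "C \<ge> 0"
    and bd: "\<And>n. d \<le> C * M ^ n * fact n * (1 / w) ^ n"
  shows "d \<le> 2 * C * exp (- (1 / (2 * M)) * w)"
proof -
  let ?x = "w / (2 * M)"
  have 1: "(\<lambda>n. d * (?x ^ n /\<^sub>R fact n)) sums (d * exp ?x)"
    by (intro sums_mult exp_converges)
  have 2: "(\<lambda>n. C * (1 / 2) ^ n) sums (C * (1 / (1 - 1 / 2)))"
    by (intro sums_mult geometric_sums) auto
  have "d * exp ?x \<le> C * (1 / (1 - 1 / 2))"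
  proof (rule sums_le[OF _ 1 2])
    fix n
    have "d * (?x ^ n /\<^sub>R fact n) \<le> (C * M ^ n * fact n * (1 / w) ^ n) * (?x ^ n /\<^sub>R fact n)"
      by (intro mult_right_mono bd) (use M w in auto)
    also have "\<dots> = C * (1 / 2) ^ n"
      using M w by (simp add: field_simps power_mult_distrib)
    finally show "d * (?x ^ n /\<^sub>R fact n) \<le> C * (1 / 2) ^ n" .
  qed
  then have "d \<le> 2 * C / exp ?x" by (simp add: field_simps)
  then show ?thesis by (simp add: exp_minus field_simps)
qed

text \<open>Watson's lemma in Nevanlinna's form: an arc of opening exactly \<open>\<pi>\<close> suffices because
  the estimates hold near 0 on a Borel disc, which \<open>h \<mapsto> 1 / h\<close> maps to a half plane.\<close>

lemma Gevrey_asymptotic_unique: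
  assumes R: "R > 0"
    and hol: "holomorphic2_on f (U \<times> Borel_disc R)" "holomorphic2_on g (U \<times> Borel_disc R)"
    and G: "Gevrey_asymptotic f F U (Borel_disc R)" "Gevrey_asymptotic g F U (Borel_disc R)"
    and x: "x \<in> U" and h: "h \<in> Borel_disc R"
  shows "f (x, h) = g (x, h)"
proof -
  obtain C1 M1 \<delta>1 where 1: "C1 > 0" "M1 > 0" "\<delta>1 > 0"
    "\<And>n x h. x \<in> U \<Longrightarrow> h \<in> Borel_disc R \<Longrightarrow> norm h < \<delta>1 \<Longrightarrow>
        norm (f (x, h) - (\<Sum>k<n. F k x * h ^ k)) \<le> C1 * M1 ^ n * fact n * norm h ^ n"
    using G(1) unfolding Gevrey_asymptotic_def by blast
  obtain C2 M2 \<delta>2 where 2: "C2 > 0" "M2 > 0" "\<delta>2 > 0"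
    "\<And>n x h. x \<in> U \<Longrightarrow> h \<in> Borel_disc R \<Longrightarrow> norm h < \<delta>2 \<Longrightarrow>
        norm (g (x, h) - (\<Sum>k<n. F k x * h ^ k)) \<le> C2 * M2 ^ n * fact n * norm h ^ n"
    using G(2) unfolding Gevrey_asymptotic_def by blast
  define C where "C = C1 + C2"
  define M where "M = max M1 M2"
  define \<delta> where "\<delta> = min \<delta>1 \<delta>2"
  have pos: "C > 0" "M > 0" "\<delta> > 0" using 1 2 by (auto simp: C_def M_def \<delta>_def)
  have bd: "cmod (f (x, h) - g (x, h)) \<le> C * M ^ n * fact n * norm h ^ n"
    if h: "h \<in> Borel_disc R" "norm h < \<delta>" for h n
  proof -
    have a: "C1 * M1 ^ n * fact n * norm h ^ n \<le> C1 * M ^ n * fact n * norm h ^ n"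
      using 1 by (intro mult_right_mono mult_left_mono power_mono) (auto simp: M_def)
    have b: "C2 * M2 ^ n * fact n * norm h ^ n \<le> C2 * M ^ n * fact n * norm h ^ n"
      using 2 by (intro mult_right_mono mult_left_mono power_mono) (auto simp: M_def)
    have "norm (f (x, h) - (\<Sum>k<n. F k x * h ^ k)) + norm (g (x, h) - (\<Sum>k<n. F k x * h ^ k))
      \<le> C * M ^ n * fact n * norm h ^ n"
      using 1(4)[OF x h(1), of n] 2(4)[OF x h(1), of n] h(2) a b
      by (simp add: C_def \<delta>_def algebra_simps)
    then show ?thesis
      using norm_triangle_ineq4[of "f (x, h) - (\<Sum>k<n. F k x * h ^ k)" "g (x, h) - (\<Sum>k<n. F k x * h ^ k)"]
      by simp
  qed
  define s where "s = max (1 / R) (1 / \<delta>)"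
  have s: "s > 0" using R by (simp add: s_def less_max_iff_disj)
  have inB: "1 / w \<in> Borel_disc R" "norm (1 / w) < \<delta>" "w \<noteq> 0" if "Re w > s" for w
  proof -
    show "1 / w \<in> Borel_disc R" using that by (simp add: Borel_disc_def s_def)
    show "w \<noteq> 0" using that s by auto
    have "cmod w \<ge> Re w" by (rule complex_Re_le_cmod)
    then have "cmod w > 1 / \<delta>" using that by (simp add: s_def)
    moreover have "1 / \<delta> > 0" using pos by simp
    ultimately have "1 / cmod w < 1 / (1 / \<delta>)" by (intro divide_strict_left_mono mult_pos_pos) linarith+
    then show "norm (1 / w) < \<delta>" by (simp add: norm_divide)
  qed
  have hol': "(\<lambda>h. f (x, h) - g (x, h)) holomorphic_on Borel_disc R"
    by (intro holomorphic_on_diff holomorphic2_on_curve[OF hol(1)] holomorphic2_on_curve[OF hol(2)])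
       (use x in \<open>auto intro: holomorphic_intros\<close>)
  have zero: "f (x, 1 / w) - g (x, 1 / w) = 0" if w: "Re w > s" for w
  proof (rule exponential_decay_halfplane_zero[where D = "\<lambda>w. f (x, 1 / w) - g (x, 1 / w)" and s = s and c = "1 / (2 * M)" and C = "2 * C"])
    show "(\<lambda>w. f (x, 1 / w) - g (x, 1 / w)) holomorphic_on {w. s < Re w}"
      using inB by (intro holomorphic_on_compose_gen[OF _ hol', where f = "\<lambda>w. 1 / w", unfolded o_def])
         (auto intro!: holomorphic_intros)
    fix w assume w: "s < Re w"
    show "cmod (f (x, 1 / w) - g (x, 1 / w)) \<le> 2 * C * exp (- (1 / (2 * M)) * cmod w)"
      by (rule factorial_bounds_imp_exponential_decay)
         (use bd[OF inB(1,2)[OF w]] inB(3)[OF w] pos in \<open>auto simp: norm_divide\<close>)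
  qed (use pos s w in auto)
  have "f (x, h) - g (x, h) = 0"
  proof (rule analytic_continuation_open[where s = "Borel_disc (1 / s)" and s' = "Borel_disc R"
        and f = "\<lambda>h. f (x, h) - g (x, h)" and g = "\<lambda>_. 0"])
    have s1: "1 / s > 0" "1 / s \<le> R" using s R by (auto simp: s_def field_simps max_def)
    show "open (Borel_disc (1 / s))" "open (Borel_disc R)" "connected (Borel_disc R)"
      using Borel_disc_eq_ball s1(1) R by auto
    show "Borel_disc (1 / s) \<noteq> {}" using Borel_disc_eq_ball[OF s1(1)] s1(1) by simp
    show "Borel_disc (1 / s) \<subseteq> Borel_disc R" by (rule Borel_disc_mono[OF s1])
    show "f (x, h) - g (x, h) = 0" if "h \<in> Borel_disc (1 / s)" for h
      using zero[of "1 / h"] that by (simp add: Borel_disc_def)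
  qed (use hol' h in auto)
  then show ?thesis by simp
qed

section \<open>Formal solutions from asymptotic expansions\<close>

definition partial_poly :: "nat \<Rightarrow> complex fps \<Rightarrow> complex poly" where
  "partial_poly n G = (\<Sum>k<n. monom (fps_nth G k) k)"

lemma coeff_partial_poly: "coeff (partial_poly n G) i = (if i < n then fps_nth G i else 0)"
  by (auto simp: partial_poly_def coeff_sum sum.delta)

lemma poly_partial_poly: "poly (partial_poly n G) h = (\<Sum>k<n. fps_nth G k * h ^ k)"
  by (simp add: partial_poly_def poly_sum poly_monom)

text \<open>Only powers matter here, not the growth of the constants: this notion is closed under
  products and determines the series.\<close>

definition asymptotic_to :: "complex filter \<Rightarrow> (complex \<Rightarrow> complex) \<Rightarrow> complex fps \<Rightarrow> bool" where
  "asymptotic_to Fl e G \<longleftrightarrow> (\<forall>n. (\<lambda>h. e h - poly (partial_poly n G) h) \<in> O[Fl](\<lambda>h. h ^ n))"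

lemma poly_bigo:
  assumes Fl: "Fl \<le> at 0" and c: "\<And>k. k < n \<Longrightarrow> coeff p k = 0"
  shows "poly p \<in> O[Fl](\<lambda>h::complex. h ^ n)"
proof -
  from c have "monom 1 n dvd p" by (simp add: monom_1_dvd_iff')
  then obtain q where q: "p = monom 1 n * q" by blast
  have "poly q \<in> O[at 0](\<lambda>_. 1)"
    by (rule bigoI_tendsto[of _ _ "poly q 0"]) (auto simp: poly_isCont[unfolded isCont_def] isCont_def[symmetric])
  then have "(\<lambda>h. h ^ n * poly q h) \<in> O[at 0](\<lambda>h. h ^ n * 1)"
    by (intro landau_o.big.mult) auto
  then have "poly p \<in> O[at 0](\<lambda>h. h ^ n)"
    by (simp add: q poly_monom fun_eq_iff[THEN iffD2, of "poly (monom 1 n * q)" "\<lambda>h. h ^ n * poly q h"])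
  then show ?thesis by (rule landau_o.big.filter_mono[OF Fl])
qed

lemma asymptotic_to_poly:
  assumes "Fl \<le> at 0" shows "asymptotic_to Fl (poly p) (fps_of_poly p)"
  unfolding asymptotic_to_def
proof
  fix n
  have "poly (p - partial_poly n (fps_of_poly p)) \<in> O[Fl](\<lambda>h. h ^ n)"
    by (rule poly_bigo[OF assms]) (simp add: coeff_partial_poly)
  moreover have "poly (p - partial_poly n (fps_of_poly p)) =
      (\<lambda>h. poly p h - poly (partial_poly n (fps_of_poly p)) h)" by (rule ext) simp
  ultimately show "(\<lambda>h. poly p h - poly (partial_poly n (fps_of_poly p)) h) \<in> O[Fl](\<lambda>h. h ^ n)"
    by simp
qed

lemma asymptotic_to_add:
  assumes "asymptotic_to Fl e1 G1" "asymptotic_to Fl e2 G2"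
  shows "asymptotic_to Fl (\<lambda>h. e1 h + e2 h) (G1 + G2)"
  unfolding asymptotic_to_def
proof
  fix n
  have "(\<lambda>h. (e1 h - poly (partial_poly n G1) h) + (e2 h - poly (partial_poly n G2) h)) \<in> O[Fl](\<lambda>h. h ^ n)"
    by (rule sum_in_bigo(1)) (use assms in \<open>auto simp: asymptotic_to_def\<close>)
  then show "(\<lambda>h. e1 h + e2 h - poly (partial_poly n (G1 + G2)) h) \<in> O[Fl](\<lambda>h. h ^ n)"
    by (simp add: poly_partial_poly sum.distrib algebra_simps)
qed

lemma asymptotic_to_mult:
  assumes Fl: "Fl \<le> at 0" and 1: "asymptotic_to Fl e1 G1" and 2: "asymptotic_to Fl e2 G2"
  shows "asymptotic_to Fl (\<lambda>h. e1 h * e2 h) (G1 * G2)"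
  unfolding asymptotic_to_def
proof
  fix n
  let ?p = "partial_poly n G1" and ?q = "partial_poly n G2" and ?r = "partial_poly n (G1 * G2)"
  have a: "(\<lambda>h. (e1 h - poly ?p h) * e2 h) \<in> O[Fl](\<lambda>h. h ^ n * 1)"
    using 1 2[unfolded asymptotic_to_def, rule_format, of 0]
    by (intro landau_o.big.mult) (auto simp: asymptotic_to_def poly_partial_poly)
  have "poly ?p \<in> O[Fl](\<lambda>h. h ^ 0)" by (rule poly_bigo[OF Fl]) simp
  then have b: "(\<lambda>h. poly ?p h * (e2 h - poly ?q h)) \<in> O[Fl](\<lambda>h. 1 * h ^ n)"
    using 2 by (intro landau_o.big.mult) (auto simp: asymptotic_to_def)
  have c: "poly (?p * ?q - ?r) \<in> O[Fl](\<lambda>h. h ^ n)"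
  proof (rule poly_bigo[OF Fl])
    fix k assume k: "k < n"
    then show "coeff (?p * ?q - ?r) k = 0"
      by (auto simp: coeff_mult coeff_partial_poly fps_mult_nth atLeast0AtMost intro!: sum.cong)
  qed
  have "(\<lambda>h. (e1 h - poly ?p h) * e2 h + poly ?p h * (e2 h - poly ?q h) + poly (?p * ?q - ?r) h)
      \<in> O[Fl](\<lambda>h. h ^ n)"
    by (intro sum_in_bigo(1) a[unfolded mult_1_right] b[unfolded mult_1] c)
  then show "(\<lambda>h. e1 h * e2 h - poly ?r h) \<in> O[Fl](\<lambda>h. h ^ n)"
    by (rule back_subst[of "\<lambda>f. f \<in> _"]) (auto simp: fun_eq_iff algebra_simps)
qed

lemma asymptotic_to_unique:
  assumes Fl: "Fl \<le> at 0" "Fl \<noteq> bot" and 1: "asymptotic_to Fl e G1" and 2: "asymptotic_to Fl e G2"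
  shows "G1 = G2"
proof -
  have eq: "fps_nth G1 n = fps_nth G2 n" for n
  proof (induction n rule: less_induct)
    case (less n)
    let ?c = "fps_nth G2 n - fps_nth G1 n"
    have "(\<lambda>h. (e h - poly (partial_poly (Suc n) G1) h) - (e h - poly (partial_poly (Suc n) G2) h))
       \<in> O[Fl](\<lambda>h. h ^ Suc n)"
      by (rule sum_in_bigo(2)) (use 1 2 in \<open>auto simp: asymptotic_to_def simp del: power_Suc\<close>)
    moreover have "(e h - poly (partial_poly (Suc n) G1) h) - (e h - poly (partial_poly (Suc n) G2) h)
        = ?c * h ^ n" for h
    proof -
      have "(\<Sum>k<n. fps_nth G1 k * h ^ k) = (\<Sum>k<n. fps_nth G2 k * h ^ k)"
        using less.IH by (intro sum.cong) auto
      then show ?thesis by (simp add: poly_partial_poly algebra_simps)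
    qed
    ultimately have "(\<lambda>h. ?c * h ^ n) \<in> O[Fl](\<lambda>h. h ^ Suc n)" by simp
    then obtain K where K: "\<forall>\<^sub>F h in Fl. norm (?c * h ^ n) \<le> K * norm (h ^ Suc n)"
      by (elim landau_o.bigE)
    have nz: "\<forall>\<^sub>F h in Fl. h \<noteq> 0"
      by (rule filter_leD[OF Fl(1)]) (simp add: eventually_at_filter)
    have "\<forall>\<^sub>F h in Fl. norm ?c \<le> K * norm h"
      using K nz
    proof eventually_elim
      case (elim h)
      then have "norm ?c * norm h ^ n \<le> (K * norm h) * norm h ^ n"
        by (simp only: norm_mult norm_power power_Suc mult.assoc)
      then show ?case using elim(2) by simp
    qed
    moreover have "((\<lambda>h. K * norm h) \<longlongrightarrow> K * norm (0::complex)) Fl"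
      by (intro tendsto_intros tendsto_mono[OF Fl(1)])
    ultimately have "norm ?c \<le> K * norm (0::complex)"
      using tendsto_lowerbound Fl(2) by blast
    then show ?case by simp
  qed
  then show ?thesis by (simp add: fps_eq_iff)
qed

lemma asymptotic_to_cong:
  assumes "\<forall>\<^sub>F h in Fl. e1 h = e2 h" "asymptotic_to Fl e1 G"
  shows "asymptotic_to Fl e2 G"
  unfolding asymptotic_to_def
proof
  fix n
  have "\<forall>\<^sub>F h in Fl. e1 h - poly (partial_poly n G) h = e2 h - poly (partial_poly n G) h"
    using assms(1) by eventually_elim simp
  then show "(\<lambda>h. e2 h - poly (partial_poly n G) h) \<in> O[Fl](\<lambda>h. h ^ n)"
    by (rule landau_o.big.in_cong[THEN iffD1]) (use assms(2) in \<open>auto simp: asymptotic_to_def\<close>)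
qed

text \<open>Asymptotic expansions can be multiplied and, by Cauchy's estimate in \<open>x\<close>,
  differentiated with respect to \<open>x\<close>. Inserting them into the equation and comparing the
  unique expansions of both sides gives the formal equation.\<close>

lemma formal_Riccati_solution_of_Gevrey:
  assumes R: "R > 0" and U: "open U"
    and sol: "Riccati_solution a b c U (Borel_disc R) f"
    and G: "Gevrey_asymptotic f F U (Borel_disc R)"
    and hol: "\<And>k. F k holomorphic_on U"
    and f0: "\<And>x. x \<in> U \<Longrightarrow> F 0 x = f0 x"
  shows "formal_Riccati_solution a b c U f0 F"
  unfolding formal_Riccati_solution_def
proof (intro conjI allI ballI)
  fix x assume x: "x \<in> U"
  let ?S = "Borel_disc R"
  let ?Fl = "at 0 within ?S"
  have Fl: "?Fl \<le> at 0" by (rule at_le) simp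
  have Fl0: "?Fl \<noteq> bot"
  proof -
    have "0 \<in> closure (?S - {0})"
    proof -
      have "?S - {0} = ?S" using Borel_disc_nz[OF _ R] by blast
      then show ?thesis using R by (simp add: Borel_disc_eq_ball)
    qed
    then show ?thesis by (simp add: trivial_limit_within islimpt_in_closure)
  qed
  obtain C M \<delta> where 1: "C > 0" "M > 0" "\<delta> > 0"
    "\<And>n x h. x \<in> U \<Longrightarrow> h \<in> ?S \<Longrightarrow> norm h < \<delta> \<Longrightarrow>
        norm (f (x, h) - (\<Sum>k<n. F k x * h ^ k)) \<le> C * M ^ n * fact n * norm h ^ n"
    using G unfolding Gevrey_asymptotic_def by blast
  have ev: "\<forall>\<^sub>F h in ?Fl. h \<in> ?S \<and> norm h < \<delta>"
    using 1(3) by (auto simp: eventually_at dist_norm)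
  have A1: "asymptotic_to ?Fl (\<lambda>h. f (x, h)) (Abs_fps (\<lambda>k. F k x))"
    unfolding asymptotic_to_def
  proof
    fix n
    show "(\<lambda>h. f (x, h) - poly (partial_poly n (Abs_fps (\<lambda>k. F k x))) h) \<in> O[?Fl](\<lambda>h. h ^ n)"
    proof (rule landau_o.bigI)
      show "C * M ^ n * fact n > 0" using 1 by simp
      show "\<forall>\<^sub>F h in ?Fl. norm (f (x, h) - poly (partial_poly n (Abs_fps (\<lambda>k. F k x))) h)
             \<le> C * M ^ n * fact n * norm (h ^ n)"
        using ev by eventually_elim (use 1(4)[OF x] in \<open>simp add: poly_partial_poly norm_power\<close>)
    qed
  qed
  obtain r where r: "r > 0" "cball x r \<subseteq> U" using U x open_contains_cball by blast
  have A2: "asymptotic_to ?Fl (\<lambda>h. deriv (\<lambda>y. f (y, h)) x) (Abs_fps (\<lambda>k. deriv (F k) x))"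
    unfolding asymptotic_to_def
  proof
    fix n
    show "(\<lambda>h. deriv (\<lambda>y. f (y, h)) x - poly (partial_poly n (Abs_fps (\<lambda>k. deriv (F k) x))) h) \<in> O[?Fl](\<lambda>h. h ^ n)"
    proof (rule landau_o.bigI)
      show "C * M ^ n * fact n / r > 0" using 1 r by simp
      show "\<forall>\<^sub>F h in ?Fl. norm (deriv (\<lambda>y. f (y, h)) x - poly (partial_poly n (Abs_fps (\<lambda>k. deriv (F k) x))) h)
             \<le> C * M ^ n * fact n / r * norm (h ^ n)"
        using ev
      proof eventually_elim
        case (elim h)
        let ?g = "\<lambda>y. f (y, h) - (\<Sum>k<n. F k y * h ^ k)"
        have holf: "(\<lambda>y. f (y, h)) holomorphic_on U"
          using sol elim unfolding Riccati_solution_def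
          by (intro holomorphic2_on_slice1[where D = "U \<times> ?S"]) auto
        have holg: "?g holomorphic_on U" by (intro holomorphic_intros holf hol)
        have d: "deriv ?g x = deriv (\<lambda>y. f (y, h)) x - (\<Sum>k<n. deriv (F k) x * h ^ k)"
          by (rule DERIV_imp_deriv)
             (auto intro!: derivative_eq_intros holomorphic_derivI[OF holf U x] holomorphic_derivI[OF hol U x]
               simp: )
        have "norm ((deriv ^^ 1) ?g x) \<le> fact 1 * (C * M ^ n * fact n * norm h ^ n) / r ^ 1"
        proof (rule Cauchy_inequality)
          show "?g holomorphic_on ball x r"
            by (rule holomorphic_on_subset[OF holg]) (use r(2) in force)
          show "continuous_on (cball x r) ?g"
            by (rule holomorphic_on_imp_continuous_on[OF holomorphic_on_subset[OF holg r(2)]])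
          fix w assume "cmod (x - w) = r"
          then have "w \<in> U" using r(2) by (auto simp: dist_norm)
          then show "cmod (?g w) \<le> C * M ^ n * fact n * norm h ^ n" using 1(4) elim by blast
        qed (use r in auto)
        then show ?case by (simp add: d poly_partial_poly norm_power)
      qed
    qed
  qed
  have L: "asymptotic_to ?Fl (\<lambda>h. poly [:0, 1:] h * deriv (\<lambda>y. f (y, h)) x)
      (fps_X * Abs_fps (\<lambda>k. deriv (F k) x))"
    using asymptotic_to_mult[OF Fl asymptotic_to_poly[OF Fl, of "[:0, 1:]"] A2]
    by (simp only: fps_of_poly_fps_X)
  have Rr: "asymptotic_to ?Fl (\<lambda>h. poly (a x) h * (f (x, h) * f (x, h)) + poly (b x) h * f (x, h) + poly (c x) h)
     (fps_of_poly (a x) * (Abs_fps (\<lambda>k. F k x) * Abs_fps (\<lambda>k. F k x))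
        + fps_of_poly (b x) * Abs_fps (\<lambda>k. F k x) + fps_of_poly (c x))"
    by (intro asymptotic_to_add asymptotic_to_mult[OF Fl] asymptotic_to_poly[OF Fl] A1)
  have "\<forall>\<^sub>F h in ?Fl. poly [:0, 1:] h * deriv (\<lambda>y. f (y, h)) x =
      poly (a x) h * (f (x, h) * f (x, h)) + poly (b x) h * f (x, h) + poly (c x) h"
    using ev by eventually_elim (use sol x in \<open>simp add: Riccati_solution_def power2_eq_square\<close>)
  from asymptotic_to_unique[OF Fl Fl0 asymptotic_to_cong[OF this L] Rr]
  show "fps_X * Abs_fps (\<lambda>k. deriv (F k) x) = fps_of_poly (a x) * (Abs_fps (\<lambda>k. F k x))\<^sup>2
        + fps_of_poly (b x) * Abs_fps (\<lambda>k. F k x) + fps_of_poly (c x)"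
    by (simp add: power2_eq_square)
qed (use hol f0 in auto)

text \<open>The coefficient of order \<open>n\<close> enters the equation of order \<open>n\<close> linearly, with factor
  \<open>2 a\<^sub>0 f\<^sub>0 + b\<^sub>0\<close>; the derivative that occurs there belongs to order \<open>n - 1\<close>.\<close>

lemma formal_Riccati_solution_unique:
  assumes U: "open U"
    and F: "formal_Riccati_solution a b c U f0 F" and G: "formal_Riccati_solution a b c U f0 G"
    and nz: "\<And>x. x \<in> U \<Longrightarrow> 2 * coeff (a x) 0 * f0 x + coeff (b x) 0 \<noteq> 0"
    and x: "x \<in> U"
  shows "G k x = F k x"
  using x
proof (induction k arbitrary: x rule: less_induct)
  case (less n)
  note x = less.prems
  show ?case
  proof (cases n)
    case 0
    then show ?thesis using F G x by (simp add: formal_Riccati_solution_def)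
  next
    case (Suc m)
    let ?P = "\<lambda>F. Abs_fps (\<lambda>k. F k x)"
    have eqn: "deriv (H m) x = fps_nth (fps_of_poly (a x) * (?P H)\<^sup>2 + fps_of_poly (b x) * ?P H + fps_of_poly (c x)) n"
      if "formal_Riccati_solution a b c U f0 H" for H
    proof -
      have "fps_nth (fps_X * Abs_fps (\<lambda>k. deriv (H k) x)) n =
         fps_nth (fps_of_poly (a x) * (?P H)\<^sup>2 + fps_of_poly (b x) * ?P H + fps_of_poly (c x)) n"
        using that x unfolding formal_Riccati_solution_def by simp
      then show ?thesis by (simp add: Suc)
    qed
    have d: "deriv (G m) x = deriv (F m) x"
    proof (rule deriv_cong_ev[OF _ refl])
      show "\<forall>\<^sub>F y in nhds x. G m y = F m y"
        using eventually_nhds_in_open[OF U x] by eventually_elim (use less.IH Suc in auto)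
    qed
    have F0: "F 0 x = f0 x" "G 0 x = f0 x" using F G x by (auto simp: formal_Riccati_solution_def)
    let ?D = "?P G - ?P F" and ?S = "?P G + ?P F"
    have "fps_nth ((fps_of_poly (a x) * ?S + fps_of_poly (b x)) * ?D) n = 0"
    proof -
      have "(fps_of_poly (a x) * ?S + fps_of_poly (b x)) * ?D =
          (fps_of_poly (a x) * (?P G)\<^sup>2 + fps_of_poly (b x) * ?P G + fps_of_poly (c x)) -
          (fps_of_poly (a x) * (?P F)\<^sup>2 + fps_of_poly (b x) * ?P F + fps_of_poly (c x))"
        by (simp add: algebra_simps power2_eq_square)
      then show ?thesis using eqn[OF F] eqn[OF G] d by simp
    qed
    moreover have "fps_nth ((fps_of_poly (a x) * ?S + fps_of_poly (b x)) * ?D) n =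
        fps_nth (fps_of_poly (a x) * ?S + fps_of_poly (b x)) 0 * fps_nth ?D n"
    proof -
      have "fps_nth ((fps_of_poly (a x) * ?S + fps_of_poly (b x)) * ?D) n =
         (\<Sum>i=0..n. fps_nth (fps_of_poly (a x) * ?S + fps_of_poly (b x)) i * fps_nth ?D (n - i))"
        by (rule fps_mult_nth)
      also have "\<dots> = (\<Sum>i\<in>{0}. fps_nth (fps_of_poly (a x) * ?S + fps_of_poly (b x)) i * fps_nth ?D (n - i))"
        by (rule sum.mono_neutral_right) (use less.IH x in auto)
      finally show ?thesis by simp
    qed
    moreover have "fps_nth (fps_of_poly (a x) * ?S + fps_of_poly (b x)) 0 = 2 * coeff (a x) 0 * f0 x + coeff (b x) 0"
      using F0 by simp
    ultimately have "(2 * coeff (a x) 0 * f0 x + coeff (b x) 0) * fps_nth ?D n = 0" by metis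
    then show ?thesis using nz[OF x] by simp
  qed
qed

section \<open>Laplace integrals and Borel sums\<close>

text \<open>The variable is \<open>p = 1 / h\<close>. The integrand is given as a function of a complex
  variable because Borel transforms are holomorphic in a tube around the ray of
  integration.\<close>

definition Laplace :: "(complex \<Rightarrow> complex) \<Rightarrow> complex \<Rightarrow> complex" where
  "Laplace g p = integral {0..} (\<lambda>t. exp (- (p * complex_of_real t)) * g (complex_of_real t))"

lemma exp_Laplace_bound:
  assumes "cmod (g (of_real t)) \<le> K * exp (L * t)" "0 \<le> t"
  shows "cmod (exp (- (p * complex_of_real t)) * g (of_real t)) \<le> K * exp (- (Re p - L) * t)"
proof -
  have "cmod (exp (- (p * complex_of_real t)) * g (of_real t)) \<le> exp (- (Re p * t)) * (K * exp (L * t))"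
    unfolding norm_mult by (intro mult_mono assms) auto
  also have "\<dots> = K * exp (- (Re p - L) * t)"
    by (simp add: mult.left_commute flip: exp_add) (simp add: algebra_simps)
  finally show ?thesis .
qed

lemma Laplace_integral_from:
  fixes T :: real
  assumes cont: "continuous_on {0..} (\<lambda>t::real. g (complex_of_real t))"
    and bd: "\<And>t. 0 \<le> t \<Longrightarrow> cmod (g (of_real t)) \<le> K * exp (L * t)"
    and p: "Re p > L" and T: "T \<ge> 0"
  shows "(\<lambda>t. exp (- (p * complex_of_real t)) * g (of_real t)) integrable_on {T..}"
    and "cmod (integral {T..} (\<lambda>t. exp (- (p * complex_of_real t)) * g (of_real t)))
           \<le> K * exp (- (Re p - L) * T) / (Re p - L)"
proof -
  let ?f = "\<lambda>t. exp (- (p * complex_of_real t)) * g (of_real t)"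
  have hi: "((\<lambda>t. K * exp (- (Re p - L) * t)) has_integral K * (exp (- (Re p - L) * T) / (Re p - L))) {T..}"
    using p by (intro has_integral_mult_right has_integral_exp_minus_to_infinity) auto
  have le: "norm (?f t) \<le> K * exp (- (Re p - L) * t)" if "t \<in> {T..}" for t
    using that T by (intro exp_Laplace_bound bd) auto
  show int: "?f integrable_on {T..}"
  proof (rule measurable_bounded_by_integrable_imp_integrable[OF _ has_integral_integrable[OF hi] le])
    have "continuous_on {T..} ?f"
      using T by (intro continuous_intros continuous_on_subset[OF cont]) auto
    then show "?f \<in> borel_measurable (lebesgue_on {T..})"
      by (rule continuous_imp_measurable_on_sets_lebesgue) auto
  qed auto
  show "cmod (integral {T..} ?f) \<le> K * exp (- (Re p - L) * T) / (Re p - L)"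
    using integral_norm_bound_integral[OF int has_integral_integrable[OF hi] le] integral_unique[OF hi]
    by simp
qed

lemma Laplace_integral_split:
  fixes T :: real
  assumes cont: "continuous_on {0..} (\<lambda>t::real. g (complex_of_real t))"
    and bd: "\<And>t. 0 \<le> t \<Longrightarrow> cmod (g (of_real t)) \<le> K * exp (L * t)"
    and p: "Re p > L" and T: "T \<ge> 0"
  shows "cmod (Laplace g p - integral {0..T} (\<lambda>t. exp (- (p * complex_of_real t)) * g (of_real t)))
           \<le> K * exp (- (Re p - L) * T) / (Re p - L)"
proof -
  let ?f = "\<lambda>t. exp (- (p * complex_of_real t)) * g (of_real t)"
  have i2: "?f integrable_on {T..}" and bd2: "cmod (integral {T..} ?f) \<le> K * exp (- (Re p - L) * T) / (Re p - L)"
    using Laplace_integral_from[OF cont bd p T] by auto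
  have i1: "?f integrable_on {0..T}"
    by (intro integrable_continuous_interval continuous_intros continuous_on_subset[OF cont]) auto
  have "{0..T} \<inter> {T..} = {T}" "{0..T} \<union> {T..} = {0..}" using T by auto
  then have "Laplace g p = integral {0..T} ?f + integral {T..} ?f"
    using integral_Un[OF i1 i2] by (simp add: Laplace_def)
  then show ?thesis using bd2 by simp
qed

lemma Laplace_bound:
  assumes cont: "continuous_on {0..} (\<lambda>t::real. g (complex_of_real t))"
    and bd: "\<And>t. 0 \<le> t \<Longrightarrow> cmod (g (of_real t)) \<le> K * exp (L * t)"
    and p: "Re p > L"
  shows "cmod (Laplace g p) \<le> K / (Re p - L)"
  using Laplace_integral_from(2)[OF cont bd p, of 0] by (simp add: Laplace_def)

lemma Laplace_tail_tendsto:
  assumes "Re p > L"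
  shows "((\<lambda>T::real. K * exp (- (Re p - L) * T) / (Re p - L)) \<longlongrightarrow> 0) at_top"
proof -
  have "Re p - L > 0" using assms by simp
  then show ?thesis by real_asymp
qed

lemma Laplace_integral_tendsto:
  assumes cont: "continuous_on {0..} (\<lambda>t::real. g (complex_of_real t))"
    and bd: "\<And>t. 0 \<le> t \<Longrightarrow> cmod (g (of_real t)) \<le> K * exp (L * t)"
    and p: "Re p > L"
  shows "((\<lambda>T. integral {0..T} (\<lambda>t. exp (- (p * complex_of_real t)) * g (of_real t))) \<longlongrightarrow> Laplace g p) at_top"
proof -
  have "((\<lambda>T. Laplace g p - integral {0..T} (\<lambda>t. exp (- (p * complex_of_real t)) * g (of_real t))) \<longlongrightarrow> 0) at_top"
  proof (rule Lim_null_comparison[OF _ Laplace_tail_tendsto[OF p]])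
    show "\<forall>\<^sub>F T in at_top. norm (Laplace g p - integral {0..T} (\<lambda>t. exp (- (p * complex_of_real t)) * g (of_real t)))
        \<le> K * exp (- (Re p - L) * T) / (Re p - L)"
      using eventually_ge_at_top[of 0] by eventually_elim (rule Laplace_integral_split[OF cont bd p])
  qed
  from tendsto_diff[OF tendsto_const[of "Laplace g p"] this] show ?thesis by simp
qed

lemma Laplace_deriv:
  assumes der: "\<And>t. 0 \<le> t \<Longrightarrow> (g has_field_derivative g' (of_real t)) (at (complex_of_real t))"
    and cont: "continuous_on {0..} (\<lambda>t::real. g' (complex_of_real t))"
    and bd: "\<And>t. 0 \<le> t \<Longrightarrow> cmod (g (of_real t)) \<le> K * exp (L * t)"
    and bd': "\<And>t. 0 \<le> t \<Longrightarrow> cmod (g' (of_real t)) \<le> K' * exp (L * t)"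
    and p: "Re p > L"
  shows "Laplace g' p = p * Laplace g p - g 0"
proof -
  let ?e = "\<lambda>t::real. exp (- (p * complex_of_real t))"
  have vd: "((\<lambda>t::real. g (complex_of_real t)) has_vector_derivative g' (of_real t)) (at t within S)" if "0 \<le> t" for t S
    using has_vector_derivative_real_field[OF der[OF that], of S] by simp
  have contg: "continuous_on {0..} (\<lambda>t::real. g (complex_of_real t))"
    unfolding continuous_on_eq_continuous_within
    using vd has_vector_derivative_continuous by fastforce
  have l1: "((\<lambda>T. integral {0..T} (\<lambda>t. ?e t * g' (of_real t))) \<longlongrightarrow> Laplace g' p) at_top"
    by (rule Laplace_integral_tendsto[OF cont bd' p])
  have l2: "((\<lambda>T. integral {0..T} (\<lambda>t. ?e t * g (of_real t))) \<longlongrightarrow> Laplace g p) at_top"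
    by (rule Laplace_integral_tendsto[OF contg bd p])
  have l3: "((\<lambda>T. ?e T * g (of_real T)) \<longlongrightarrow> 0) at_top"
  proof (rule Lim_null_comparison)
    show "\<forall>\<^sub>F T in at_top. norm (?e T * g (of_real T)) \<le> K * exp (- (Re p - L) * T)"
      using eventually_ge_at_top[of 0] by eventually_elim (intro exp_Laplace_bound bd)
    have "Re p - L > 0" using p by simp
    then show "((\<lambda>T. K * exp (- (Re p - L) * T)) \<longlongrightarrow> 0) at_top" by real_asymp
  qed
  have eq: "integral {0..T} (\<lambda>t. ?e t * g' (of_real t)) =
      p * integral {0..T} (\<lambda>t. ?e t * g (of_real t)) + (?e T * g (of_real T) - g 0)" if T: "T \<ge> 0" for T
  proof -
    have "((\<lambda>t. ?e t * g' (of_real t) - p * (?e t * g (of_real t))) has_integral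
           (?e T * g (of_real T) - ?e 0 * g (of_real 0))) {0..T}"
    proof (rule fundamental_theorem_of_calculus[OF T])
      fix t assume t: "t \<in> {0..T}"
      have "(?e has_vector_derivative (- p * ?e t)) (at t within {0..T})"
        by (rule has_vector_derivative_real_field[of "\<lambda>z. exp (- (p * z))", THEN has_vector_derivative_eq_rhs])
           (auto intro!: derivative_eq_intros)
      from has_vector_derivative_mult[OF this vd[of t]] t
      show "((\<lambda>t. ?e t * g (of_real t)) has_vector_derivative
          (?e t * g' (of_real t) - p * (?e t * g (of_real t)))) (at t within {0..T})"
        by (simp add: algebra_simps)
    qed
    then have f1: "integral {0..T} (\<lambda>t. ?e t * g' (of_real t) - p * (?e t * g (of_real t))) =
        ?e T * g (of_real T) - g 0" by (simp add: integral_unique)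
    have f2: "integral {0..T} (\<lambda>t. ?e t * g' (of_real t) - p * (?e t * g (of_real t))) =
       integral {0..T} (\<lambda>t. ?e t * g' (of_real t)) - integral {0..T} (\<lambda>t. p * (?e t * g (of_real t)))"
      by (rule integral_diff; intro integrable_continuous_interval continuous_intros
            continuous_on_subset[OF cont] continuous_on_subset[OF contg]; use T in auto)
    from f1[unfolded f2 integral_mult_right] show ?thesis
      unfolding diff_eq_eq by (simp only: add.commute)
  qed
  have "((\<lambda>T. p * integral {0..T} (\<lambda>t. ?e t * g (of_real t)) + (?e T * g (of_real T) - g 0)) \<longlongrightarrow>
      p * Laplace g p + (0 - g 0)) at_top"
    by (intro tendsto_intros l2 l3)
  moreover have "\<forall>\<^sub>F T in at_top. integral {0..T} (\<lambda>t. ?e t * g' (of_real t)) =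
      p * integral {0..T} (\<lambda>t. ?e t * g (of_real t)) + (?e T * g (of_real T) - g 0)"
    using eventually_ge_at_top[of 0] by eventually_elim (rule eq)
  ultimately have "((\<lambda>T. integral {0..T} (\<lambda>t. ?e t * g' (of_real t))) \<longlongrightarrow>
      p * Laplace g p + (0 - g 0)) at_top"
    by (simp cong: tendsto_cong)
  from tendsto_unique[OF _ l1 this] show ?thesis by simp
qed

text \<open>The truncated integrals are holomorphic by differentiation under the integral, and the
  exponential bound makes their convergence locally uniform.\<close>

lemma holomorphic2_on_Laplace:
  assumes U: "open U" and D: "holomorphic2_on \<phi> D" "\<And>x t. x \<in> U \<Longrightarrow> t \<ge> 0 \<Longrightarrow> (x, complex_of_real t) \<in> D"
    and bd: "\<And>x t. x \<in> U \<Longrightarrow> 0 \<le> t \<Longrightarrow> cmod (\<phi> (x, of_real t)) \<le> K * exp (L * t)"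
  shows "holomorphic2_on (\<lambda>(x, p). Laplace (\<lambda>t. \<phi> (x, t)) p) (U \<times> {p. Re p > L})"
proof -
  let ?D = "U \<times> {p. Re p > L}"
  let ?f = "\<lambda>n p. integral {0..real n} (\<lambda>t. exp (- (snd p * complex_of_real t)) * \<phi> (fst p, of_real t))"
  have cont: "continuous_on {0..} (\<lambda>t::real. \<phi> (x, of_real t))" if "x \<in> U" for x
    by (rule continuous_on_compose2[OF holomorphic2_on_imp_continuous_on[OF D(1)]])
       (use that D(2) in \<open>auto intro!: continuous_intros\<close>)
  have opD: "open ?D" using U by (intro open_Times open_halfspace_Re_gt)
  have "holomorphic2_on (\<lambda>(x, p). Laplace (\<lambda>t. \<phi> (x, t)) p) ?D"
  proof (rule holomorphic2_on_uniform_limit[OF opD, where f = ?f])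
    fix n
    show "holomorphic2_on (?f n) ?D"
    proof (rule holomorphic2_on_integral[OF opD])
      have 1: "continuous_on (?D \<times> {0..real n}) (\<lambda>q. \<phi> (fst (fst q), of_real (snd q)))"
        by (rule continuous_on_compose2[OF holomorphic2_on_imp_continuous_on[OF D(1)]])
           (use D(2) in \<open>auto intro!: continuous_intros\<close>)
      show "continuous_on (?D \<times> {0..real n}) (\<lambda>(p, s). exp (- (snd p * complex_of_real s)) * \<phi> (fst p, of_real s))"
        unfolding case_prod_unfold by (intro continuous_intros 1)
      fix s assume s: "s \<in> {0..real n}"
      have "holomorphic2_on (\<lambda>w. \<phi> (fst w, complex_of_real s)) ?D"
        by (rule holomorphic2_on_compose[OF D(1)]) (use D(2) s in \<open>auto intro: hol2_intros\<close>)
      moreover have "holomorphic2_on (\<lambda>w. exp (- (snd w * complex_of_real s))) ?D"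
        by (rule holomorphic2_on_compose1[where U = UNIV and g = exp])
           (auto intro!: hol2_intros holomorphic_on_exp)
      ultimately show "holomorphic2_on (\<lambda>p. exp (- (snd p * complex_of_real s)) * \<phi> (fst p, complex_of_real s)) ?D"
        by (rule holomorphic2_on_mult[rotated])
    qed
  next
    fix q assume q: "q \<in> ?D"
    obtain x p where xp: "q = (x, p)" "x \<in> U" "Re p > L" using q by auto
    define \<kappa> where "\<kappa> = (Re p + L) / 2"
    have \<kappa>: "\<kappa> > L" "\<kappa> < Re p" using xp by (auto simp: \<kappa>_def)
    let ?N = "U \<times> {p. Re p > \<kappa>}"
    have K: "K \<ge> 0"
    proof -
      have "0 \<le> K * exp (L * 0)" using bd[OF xp(2), of 0] norm_ge_zero order_trans by blast
      then show ?thesis by simp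
    qed
    have "uniform_limit ?N ?f (\<lambda>(x, p). Laplace (\<lambda>t. \<phi> (x, t)) p) sequentially"
    proof (rule uniform_limitI)
      fix e :: real assume e: "e > 0"
      have "(\<lambda>n. K * exp (- (\<kappa> - L) * real n) / (\<kappa> - L)) \<longlonglongrightarrow> 0"
        using filterlim_compose[OF Laplace_tail_tendsto[of L "of_real \<kappa>" K] filterlim_real_sequentially] \<kappa> by simp
      then have "\<forall>\<^sub>F n in sequentially. K * exp (- (\<kappa> - L) * real n) / (\<kappa> - L) < e"
        using e by (rule order_tendstoD)
      then show "\<forall>\<^sub>F n in sequentially. \<forall>q\<in>?N. dist (?f n q) (case q of (x, p) \<Rightarrow> Laplace (\<lambda>t. \<phi> (x, t)) p) < e"
      proof eventually_elim
        case (elim n)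
        show ?case
        proof
          fix q assume "q \<in> ?N"
          then obtain y p where yp: "q = (y, p)" "y \<in> U" "Re p > \<kappa>" by auto
          have "cmod (Laplace (\<lambda>t. \<phi> (y, t)) p - ?f n q) \<le> K * exp (- (Re p - L) * real n) / (Re p - L)"
            using Laplace_integral_split[OF cont[OF yp(2)] bd[OF yp(2)], of p "real n"] yp \<kappa> by simp
          also have "\<dots> \<le> K * exp (- (\<kappa> - L) * real n) / (\<kappa> - L)"
            using yp \<kappa> K by (intro frac_le mult_left_mono) (auto intro!: mult_right_mono)
          finally show "dist (?f n q) (case q of (x, p) \<Rightarrow> Laplace (\<lambda>t. \<phi> (x, t)) p) < e"
            using elim yp by (simp add: dist_norm norm_minus_commute)
        qed
      qed
    qed
    then show "\<exists>N. open N \<and> q \<in> N \<and> N \<subseteq> ?D \<and> uniform_limit N ?f (\<lambda>(x, p). Laplace (\<lambda>t. \<phi> (x, t)) p) sequentially"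
      using xp \<kappa> U by (intro exI[of _ ?N]) (auto intro!: open_Times open_halfspace_Re_gt)
  qed
  then show ?thesis .
qed

lemma open_tube: "open (tube \<epsilon>)"
  unfolding tube_def by (intro open_Collect_less continuous_intros)

lemma ball_subset_tube: "t \<ge> 0 \<Longrightarrow> ball (complex_of_real t) \<epsilon> \<subseteq> tube \<epsilon>"
proof
  fix \<xi> assume t: "t \<ge> 0" and x: "\<xi> \<in> ball (complex_of_real t) \<epsilon>"
  have "infdist \<xi> (complex_of_real ` {0..}) \<le> dist \<xi> (of_real t)"
    using t by (intro infdist_le) auto
  then show "\<xi> \<in> tube \<epsilon>" using x by (simp add: tube_def dist_commute)
qed

text \<open>Cauchy's estimate on discs of the fixed radius \<open>\<epsilon> / 2\<close> around the points of the
  positive axis: here the width of the tube becomes the Gevrey constant.\<close>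

lemma higher_deriv_tube_bound:
  assumes hol: "g holomorphic_on tube \<epsilon>" and \<epsilon>: "\<epsilon> > 0" and L: "L \<ge> 0"
    and bd: "\<And>\<xi>. \<xi> \<in> tube \<epsilon> \<Longrightarrow> cmod (g \<xi>) \<le> K * exp (L * cmod \<xi>)" and t: "t \<ge> 0"
  shows "cmod ((deriv ^^ n) g (of_real t)) \<le> fact n * (K * exp (L * (\<epsilon> / 2))) / (\<epsilon> / 2) ^ n * exp (L * t)"
proof -
  let ?r = "\<epsilon> / 2"
  have sub: "cball (complex_of_real t) ?r \<subseteq> tube \<epsilon>"
    using ball_subset_tube[OF t, of \<epsilon>] \<epsilon> by (force simp: subset_iff)
  have K: "K \<ge> 0"
  proof -
    have "complex_of_real t \<in> tube \<epsilon>" using sub \<epsilon> by auto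
    then have "0 \<le> K * exp (L * cmod (of_real t))" using bd norm_ge_zero order_trans by blast
    then show ?thesis by (simp add: zero_le_mult_iff)
  qed
  have "cmod ((deriv ^^ n) g (of_real t)) \<le> fact n * (K * exp (L * (t + ?r))) / ?r ^ n"
  proof (rule Cauchy_inequality)
    show "g holomorphic_on ball (complex_of_real t) ?r"
      by (rule holomorphic_on_subset[OF hol]) (use sub in force)
    show "continuous_on (cball (complex_of_real t) ?r) g"
      by (rule holomorphic_on_imp_continuous_on[OF holomorphic_on_subset[OF hol sub]])
    fix w assume w: "cmod (of_real t - w) = ?r"
    then have "w \<in> tube \<epsilon>" using sub by (auto simp: dist_norm)
    moreover have "cmod w \<le> t + ?r"
      using norm_triangle_ineq4[of "of_real t" "of_real t - w"] t w by simp
    ultimately show "cmod (g w) \<le> K * exp (L * (t + ?r))"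
      by (intro order_trans[OF bd] mult_left_mono) (use K L in \<open>auto intro!: mult_left_mono\<close>)
  qed (use \<epsilon> in auto)
  then show ?thesis by (simp add: algebra_simps exp_add)
qed

lemma Laplace_higher_deriv:
  assumes hol: "g holomorphic_on tube \<epsilon>" and \<epsilon>: "\<epsilon> > 0" and L: "L \<ge> 0"
    and bd: "\<And>\<xi>. \<xi> \<in> tube \<epsilon> \<Longrightarrow> cmod (g \<xi>) \<le> K * exp (L * cmod \<xi>)" and p: "Re p > L"
  shows "Laplace g p = (\<Sum>k<n. (deriv ^^ k) g 0 * (1 / p) ^ Suc k) + (1 / p) ^ n * Laplace ((deriv ^^ n) g) p"
proof (induction n)
  case (Suc n)
  have p0: "p \<noteq> 0" using p L by auto
  have "Laplace ((deriv ^^ Suc n) g) p = p * Laplace ((deriv ^^ n) g) p - (deriv ^^ n) g 0"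
  proof (rule Laplace_deriv)
    have in_tube: "complex_of_real t \<in> tube \<epsilon>" if "t \<ge> 0" for t
      using ball_subset_tube[OF that, of \<epsilon>] \<epsilon> by auto
    have h: "(deriv ^^ k) g holomorphic_on tube \<epsilon>" for k
      by (rule holomorphic_higher_deriv[OF hol open_tube])
    show "((deriv ^^ n) g has_field_derivative (deriv ^^ Suc n) g (of_real t)) (at (of_real t))" if "0 \<le> t" for t
      using holomorphic_derivI[OF h open_tube in_tube[OF that]] by simp
    show "continuous_on {0..} (\<lambda>t::real. (deriv ^^ Suc n) g (of_real t))"
      by (rule continuous_on_compose2[OF holomorphic_on_imp_continuous_on[OF h]])
         (use in_tube in \<open>auto intro!: continuous_intros\<close>)
  qed (use higher_deriv_tube_bound[OF hol \<epsilon> L bd] p in blast)+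
  then have "(1 / p) ^ n * Laplace ((deriv ^^ n) g) p =
     (deriv ^^ n) g 0 * (1 / p) ^ Suc n + (1 / p) ^ Suc n * Laplace ((deriv ^^ Suc n) g) p"
    using p0 by (simp add: field_simps)
  then show ?case using Suc.IH by simp
qed simp

text \<open>The Laplace integral of \<open>\<xi>\<^sup>k\<close> is \<open>k! h\<^sup>k\<^sup>+\<^sup>1\<close>, so the Taylor coefficients of the Borel
  transform at 0 reappear shifted by one order and multiplied by factorials.\<close>

definition Borel_coeff :: "(complex \<Rightarrow> complex) \<Rightarrow> (complex \<times> complex \<Rightarrow> complex) \<Rightarrow> nat \<Rightarrow> complex \<Rightarrow> complex" where
  "Borel_coeff F0 \<phi> k x = (case k of 0 \<Rightarrow> F0 x | Suc j \<Rightarrow> (deriv ^^ j) (\<lambda>\<xi>. \<phi> (x, \<xi>)) 0)"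

definition Borel_sum :: "(complex \<Rightarrow> complex) \<Rightarrow> (complex \<times> complex \<Rightarrow> complex) \<Rightarrow> complex \<times> complex \<Rightarrow> complex" where
  "Borel_sum F0 \<phi> = (\<lambda>(x, h). F0 x + Laplace (\<lambda>\<xi>. \<phi> (x, \<xi>)) (1 / h))"

lemma holomorphic_on_higher_deriv_param:
  assumes U: "open U" and hol: "holomorphic2_on \<phi> (U \<times> V)" and r: "r > 0" "cball w r \<subseteq> V"
  shows "(\<lambda>x. (deriv ^^ k) (\<lambda>\<xi>. \<phi> (x, \<xi>)) w) holomorphic_on U"
proof -
  define c where "c = (\<lambda>s::real. 2 * of_real pi * \<i> * of_real r * exp (2 * of_real pi * \<i> * of_real s) / (circlepath w r s - w) ^ Suc k)"
  define G where "G = (\<lambda>s (q::complex \<times> complex). \<phi> (fst q, circlepath w r s) * c s)"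
  have circ: "circlepath w r s \<in> V" "circlepath w r s - w \<noteq> 0" for s
    using r by (auto simp: circlepath dist_norm norm_mult intro!: subsetD[OF r(2)])
  have contc: "continuous_on {0..1} c"
    unfolding c_def by (intro continuous_intros) (use circ(2) in \<open>auto simp: circlepath intro!: continuous_intros\<close>)
  have "holomorphic2_on (\<lambda>q. integral {0..1} (\<lambda>s. G s q)) (U \<times> UNIV)"
  proof (rule holomorphic2_on_integral)
    show "open (U \<times> (UNIV :: complex set))" using U by (intro open_Times) auto
    have "continuous_on ((U \<times> UNIV) \<times> {0..1}) (\<lambda>q. \<phi> (fst (fst q), circlepath w r (snd q)))"
      by (rule continuous_on_compose2[OF holomorphic2_on_imp_continuous_on[OF hol]])
         (use circ(1) in \<open>auto simp: circlepath intro!: continuous_intros\<close>)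
    moreover have "continuous_on ((U \<times> (UNIV :: complex set)) \<times> {0..1}) (\<lambda>q. c (snd q))"
      by (rule continuous_on_compose2[OF contc]) (auto intro!: continuous_intros)
    ultimately show "continuous_on ((U \<times> UNIV) \<times> {0..1}) (\<lambda>(p, s). G s p)"
      unfolding G_def case_prod_unfold by (rule continuous_on_mult)
    show "holomorphic2_on (G s) (U \<times> UNIV)" for s
      unfolding G_def by (intro hol2_intros holomorphic2_on_compose[OF hol]) (use circ in auto)
  qed
  then have "(\<lambda>x. integral {0..1} (\<lambda>s. G s (x, 0))) holomorphic_on U"
    by (rule holomorphic2_on_slice1) auto
  then have "(\<lambda>x. fact k / (2 * pi * \<i>) * integral {0..1} (\<lambda>s. G s (x, 0))) holomorphic_on U"
    by (intro holomorphic_intros)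
  moreover have "fact k / (2 * pi * \<i>) * integral {0..1} (\<lambda>s. G s (x, 0)) = (deriv ^^ k) (\<lambda>\<xi>. \<phi> (x, \<xi>)) w"
    if "x \<in> U" for x
  proof -
    have "(\<lambda>\<xi>. \<phi> (x, \<xi>)) holomorphic_on cball w r"
      by (rule holomorphic2_on_slice2[OF hol]) (use that r in auto)
    then have "contour_integral (circlepath w r) (\<lambda>u. \<phi> (x, u) / (u - w) ^ Suc k) =
        (2 * pi * \<i>) * (deriv ^^ k) (\<lambda>\<xi>. \<phi> (x, \<xi>)) w / fact k"
      using r by (intro Cauchy_contour_integral_circlepath)
        (auto intro: holomorphic_on_imp_continuous_on holomorphic_on_subset)
    moreover have "contour_integral (circlepath w r) (\<lambda>u. \<phi> (x, u) / (u - w) ^ Suc k) =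
        integral {0..1} (\<lambda>s. G s (x, 0))"
      by (simp add: contour_integral_integral vector_derivative_circlepath G_def c_def algebra_simps)
    ultimately have "integral {0..1} (\<lambda>s. G s (x, 0)) =
        (2 * pi * \<i>) * (deriv ^^ k) (\<lambda>\<xi>. \<phi> (x, \<xi>)) w / fact k" by simp
    then show ?thesis by (simp only:) simp
  qed
  ultimately show ?thesis by (rule holomorphic_transform)
qed

text \<open>The condition on \<open>R\<close> keeps \<open>Re (1 / h) - L\<close> at least 1 on the Borel disc, so that no
  Laplace integral degenerates at its boundary.\<close>

locale Borel_data =
  fixes U :: "complex set" and F0 :: "complex \<Rightarrow> complex" and \<phi> :: "complex \<times> complex \<Rightarrow> complex"
    and \<epsilon> K L B R :: real
  assumes U: "open U" and hol: "holomorphic2_on \<phi> (U \<times> tube \<epsilon>)" and \<epsilon>: "\<epsilon> > 0"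
    and K: "K > 0" and L: "L > 0"
    and bd: "\<And>x \<xi>. x \<in> U \<Longrightarrow> \<xi> \<in> tube \<epsilon> \<Longrightarrow> cmod (\<phi> (x, \<xi>)) \<le> K * exp (L * cmod \<xi>)"
    and F0: "F0 holomorphic_on U" "\<And>x. x \<in> U \<Longrightarrow> cmod (F0 x) \<le> B"
    and B: "B \<ge> 0" and R: "R > 0" "1 / R \<ge> L + 1"
begin

lemma slice_hol: "x \<in> U \<Longrightarrow> (\<lambda>\<xi>. \<phi> (x, \<xi>)) holomorphic_on tube \<epsilon>"
  by (rule holomorphic2_on_slice2[OF hol]) auto

lemma in_tube: "t \<ge> 0 \<Longrightarrow> complex_of_real t \<in> tube \<epsilon>"
  using ball_subset_tube[of t \<epsilon>] \<epsilon> by auto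

lemma slice_cont: "x \<in> U \<Longrightarrow> continuous_on {0..} (\<lambda>t::real. \<phi> (x, of_real t))"
  by (rule continuous_on_compose2[OF holomorphic_on_imp_continuous_on[OF slice_hol]])
     (use in_tube in \<open>auto intro!: continuous_intros\<close>)

lemma slice_bd: "x \<in> U \<Longrightarrow> 0 \<le> t \<Longrightarrow> cmod (\<phi> (x, of_real t)) \<le> K * exp (L * t)"
  using bd[of x "of_real t"] in_tube[of t] by simp

lemma disc: "h \<in> Borel_disc R \<Longrightarrow> Re (1 / h) \<ge> L + 1"
  using R unfolding Borel_disc_def by auto

lemma Borel_coeff_holomorphic: "Borel_coeff F0 \<phi> k holomorphic_on U"
proof (cases k)
  case (Suc j)
  have "cball 0 (\<epsilon> / 2) \<subseteq> tube \<epsilon>" using ball_subset_tube[of 0 \<epsilon>] \<epsilon> by force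
  from holomorphic_on_higher_deriv_param[OF U hol _ this] \<epsilon>
  show ?thesis by (simp add: Borel_coeff_def[abs_def] Suc)
qed (use F0 in \<open>simp add: Borel_coeff_def[abs_def]\<close>)

lemma Borel_sum_holomorphic2: "holomorphic2_on (Borel_sum F0 \<phi>) (U \<times> Borel_disc R)"
proof -
  have 1: "holomorphic2_on (\<lambda>(x, p). Laplace (\<lambda>t. \<phi> (x, t)) p) (U \<times> {p. Re p > L})"
    by (rule holomorphic2_on_Laplace[OF U hol]) (use in_tube slice_bd in auto)
  have "holomorphic2_on (\<lambda>w. (\<lambda>(x, p). Laplace (\<lambda>t. \<phi> (x, t)) p) (fst w, 1 / snd w)) (U \<times> Borel_disc R)"
  proof (rule holomorphic2_on_compose[OF 1])
    show "holomorphic2_on (\<lambda>w. 1 / snd w) (U \<times> Borel_disc R)"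
      by (rule holomorphic2_on_compose1[where g = "\<lambda>h. 1 / h" and U = "- {0}"])
         (use Borel_disc_nz R in \<open>auto intro!: hol2_intros holomorphic_intros\<close>)
    show "(fst w, 1 / snd w) \<in> U \<times> {p. L < Re p}" if "w \<in> U \<times> Borel_disc R" for w
      using that disc[of "snd w"] by auto
  qed (rule hol2_intros)
  moreover have "holomorphic2_on (\<lambda>w. F0 (fst w)) (U \<times> Borel_disc R)"
    by (rule holomorphic2_on_compose1[OF F0(1) U]) (auto intro: hol2_intros)
  ultimately show ?thesis
    unfolding Borel_sum_def case_prod_unfold by (auto intro: hol2_intros)
qed

text \<open>After \<open>n\<close> integrations by parts the remainder is \<open>h\<^sup>n\<close> times a coefficient of order \<open>n\<close>
  and the Laplace integral of the derivative of order \<open>n\<close>; both are of size \<open>n! / r\<^sup>n\<close>.\<close>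

lemma Borel_sum_Gevrey: "Gevrey_asymptotic (Borel_sum F0 \<phi>) (Borel_coeff F0 \<phi>) U (Borel_disc R)"
proof -
  define r where "r = \<epsilon> / 2"
  define K' where "K' = K * exp (L * r)"
  have pos: "r > 0" "K' > 0" using \<epsilon> K by (auto simp: r_def K'_def)
  have main: "cmod (Borel_sum F0 \<phi> (x, h) - (\<Sum>k<n. Borel_coeff F0 \<phi> k x * h ^ k))
      \<le> (B + K' * r + K') * (1 / r) ^ n * fact n * norm h ^ n"
    if x: "x \<in> U" and h: "h \<in> Borel_disc R" for x h n
  proof -
    define p where "p = 1 / h"
    have p: "Re p \<ge> L + 1" "1 / p = h" using disc[OF h] by (auto simp: p_def)
    let ?g = "\<lambda>\<xi>. \<phi> (x, \<xi>)"
    have hb: "cmod ((deriv ^^ n) ?g (of_real t)) \<le> fact n * K' / r ^ n * exp (L * t)" if "t \<ge> 0" for t n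
      using higher_deriv_tube_bound[OF slice_hol[OF x] \<epsilon> _ bd[OF x] that, of n] L by (simp add: r_def K'_def)
    have lp: "cmod (Laplace ((deriv ^^ n) ?g) p) \<le> fact n * K' / r ^ n"
    proof -
      have h: "(deriv ^^ n) ?g holomorphic_on tube \<epsilon>"
        by (rule holomorphic_higher_deriv[OF slice_hol[OF x] open_tube])
      have c: "continuous_on {0..} (\<lambda>t::real. (deriv ^^ n) ?g (of_real t))"
        by (rule continuous_on_compose2[OF holomorphic_on_imp_continuous_on[OF h]])
           (use in_tube in \<open>auto intro!: continuous_intros\<close>)
      have "cmod (Laplace ((deriv ^^ n) ?g) p) \<le> fact n * K' / r ^ n / (Re p - L)"
        by (rule Laplace_bound[OF c hb]) (use p in auto)
      also have "\<dots> \<le> fact n * K' / r ^ n / 1"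
        using p pos by (intro divide_left_mono) auto
      finally show ?thesis by simp
    qed
    have co: "cmod (Borel_coeff F0 \<phi> n x) \<le> fact n * (B + K' * r) / r ^ n"
    proof (cases n)
      case 0
      then show ?thesis using F0(2)[OF x] pos by (simp add: Borel_coeff_def add_increasing2)
    next
      case (Suc m)
      have "cmod (Borel_coeff F0 \<phi> n x) \<le> fact m * K' / r ^ m"
        using hb[of 0 m] by (simp add: Borel_coeff_def Suc)
      also have "\<dots> = fact m * (K' * r) / r ^ n" using pos by (simp add: Suc)
      also have "\<dots> \<le> fact n * (B + K' * r) / r ^ n"
        using pos B by (intro divide_right_mono mult_mono fact_mono) (auto simp: Suc)
      finally show ?thesis .
    qed
    have "Laplace ?g p = (\<Sum>k<n. (deriv ^^ k) ?g 0 * h ^ Suc k) + h ^ n * Laplace ((deriv ^^ n) ?g) p"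
      using Laplace_higher_deriv[OF slice_hol[OF x] \<epsilon> _ bd[OF x], of p n] L p by simp
    then have "Borel_sum F0 \<phi> (x, h) = (\<Sum>k<Suc n. Borel_coeff F0 \<phi> k x * h ^ k) + h ^ n * Laplace ((deriv ^^ n) ?g) p"
      unfolding sum.lessThan_Suc_shift by (simp add: Borel_sum_def Borel_coeff_def p_def)
    then have "Borel_sum F0 \<phi> (x, h) - (\<Sum>k<n. Borel_coeff F0 \<phi> k x * h ^ k) =
        h ^ n * (Borel_coeff F0 \<phi> n x + Laplace ((deriv ^^ n) ?g) p)" by (simp add: algebra_simps)
    then have "cmod (Borel_sum F0 \<phi> (x, h) - (\<Sum>k<n. Borel_coeff F0 \<phi> k x * h ^ k)) \<le>
        norm h ^ n * (fact n * (B + K' * r) / r ^ n + fact n * K' / r ^ n)"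
      by (simp only: norm_mult norm_power) (intro mult_left_mono norm_triangle_le add_mono co lp; simp)
    also have "\<dots> = (B + K' * r + K') * (1 / r) ^ n * fact n * norm h ^ n"
      using pos by (simp add: power_divide field_simps)
    finally show ?thesis .
  qed
  have "B + K' * r + K' > 0" using pos B by (simp add: add_nonneg_pos)
  then show ?thesis
    unfolding Gevrey_asymptotic_def
    by (intro exI[of _ "B + K' * r + K'"] exI[of _ "1 / r"] exI[of _ 1] conjI) (use main pos in auto)
qed

lemma Borel_sum_resummation: "uniform_Borel_resummation (Borel_sum F0 \<phi>) (Borel_coeff F0 \<phi>) U (Borel_disc R)"
proof -
  define r where "r = \<epsilon> / 2"
  define K' where "K' = K * exp (L * r)"
  have pos: "r > 0" "K' > 0" using \<epsilon> K by (auto simp: r_def K'_def)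
  let ?t = "\<lambda>k (x, \<xi>). Borel_coeff F0 \<phi> (Suc k) x / fact k * \<xi> ^ k"
  have "uniform_limit (U \<times> ball 0 (r / 2)) (\<lambda>n q. \<Sum>k<n. ?t k q) (\<lambda>q. \<Sum>k. ?t k q) sequentially"
  proof (rule Weierstrass_m_test)
    show "norm (?t k q) \<le> K' * (1 / 2) ^ k" if qin: "q \<in> U \<times> ball 0 (r / 2)" for k q
    proof -
      obtain x \<xi> where q: "q = (x, \<xi>)" "x \<in> U" "cmod \<xi> < r / 2" using qin by (cases q) auto
      have "cmod ((deriv ^^ k) (\<lambda>\<xi>. \<phi> (x, \<xi>)) 0) \<le> fact k * K' / r ^ k"
        using higher_deriv_tube_bound[OF slice_hol[OF q(2)] \<epsilon> _ bd[OF q(2)], of 0 k] L by (simp add: r_def K'_def)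
      then have "norm (?t k q) \<le> (fact k * K' / r ^ k) / fact k * (r / 2) ^ k"
        unfolding q(1) prod.case norm_mult norm_divide norm_power
        using q pos by (intro mult_mono divide_mono power_mono) (auto simp: Borel_coeff_def)
      also have "\<dots> = K' * (1 / 2) ^ k" using pos by (simp add: power_divide field_simps)
      finally show ?thesis .
    qed
    show "summable (\<lambda>k. K' * (1 / 2) ^ k)" by (intro summable_mult summable_geometric) auto
  qed
  moreover have "(\<Sum>k. ?t k q) = \<phi> q" if qin: "q \<in> U \<times> ball 0 (r / 2)" for q
  proof -
    obtain x \<xi> where q: "q = (x, \<xi>)" "x \<in> U" "cmod \<xi> < r / 2" using qin by (cases q) auto
    have "(\<lambda>\<xi>. \<phi> (x, \<xi>)) holomorphic_on ball 0 \<epsilon>"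
      using holomorphic_on_subset[OF slice_hol[OF q(2)]] ball_subset_tube[of 0 \<epsilon>] by simp
    from holomorphic_power_series[OF this, of \<xi>] q pos
    have "(\<lambda>n. (deriv ^^ n) (\<lambda>\<xi>. \<phi> (x, \<xi>)) 0 / fact n * \<xi> ^ n) sums \<phi> (x, \<xi>)" by (simp add: r_def)
    then show ?thesis using q(1) by (simp add: Borel_coeff_def sums_iff)
  qed
  ultimately have "uniform_limit (U \<times> ball 0 (r / 2)) (\<lambda>n q. \<Sum>k<n. ?t k q) \<phi> sequentially"
    by (simp cong: uniform_limit_cong')
  then have ul: "uniform_limit (U \<times> ball 0 (r / 2)) (\<lambda>n (x, \<xi>). \<Sum>k<n. Borel_coeff F0 \<phi> (Suc k) x / fact k * \<xi> ^ k) \<phi> sequentially"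
    by (simp add: case_prod_unfold)
  have lim: "uniform_limit U
           (\<lambda>T x. Borel_coeff F0 \<phi> 0 x + integral {0..T} (\<lambda>t. exp (- complex_of_real t / h) * \<phi> (x, complex_of_real t)))
           (\<lambda>x. Borel_sum F0 \<phi> (x, h)) at_top" if h: "h \<in> Borel_disc R" for h
  proof (rule uniform_limitI)
    fix e :: real assume e: "e > 0"
    have p: "Re (1 / h) > L" using disc[OF h] by simp
    have "\<forall>\<^sub>F T in at_top. K * exp (- (Re (1 / h) - L) * T) / (Re (1 / h) - L) < e"
      using Laplace_tail_tendsto[OF p] e by (rule order_tendstoD)
    then show "\<forall>\<^sub>F T in at_top. \<forall>x\<in>U. dist (Borel_coeff F0 \<phi> 0 x + integral {0..T}
        (\<lambda>t. exp (- complex_of_real t / h) * \<phi> (x, complex_of_real t))) (Borel_sum F0 \<phi> (x, h)) < e"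
      using eventually_ge_at_top[of 0]
    proof eventually_elim
      case (elim T)
      show ?case
      proof
        fix x assume x: "x \<in> U"
        show "dist (Borel_coeff F0 \<phi> 0 x + integral {0..T}
            (\<lambda>t. exp (- complex_of_real t / h) * \<phi> (x, complex_of_real t))) (Borel_sum F0 \<phi> (x, h)) < e"
          using Laplace_integral_split[OF slice_cont[OF x] slice_bd[OF x] p elim(2)] elim(1)
          by (simp add: Borel_coeff_def Borel_sum_def dist_norm norm_minus_commute)
      qed
    qed
  qed
  show ?thesis
    unfolding uniform_Borel_resummation_def
    by (rule exI[of _ \<phi>], rule exI[of _ \<epsilon>], rule exI[of _ "r / 2"], rule exI[of _ K], rule exI[of _ L])
       (use pos \<epsilon> K L ul hol bd lim in \<open>auto simp: r_def\<close>)
qed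

end

section \<open>Laplace integrals of convolutions\<close>

lemma set_integrable_exp_decay:
  fixes f :: "real \<Rightarrow> complex"
  assumes c: "continuous_on {0..} f" and \<kappa>: "\<kappa> > 0"
    and bd: "\<And>t. 0 \<le> t \<Longrightarrow> cmod (f t) \<le> C * exp (- \<kappa> * t)"
  shows "set_integrable lborel {0..} f"
proof -
  have hi: "((\<lambda>t. C * exp (- \<kappa> * t)) has_integral C * (exp (- \<kappa> * 0) / \<kappa>)) {0..}"
    using \<kappa> by (intro has_integral_mult_right has_integral_exp_minus_to_infinity) auto
  have m: "f \<in> borel_measurable (lebesgue_on {0..})"
    by (rule continuous_imp_measurable_on_sets_lebesgue[OF c]) auto
  have le: "norm (f t) \<le> C * exp (- \<kappa> * t)" if "t \<in> {0..}" for t using bd that by simp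
  have "f integrable_on {0..}"
    by (rule measurable_bounded_by_integrable_imp_integrable[OF m has_integral_integrable[OF hi] le]) auto
  then have "f absolutely_integrable_on {0..}"
    using absolutely_integrable_integrable_bound[OF le _ has_integral_integrable[OF hi]] by blast
  then show ?thesis
    unfolding set_integrable_def
    by (subst (asm) integrable_completion)
       (use borel_measurable_continuous_on_indicator[OF _ c] in auto)
qed

text \<open>The change of variables \<open>(s, t) \<mapsto> (s, t - s)\<close> maps the region \<open>0 \<le> s \<le> t\<close> to the
  quadrant.\<close>

lemma Fubini_triangle:
  fixes G :: "real \<times> real \<Rightarrow> complex"
  assumes c: "continuous_on ({0..} \<times> {0..}) G" and \<kappa>: "\<kappa> > 0"
    and bd: "\<And>s u. 0 \<le> s \<Longrightarrow> 0 \<le> u \<Longrightarrow> cmod (G (s, u)) \<le> C * exp (- \<kappa> * (s + u))"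
  shows "integral {0..} (\<lambda>t. integral {0..t} (\<lambda>s. G (s, t - s))) =
         integral {0..} (\<lambda>s. integral {0..} (\<lambda>u. G (s, u)))"
proof -
  define S where "S = {q::real \<times> real. 0 \<le> fst q \<and> fst q \<le> snd q}"
  define H where "H = (\<lambda>q. indicator S q *\<^sub>R G (fst q, snd q - fst q))"
  define e where "e = (\<lambda>t::real. indicator {0..} t *\<^sub>R exp (- (\<kappa> / 2) * t))"
  have clS: "closed S" unfolding S_def
    by (intro closed_Collect_conj closed_Collect_le continuous_intros)
  have mH: "H \<in> borel_measurable (lborel \<Otimes>\<^sub>M lborel)"
  proof -
    have "continuous_on S (\<lambda>q. G (fst q, snd q - fst q))"
      by (rule continuous_on_compose2[OF c]) (auto simp: S_def intro!: continuous_intros)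
    then have "H \<in> borel_measurable borel"
      unfolding H_def by (rule borel_measurable_continuous_on_indicator[rotated]) (use clS in auto)
    then show ?thesis by (simp add: lborel_prod)
  qed
  have "set_integrable lborel {0..} (\<lambda>t. complex_of_real (exp (- (\<kappa> / 2) * t)))"
    using \<kappa> by (intro set_integrable_exp_decay[where \<kappa> = "\<kappa> / 2" and C = 1]) (auto intro!: continuous_intros)
  then have "integrable lborel (\<lambda>t. Re (indicator {0..} t *\<^sub>R complex_of_real (exp (- (\<kappa> / 2) * t))))"
    unfolding set_integrable_def by (rule integrable_Re)
  then have ie: "integrable lborel e" by (simp add: e_def)
  have e0: "e t \<ge> 0" for t by (simp add: e_def)
  have id: "integrable (lborel \<Otimes>\<^sub>M lborel) (\<lambda>q. C * (e (fst q) * e (snd q)))"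
  proof (intro integrable_mult_right lborel_pair.Fubini_integrable)
    have [measurable]: "e \<in> borel_measurable lborel" using ie by auto
    show "(\<lambda>q. e (fst q) * e (snd q)) \<in> borel_measurable (lborel \<Otimes>\<^sub>M lborel)" by measurable
    show "integrable lborel (\<lambda>x. LINT y|lborel. norm (e (fst (x, y)) * e (snd (x, y))))"
      using ie e0 by (simp add: abs_mult)
    show "AE x in lborel. integrable lborel (\<lambda>y. e (fst (x, y)) * e (snd (x, y)))"
      using ie by simp
  qed
  \<comment> \<open>On the support \<open>s \<le> t\<close>, half of the decay in \<open>t\<close> can be spent on \<open>s\<close>.\<close>
  have iH: "integrable (lborel \<Otimes>\<^sub>M lborel) H"
  proof (rule Bochner_Integration.integrable_bound[OF id mH], intro AE_I2)
    fix q :: "real \<times> real"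
    obtain s t where q: "q = (s, t)" by (cases q)
    show "norm (H q) \<le> norm (C * (e (fst q) * e (snd q)))"
    proof (cases "q \<in> S")
      case True
      then have st: "0 \<le> s" "s \<le> t" by (auto simp: S_def q)
      have C: "C \<ge> 0" using bd[of 0 0] norm_ge_zero[of "G (0,0)"] by (auto intro: order_trans[rotated])
      have "norm (H q) \<le> C * exp (- \<kappa> * t)" using bd[of s "t - s"] st True by (simp add: H_def q)
      also have "\<dots> \<le> C * exp (- (\<kappa> / 2) * s + - (\<kappa> / 2) * t)"
        using C \<kappa> st by (intro mult_left_mono) (auto simp: field_simps)
      also have "\<dots> = C * (e s * e t)" unfolding exp_add using st by (simp add: e_def)
      finally show ?thesis using C e0 by (simp add: q)
    qed (simp add: H_def)
  qed
  have L: "(LINT s|lborel. H (s, t)) = indicator {0..} t *\<^sub>R integral {0..t} (\<lambda>s. G (s, t - s))" for t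
  proof (cases "t \<ge> 0")
    case True
    have ct: "continuous_on {0..t} (\<lambda>s. G (s, t - s))"
      by (rule continuous_on_compose2[OF c]) (auto intro!: continuous_intros)
    have "(LINT s|lborel. H (s, t)) = (LINT s:{0..t}|lborel. G (s, t - s))"
      unfolding set_lebesgue_integral_def
      by (rule Bochner_Integration.integral_cong) (auto simp: H_def S_def indicator_def)
    also have "\<dots> = integral {0..t} (\<lambda>s. G (s, t - s))"
      by (rule set_borel_integral_eq_integral) (rule borel_integrable_atLeastAtMost'[OF ct])
    finally show ?thesis using True by simp
  next
    case False
    then have "H (s, t) = 0" for s by (auto simp: H_def S_def)
    then show ?thesis using False by simp
  qed
  have Rr: "(LINT t|lborel. H (s, t)) = indicator {0..} s *\<^sub>R integral {0..} (\<lambda>u. G (s, u))" for s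
  proof (cases "s \<ge> 0")
    case True
    have ct: "continuous_on {0..} (\<lambda>u. G (s, u))"
      by (rule continuous_on_compose2[OF c]) (use True in \<open>auto intro!: continuous_intros\<close>)
    have "(LINT t|lborel. H (s, t)) = (LINT u|lborel. H (s, s + 1 * u))"
      by (subst lborel_integral_real_affine[of 1 _ s]) auto
    also have "\<dots> = (LINT u:{0..}|lborel. G (s, u))"
      unfolding set_lebesgue_integral_def
      by (rule Bochner_Integration.integral_cong) (use True in \<open>auto simp: H_def S_def indicator_def\<close>)
    also have "\<dots> = integral {0..} (\<lambda>u. G (s, u))"
      by (rule set_borel_integral_eq_integral,
          rule set_integrable_exp_decay[OF ct \<kappa>, where C = "C * exp (- \<kappa> * s)"])
         (use bd[OF True] in \<open>auto simp: distrib_left mult.assoc simp flip: exp_add\<close>)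
    finally show ?thesis using True by simp
  next
    case False
    then have "H (s, t) = 0" for t by (auto simp: H_def S_def)
    then show ?thesis using False by simp
  qed
  have iH': "integrable (lborel \<Otimes>\<^sub>M lborel) (case_prod (\<lambda>s t. H (s, t)))" using iH by simp
  have i1: "integrable lborel (\<lambda>t. LINT s|lborel. H (s, t))"
    using lborel_pair.integrable_snd[OF iH'] .
  have i2: "integrable lborel (\<lambda>s. LINT t|lborel. H (s, t))"
    using lborel_pair.integrable_fst'[OF iH] .
  have "(LINT t|lborel. LINT s|lborel. H (s, t)) = (LINT s|lborel. LINT t|lborel. H (s, t))"
    using lborel_pair.Fubini_integral[OF iH'] .
  moreover have "(LINT t|lborel. LINT s|lborel. H (s, t)) = integral {0..} (\<lambda>t. integral {0..t} (\<lambda>s. G (s, t - s)))"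
    using set_borel_integral_eq_integral(2)[of "{0..}" "\<lambda>t. integral {0..t} (\<lambda>s. G (s, t - s))"] i1
    unfolding L set_integrable_def set_lebesgue_integral_def by simp
  moreover have "(LINT s|lborel. LINT t|lborel. H (s, t)) = integral {0..} (\<lambda>s. integral {0..} (\<lambda>u. G (s, u)))"
    using set_borel_integral_eq_integral(2)[of "{0..}" "\<lambda>s. integral {0..} (\<lambda>u. G (s, u))"] i2
    unfolding Rr set_integrable_def set_lebesgue_integral_def by simp
  ultimately show ?thesis by simp
qed

lemma integral_unit_interval_rescale:
  fixes f :: "real \<Rightarrow> complex"
  assumes c: "continuous_on {0..t} f" and t: "t \<ge> 0"
  shows "integral {0..1} (\<lambda>s. of_real t * f (s * t)) = integral {0..t} f"
proof (cases "t = 0")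
  case False
  with t have t: "t > 0" by simp
  have "(f has_integral integral {0..t} f) {0..t}"
    using c by (intro integrable_integral integrable_continuous_interval)
  from has_integral_stretch_real[OF this, of t] t
  have "((\<lambda>s. f (t * s)) has_integral (1 / t) *\<^sub>R integral {0..t} f) ((\<lambda>x. x / t) ` {0..t})" by simp
  moreover have "(\<lambda>x. x / t) ` {0..t} = {0..1}"
    using t by (auto simp: image_iff field_simps intro!: bexI[of _ "t * _"])
  ultimately have "((\<lambda>s. f (t * s)) has_integral (1 / t) *\<^sub>R integral {0..t} f) {0..1}" by simp
  then have "((\<lambda>s. of_real t * f (t * s)) has_integral of_real t * ((1 / t) *\<^sub>R integral {0..t} f)) {0..1}"
    by (rule has_integral_mult_right)
  from integral_unique[OF this] show ?thesis
    using t by (simp add: mult.commute[of t] scaleR_conv_of_real del: integral_mult_right)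
qed simp

text \<open>Both the convolution theorem and the Laplace integral of an integral along
  characteristics are instances of this identity: \<open>\<Gamma>\<close> is a product in the former case, and
  depends on \<open>s\<close> through a shift of the base point in the latter.\<close>

lemma Laplace_triangle:
  fixes \<Gamma> :: "real \<times> real \<Rightarrow> complex"
  assumes c: "continuous_on ({0..} \<times> {0..}) \<Gamma>" and p: "Re p > L"
    and bd: "\<And>s u. 0 \<le> s \<Longrightarrow> 0 \<le> u \<Longrightarrow> cmod (\<Gamma> (s, u)) \<le> C * exp (L * (s + u))"
  shows "integral {0..} (\<lambda>t. exp (- (p * of_real t)) *
            integral {0..1} (\<lambda>s. of_real t * \<Gamma> (s * t, (1 - s) * t))) =
         integral {0..} (\<lambda>s. exp (- (p * of_real s)) * integral {0..} (\<lambda>u. exp (- (p * of_real u)) * \<Gamma> (s, u)))"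
proof -
  define G where "G = (\<lambda>q. exp (- (p * of_real (fst q + snd q))) * \<Gamma> q)"
  have cG: "continuous_on ({0..} \<times> {0..}) G" unfolding G_def by (intro continuous_intros c)
  have bG: "cmod (G (s, u)) \<le> C * exp (- (Re p - L) * (s + u))" if "0 \<le> s" "0 \<le> u" for s u
  proof -
    have "cmod (G (s, u)) \<le> exp (- (Re p * (s + u))) * (C * exp (L * (s + u)))"
      unfolding G_def norm_mult by (intro mult_mono) (use bd[OF that] in auto)
    also have "\<dots> = C * exp (- (Re p - L) * (s + u))"
      by (simp add: mult.left_commute flip: exp_add) (simp add: algebra_simps)
    finally show ?thesis .
  qed
  have F: "integral {0..} (\<lambda>t. integral {0..t} (\<lambda>s. G (s, t - s))) =
         integral {0..} (\<lambda>s. integral {0..} (\<lambda>u. G (s, u)))"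
    by (rule Fubini_triangle[OF cG _ bG]) (use p in auto)
  have l: "exp (- (p * of_real t)) * integral {0..1} (\<lambda>s. of_real t * \<Gamma> (s * t, (1 - s) * t)) =
        integral {0..t} (\<lambda>s. G (s, t - s))" if t: "t \<in> {0..}" for t
  proof -
    have ct: "continuous_on {0..t} (\<lambda>s. \<Gamma> (s, t - s))"
      by (rule continuous_on_compose2[OF c]) (auto intro!: continuous_intros)
    have "integral {0..1} (\<lambda>s. of_real t * \<Gamma> (s * t, (1 - s) * t)) = integral {0..t} (\<lambda>s. \<Gamma> (s, t - s))"
      using integral_unit_interval_rescale[OF ct] t by (simp add: algebra_simps)
    then show ?thesis by (simp add: G_def)
  qed
  have r: "exp (- (p * of_real s)) * integral {0..} (\<lambda>u. exp (- (p * of_real u)) * \<Gamma> (s, u)) =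
      integral {0..} (\<lambda>u. G (s, u))" for s
    by (simp add: G_def exp_add exp_diff ring_distribs mult.assoc flip: integral_mult_right)
       (simp add: exp_minus field_simps exp_add)
  show ?thesis unfolding r F[symmetric] by (rule integral_cong) (rule l)
qed

section \<open>Convolution and contraction in the Borel plane\<close>

text \<open>Convolution along the segment from 0 to \<open>\<xi>\<close>, which is holomorphic in \<open>\<xi>\<close>; it
  corresponds to the product of Laplace integrals.\<close>

definition conv :: "(complex \<times> complex \<Rightarrow> complex) \<Rightarrow> (complex \<times> complex \<Rightarrow> complex) \<Rightarrow> complex \<times> complex \<Rightarrow> complex" where
  "conv f g = (\<lambda>(z, \<xi>). integral {0..1} (\<lambda>s::real. \<xi> * (f (z, of_real s * \<xi>) * g (z, of_real (1 - s) * \<xi>))))"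

text \<open>Integration along the characteristic \<open>z + \<xi> = const\<close> from \<open>(z, \<xi>)\<close> to \<open>(z + \<xi>, 0)\<close>.\<close>

definition char_int :: "(complex \<times> complex \<Rightarrow> complex) \<Rightarrow> complex \<times> complex \<Rightarrow> complex" where
  "char_int f = (\<lambda>(z, \<xi>). integral {0..1} (\<lambda>s::real. \<xi> * f (z + of_real s * \<xi>, of_real (1 - s) * \<xi>)))"

text \<open>The factor \<open>1 / (1 + t\<^sup>2)\<close> is what makes the weight stable under convolution; with a
  pure exponential a factor \<open>t\<close> would appear each time.\<close>

definition wt :: "real \<Rightarrow> real \<Rightarrow> real" where
  "wt L t = exp (L * t) / (1 + t\<^sup>2)"

lemma wt_pos: "wt L t > 0"
  by (simp add: wt_def add_pos_nonneg)

lemma one_plus_square_le_exp: "t \<ge> 0 \<Longrightarrow> 1 + t\<^sup>2 \<le> 2 * exp (t::real)"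
proof -
  assume t: "t \<ge> 0"
  have "1 + t + t\<^sup>2 / 2 \<le> exp t" by (rule exp_lower_Taylor_quadratic[OF t])
  then show ?thesis using t by linarith
qed

lemma exp_le_wt: "t \<ge> 0 \<Longrightarrow> a + 1 \<le> L \<Longrightarrow> exp (a * t) \<le> 2 * wt L t"
proof -
  assume t: "t \<ge> 0" and L: "a + 1 \<le> L"
  have "exp (a * t) * (1 + t\<^sup>2) \<le> exp (a * t) * (2 * exp t)"
    by (intro mult_left_mono one_plus_square_le_exp t) auto
  also have "\<dots> = 2 * exp ((a + 1) * t)" by (simp add: distrib_right exp_add)
  also have "\<dots> \<le> 2 * exp (L * t)" using t L by (simp add: mult_right_mono)
  finally show ?thesis by (simp add: wt_def field_simps add_pos_nonneg)
qed

lemma wt_le_exp: "wt L t \<le> exp (L * t)"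
  by (simp add: wt_def divide_le_eq add_pos_nonneg mult_left_le_one_le field_simps)

text \<open>For \<open>a + b = t\<close> one has \<open>1 + t\<^sup>2 \<le> 2 (1 + a\<^sup>2) + 2 (1 + b\<^sup>2)\<close>; division by
  \<open>(1 + a\<^sup>2) (1 + b\<^sup>2)\<close> leaves a sum of two integrable terms.\<close>

lemma wt_mult_le:
  assumes "a \<ge> 0" "b \<ge> 0"
  shows "wt L1 a * wt L2 b \<le> exp (L1 * a + L2 * b) * (2 / (1 + a\<^sup>2) + 2 / (1 + b\<^sup>2)) / (1 + (a + b)\<^sup>2)"
proof -
  have p: "1 + a\<^sup>2 > 0" "1 + b\<^sup>2 > 0" "1 + (a + b)\<^sup>2 > 0" by (auto simp: add_pos_nonneg)
  have "0 \<le> (a - b)\<^sup>2" by simp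
  then have "1 + (a + b)\<^sup>2 \<le> 2 * (1 + b\<^sup>2) + 2 * (1 + a\<^sup>2)" by (simp add: power2_eq_square algebra_simps)
  then have "1 / ((1 + a\<^sup>2) * (1 + b\<^sup>2)) \<le> (2 / (1 + a\<^sup>2) + 2 / (1 + b\<^sup>2)) / (1 + (a + b)\<^sup>2)"
    using p by (simp add: divide_simps)
  from mult_left_mono[OF this, of "exp (L1 * a + L2 * b)"]
  show ?thesis by (simp add: wt_def exp_add)
qed

lemma exp_scaled_integral:
  fixes t :: real
  assumes "l > 0" "t \<ge> 0"
  obtains I where "((\<lambda>s. t * exp (- l * (s * t))) has_integral I) {0..1}" "I \<le> 1 / l"
proof
  have "((\<lambda>s. t * exp (- l * (s * t))) has_integral
      ((- exp (- l * (1 * t)) / l) - (- exp (- l * (0 * t)) / l))) {0..1}"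
    by (rule fundamental_theorem_of_calculus)
       (use assms in \<open>auto intro!: derivative_eq_intros simp flip: has_real_derivative_iff_has_vector_derivative\<close>)
  then show "((\<lambda>s. t * exp (- l * (s * t))) has_integral (1 - exp (- l * t)) / l) {0..1}"
    using assms by (simp add: diff_divide_distrib)
  show "(1 - exp (- l * t)) / l \<le> 1 / l" using assms by (simp add: divide_right_mono)
qed

lemma wt_convolution_integral:
  fixes t :: real
  assumes t: "t \<ge> 0"
  obtains I where "((\<lambda>s. t * (exp (L * t) * (2 / (1 + (s * t)\<^sup>2) + 2 / (1 + ((1 - s) * t)\<^sup>2)) / (1 + t\<^sup>2))) has_integral I) {0..1}"
    "I \<le> 2 * pi * wt L t"
proof
  have "((\<lambda>s. t * (2 / (1 + (s * t)\<^sup>2) + 2 / (1 + ((1 - s) * t)\<^sup>2))) has_integral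
      ((2 * arctan (1 * t) - 2 * arctan ((1 - 1) * t)) - (2 * arctan (0 * t) - 2 * arctan ((1 - 0) * t)))) {0..1}"
    by (rule fundamental_theorem_of_calculus)
       (auto intro!: derivative_eq_intros simp: field_simps simp flip: has_real_derivative_iff_has_vector_derivative)
  then have "((\<lambda>s. wt L t * (t * (2 / (1 + (s * t)\<^sup>2) + 2 / (1 + ((1 - s) * t)\<^sup>2)))) has_integral wt L t * (4 * arctan t)) {0..1}"
    by (intro has_integral_mult_right) simp
  then show "((\<lambda>s. t * (exp (L * t) * (2 / (1 + (s * t)\<^sup>2) + 2 / (1 + ((1 - s) * t)\<^sup>2)) / (1 + t\<^sup>2))) has_integral wt L t * (4 * arctan t)) {0..1}"
    by (simp add: wt_def mult_ac)
  have "4 * arctan t \<le> 2 * pi" using arctan_bounded[of t] by linarith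
  then show "wt L t * (4 * arctan t) \<le> 2 * pi * wt L t"
    using wt_pos[of L t] by (simp add: mult.commute mult_left_mono)
qed

definition starlike2 :: "(complex \<times> complex) set \<Rightarrow> bool" where
  "starlike2 D \<longleftrightarrow> open D \<and> (\<forall>z \<xi> s. (z, \<xi>) \<in> D \<longrightarrow> 0 \<le> s \<longrightarrow> s \<le> 1 \<longrightarrow> (z, complex_of_real s * \<xi>) \<in> D)"

text \<open>The weight is split: the dependence on \<open>\<xi>\<close> is fixed, whereas the factor \<open>w\<close> depends on
  \<open>z\<close> and multiplies under convolution.\<close>

definition weighted :: "(complex \<times> complex) set \<Rightarrow> real \<Rightarrow> (complex \<times> complex \<Rightarrow> complex) \<Rightarrow> (complex \<Rightarrow> real) \<Rightarrow> bool" where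
  "weighted D L f w \<longleftrightarrow> holomorphic2_on f D \<and> (\<forall>z \<xi>. (z, \<xi>) \<in> D \<longrightarrow> cmod (f (z, \<xi>)) \<le> w z * wt L (cmod \<xi>))"

lemma weightedD: "weighted D L f w \<Longrightarrow> (z, \<xi>) \<in> D \<Longrightarrow> cmod (f (z, \<xi>)) \<le> w z * wt L (cmod \<xi>)"
  by (simp add: weighted_def)

lemma weighted_nonneg: "weighted D L f w \<Longrightarrow> (z, \<xi>) \<in> D \<Longrightarrow> 0 \<le> w z"
  using weightedD[of D L f w z \<xi>] wt_pos[of L "cmod \<xi>"] norm_ge_zero[of "f (z, \<xi>)"]
  by (meson order_trans zero_le_mult_iff not_le)

lemma weighted_add: "weighted D L f w \<Longrightarrow> weighted D L g v \<Longrightarrow> weighted D L (\<lambda>q. f q + g q) (\<lambda>z. w z + v z)"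
  unfolding weighted_def by (auto intro!: hol2_intros norm_triangle_le add_mono simp: distrib_right)

lemma weighted_diff: "weighted D L f w \<Longrightarrow> weighted D L g v \<Longrightarrow> weighted D L (\<lambda>q. f q - g q) (\<lambda>z. w z + v z)"
  unfolding weighted_def by (auto intro!: hol2_intros norm_triangle_le_diff add_mono simp: distrib_right)

lemma weighted_minus: "weighted D L f w \<Longrightarrow> weighted D L (\<lambda>q. - f q) w"
  unfolding weighted_def by (auto intro: hol2_intros)

lemma weighted_mono: "weighted D L f w \<Longrightarrow> (\<And>z \<xi>. (z, \<xi>) \<in> D \<Longrightarrow> w z \<le> v z) \<Longrightarrow> weighted D L f v"
  unfolding weighted_def using wt_pos by (meson mult_right_mono less_imp_le order_trans)

lemma weighted_mult:
  assumes f: "weighted D L f w" and c: "c holomorphic_on H" "open H"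
    and H: "\<And>z \<xi>. (z, \<xi>) \<in> D \<Longrightarrow> z \<in> H" and u: "\<And>z. z \<in> H \<Longrightarrow> cmod (c z) \<le> u z"
  shows "weighted D L (\<lambda>q. c (fst q) * f q) (\<lambda>z. u z * w z)"
  unfolding weighted_def
proof (intro conjI allI impI)
  show "holomorphic2_on (\<lambda>q. c (fst q) * f q) D"
    using f H by (intro hol2_intros holomorphic2_on_compose1[OF c]) (auto simp: weighted_def)
  fix z \<xi> assume z: "(z, \<xi>) \<in> D"
  have "cmod (c z) * cmod (f (z, \<xi>)) \<le> u z * (w z * wt L (cmod \<xi>))"
    using u[OF H[OF z]] weightedD[OF f z] by (intro mult_mono) (auto intro: order_trans[rotated])
  then show "cmod (c (fst (z, \<xi>)) * f (z, \<xi>)) \<le> u z * w z * wt L (cmod \<xi>)"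
    by (simp add: norm_mult mult.assoc)
qed

lemma conv_holomorphic2:
  assumes D: "starlike2 D" and f: "holomorphic2_on f D" and g: "holomorphic2_on g D"
  shows "holomorphic2_on (conv f g) D"
proof -
  let ?G = "\<lambda>s q. snd q * (f (fst q, complex_of_real s * snd q) * g (fst q, complex_of_real (1 - s) * snd q))"
  have inD: "(fst q, complex_of_real s * snd q) \<in> D" "(fst q, complex_of_real (1 - s) * snd q) \<in> D"
    if "q \<in> D" "s \<in> {0..1}" for q s
    using D that unfolding starlike2_def by (metis atLeastAtMost_iff diff_ge_0_iff_ge prod.collapse diff_le_eq le_add_same_cancel1)+
  have "holomorphic2_on (\<lambda>q. integral {0..1} (\<lambda>s. ?G s q)) D"
  proof (rule holomorphic2_on_integral)
    show "open D" using D by (simp add: starlike2_def)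
    have 1: "continuous_on (D \<times> {0..1}) (\<lambda>r. f (fst (fst r), complex_of_real (snd r) * snd (fst r)))"
      by (rule continuous_on_compose2[OF holomorphic2_on_imp_continuous_on[OF f]])
         (use inD in \<open>auto intro!: continuous_intros\<close>)
    have 2: "continuous_on (D \<times> {0..1}) (\<lambda>r. g (fst (fst r), complex_of_real (1 - snd r) * snd (fst r)))"
      by (rule continuous_on_compose2[OF holomorphic2_on_imp_continuous_on[OF g]])
         (use inD in \<open>auto intro!: continuous_intros simp del: of_real_diff\<close>)
    show "continuous_on (D \<times> {0..1}) (\<lambda>(q, s). ?G s q)"
      unfolding case_prod_unfold by (intro continuous_intros 1 2)
    show "holomorphic2_on (?G s) D" if "s \<in> {0..1}" for s
      by (intro hol2_intros holomorphic2_on_compose[OF f] holomorphic2_on_compose[OF g]) (use inD that in auto)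
  qed
  then show ?thesis by (simp add: conv_def case_prod_unfold)
qed

lemma conv_integrand_continuous:
  assumes D: "starlike2 D" and f: "holomorphic2_on f D" and g: "holomorphic2_on g D" and z: "(z, \<xi>) \<in> D"
  shows "continuous_on {0..1} (\<lambda>s::real. \<xi> * (f (z, of_real s * \<xi>) * g (z, of_real (1 - s) * \<xi>)))"
proof -
  have inD: "(z, complex_of_real s * \<xi>) \<in> D" "(z, complex_of_real (1 - s) * \<xi>) \<in> D" if "s \<in> {0..1}" for s
    using D that z by (auto simp: starlike2_def simp del: of_real_diff)
  have 1: "continuous_on {0..1} (\<lambda>s. f (z, complex_of_real s * \<xi>))"
    by (rule continuous_on_compose2[OF holomorphic2_on_imp_continuous_on[OF f]])
       (use inD in \<open>auto intro!: continuous_intros\<close>)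
  have 2: "continuous_on {0..1} (\<lambda>s. g (z, complex_of_real (1 - s) * \<xi>))"
    by (rule continuous_on_compose2[OF holomorphic2_on_imp_continuous_on[OF g]])
       (use inD in \<open>auto intro!: continuous_intros simp del: of_real_diff\<close>)
  show ?thesis by (intro continuous_intros 1 2)
qed

lemma conv_diff:
  assumes D: "starlike2 D" and f: "holomorphic2_on f D" "holomorphic2_on f' D"
    and g: "holomorphic2_on g D" "holomorphic2_on g' D" and q: "q \<in> D"
  shows "conv f g q - conv f' g' q = conv (\<lambda>q. f q - f' q) g q + conv f' (\<lambda>q. g q - g' q) q"
proof -
  obtain z \<xi> where q': "q = (z, \<xi>)" by (cases q)
  note z = q[unfolded q']
  note c = conv_integrand_continuous[OF D _ _ z, THEN integrable_continuous_interval]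
  have "conv f g q - conv f' g' q = integral {0..1} (\<lambda>s::real.
      \<xi> * (f (z, of_real s * \<xi>) * g (z, of_real (1 - s) * \<xi>)) -
      \<xi> * (f' (z, of_real s * \<xi>) * g' (z, of_real (1 - s) * \<xi>)))"
    unfolding conv_def q' prod.case by (rule integral_diff[symmetric]) (rule c f g)+
  also have "\<dots> = integral {0..1} (\<lambda>s::real.
      \<xi> * ((f (z, of_real s * \<xi>) - f' (z, of_real s * \<xi>)) * g (z, of_real (1 - s) * \<xi>)) +
      \<xi> * (f' (z, of_real s * \<xi>) * (g (z, of_real (1 - s) * \<xi>) - g' (z, of_real (1 - s) * \<xi>))))"
    by (rule integral_cong) (simp add: algebra_simps)
  also have "\<dots> = conv (\<lambda>q. f q - f' q) g q + conv f' (\<lambda>q. g q - g' q) q"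
    unfolding conv_def q' prod.case
    by (rule integral_add[OF c[OF holomorphic2_on_diff[OF f] g(1)] c[OF f(2) holomorphic2_on_diff[OF g]]])
  finally show ?thesis .
qed

lemma conv_norm_bound:
  assumes D: "starlike2 D" and f: "weighted D L1 f w" and g: "weighted D L2 g v" and z: "(z, \<xi>) \<in> D"
    and h: "(h has_integral J) {0..1}"
      "\<And>s. s \<in> {0..1} \<Longrightarrow> cmod \<xi> * (wt L1 (s * cmod \<xi>) * wt L2 ((1 - s) * cmod \<xi>)) \<le> h s"
  shows "cmod (conv f g (z, \<xi>)) \<le> w z * v z * J"
proof -
  have wv: "w z \<ge> 0" "v z \<ge> 0" using weighted_nonneg[OF f z] weighted_nonneg[OF g z] by auto
  have hJ: "((\<lambda>s. w z * v z * h s) has_integral w z * v z * J) {0..1}"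
    by (rule has_integral_mult_right[OF h(1)])
  have "norm (integral {0..1} (\<lambda>s::real. \<xi> * (f (z, of_real s * \<xi>) * g (z, of_real (1 - s) * \<xi>)))) \<le>
      integral {0..1} (\<lambda>s. w z * v z * h s)"
  proof (rule integral_norm_bound_integral)
    show "(\<lambda>s::real. \<xi> * (f (z, of_real s * \<xi>) * g (z, of_real (1 - s) * \<xi>))) integrable_on {0..1}"
      using f g by (intro integrable_continuous_interval conv_integrand_continuous[OF D _ _ z]) (auto simp: weighted_def)
    show "(\<lambda>s. w z * v z * h s) integrable_on {0..1}" using hJ by blast
    fix s :: real assume s: "s \<in> {0..1}"
    have inD: "(z, complex_of_real s * \<xi>) \<in> D" "(z, complex_of_real (1 - s) * \<xi>) \<in> D"
      using D s z by (auto simp: starlike2_def simp del: of_real_diff)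
    have n: "cmod (complex_of_real s * \<xi>) = s * cmod \<xi>" "cmod (complex_of_real (1 - s) * \<xi>) = (1 - s) * cmod \<xi>"
      using s by (auto simp: norm_mult simp del: of_real_diff)
    have "cmod \<xi> * (cmod (f (z, of_real s * \<xi>)) * cmod (g (z, of_real (1 - s) * \<xi>))) \<le>
       cmod \<xi> * ((w z * wt L1 (s * cmod \<xi>)) * (v z * wt L2 ((1 - s) * cmod \<xi>)))"
      using weightedD[OF f inD(1)] weightedD[OF g inD(2)] wv wt_pos unfolding n
      by (intro mult_left_mono mult_mono) (auto intro: mult_nonneg_nonneg less_imp_le)
    also have "\<dots> = w z * v z * (cmod \<xi> * (wt L1 (s * cmod \<xi>) * wt L2 ((1 - s) * cmod \<xi>)))"
      by (simp add: mult_ac)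
    also have "\<dots> \<le> w z * v z * h s" using h(2)[OF s] wv by (intro mult_left_mono) auto
    finally show "norm (\<xi> * (f (z, of_real s * \<xi>) * g (z, of_real (1 - s) * \<xi>))) \<le> w z * v z * h s"
      by (simp add: norm_mult)
  qed
  then show ?thesis unfolding integral_unique[OF hJ] by (simp add: conv_def)
qed

text \<open>The integral of the two terms provided by \<open>wt_mult_le\<close> is \<open>4 arctan t\<close>.\<close>

lemma weighted_conv:
  assumes D: "starlike2 D" and f: "weighted D L f w" and g: "weighted D L g v"
  shows "weighted D L (conv f g) (\<lambda>z. 2 * pi * (w z * v z))"
  unfolding weighted_def
proof (intro conjI allI impI)
  show "holomorphic2_on (conv f g) D" using f g by (intro conv_holomorphic2 D) (auto simp: weighted_def)
  fix z \<xi> assume z: "(z, \<xi>) \<in> D"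
  let ?t = "cmod \<xi>"
  obtain I where I: "((\<lambda>s. ?t * (exp (L * ?t) * (2 / (1 + (s * ?t)\<^sup>2) + 2 / (1 + ((1 - s) * ?t)\<^sup>2)) / (1 + ?t\<^sup>2))) has_integral I) {0..1}"
    "I \<le> 2 * pi * wt L ?t" by (rule wt_convolution_integral[of ?t L]) auto
  have "cmod (conv f g (z, \<xi>)) \<le> w z * v z * I"
  proof (rule conv_norm_bound[OF D f g z I(1)])
    fix s :: real assume s: "s \<in> {0..1}"
    have eq: "s * ?t + (1 - s) * ?t = ?t" "L * (s * ?t) + L * ((1 - s) * ?t) = L * ?t"
      by (simp_all add: algebra_simps)
    have "wt L (s * ?t) * wt L ((1 - s) * ?t) \<le>
       exp (L * ?t) * (2 / (1 + (s * ?t)\<^sup>2) + 2 / (1 + ((1 - s) * ?t)\<^sup>2)) / (1 + ?t\<^sup>2)"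
      using wt_mult_le[of "s * ?t" "(1 - s) * ?t" L L, unfolded eq] s by (simp del: times_divide_eq_right)
    then show "?t * (wt L (s * ?t) * wt L ((1 - s) * ?t)) \<le>
       ?t * (exp (L * ?t) * (2 / (1 + (s * ?t)\<^sup>2) + 2 / (1 + ((1 - s) * ?t)\<^sup>2)) / (1 + ?t\<^sup>2))"
      by (rule mult_left_mono) auto
  qed
  also have "\<dots> \<le> w z * v z * (2 * pi * wt L ?t)"
    using weighted_nonneg[OF f z] weighted_nonneg[OF g z] by (intro mult_left_mono I) auto
  finally show "cmod (conv f g (z, \<xi>)) \<le> 2 * pi * (w z * v z) * wt L ?t" by (simp add: mult_ac)
qed

text \<open>If one factor grows with a smaller rate, convolution gains the inverse of the
  difference of the rates; this makes linear convolution equations contractive.\<close>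

lemma weighted_conv_small:
  assumes D: "starlike2 D" and f: "weighted D L1 f w" and g: "weighted D L2 g v" and L: "L1 < L2"
  shows "weighted D L2 (conv f g) (\<lambda>z. 4 / (L2 - L1) * (w z * v z))"
  unfolding weighted_def
proof (intro conjI allI impI)
  show "holomorphic2_on (conv f g) D" using f g by (intro conv_holomorphic2 D) (auto simp: weighted_def)
  fix z \<xi> assume z: "(z, \<xi>) \<in> D"
  let ?t = "cmod \<xi>"
  obtain I where I: "((\<lambda>s. ?t * exp (- (L2 - L1) * (s * ?t))) has_integral I) {0..1}" "I \<le> 1 / (L2 - L1)"
    by (rule exp_scaled_integral[of "L2 - L1" ?t]) (use L in auto)
  have "cmod (conv f g (z, \<xi>)) \<le> w z * v z * (4 * wt L2 ?t * I)"
  proof (rule conv_norm_bound[OF D f g z])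
    show "((\<lambda>s. 4 * wt L2 ?t * (?t * exp (- (L2 - L1) * (s * ?t)))) has_integral 4 * wt L2 ?t * I) {0..1}"
      by (rule has_integral_mult_right[OF I(1)])
    fix s :: real assume s: "s \<in> {0..1}"
    have eq: "s * ?t + (1 - s) * ?t = ?t" by (simp add: algebra_simps)
    have "wt L1 (s * ?t) * wt L2 ((1 - s) * ?t) \<le>
       exp (L1 * (s * ?t) + L2 * ((1 - s) * ?t)) * (2 / (1 + (s * ?t)\<^sup>2) + 2 / (1 + ((1 - s) * ?t)\<^sup>2)) / (1 + ?t\<^sup>2)"
      using wt_mult_le[of "s * ?t" "(1 - s) * ?t" L1 L2, unfolded eq] s by (simp del: times_divide_eq_right)
    also have "\<dots> \<le> exp (L1 * (s * ?t) + L2 * ((1 - s) * ?t)) * (2 / 1 + 2 / 1) / (1 + ?t\<^sup>2)"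
      by (intro divide_right_mono mult_left_mono add_mono divide_left_mono) (auto simp: add_pos_nonneg)
    also have "\<dots> = 4 * (wt L2 ?t * exp (- (L2 - L1) * (s * ?t)))"
      by (simp add: wt_def algebra_simps flip: exp_add)
    finally have "wt L1 (s * ?t) * wt L2 ((1 - s) * ?t) \<le> 4 * (wt L2 ?t * exp (- (L2 - L1) * (s * ?t)))" .
    from mult_left_mono[OF this norm_ge_zero]
    show "?t * (wt L1 (s * ?t) * wt L2 ((1 - s) * ?t)) \<le> 4 * wt L2 ?t * (?t * exp (- (L2 - L1) * (s * ?t)))"
      by (simp only: mult_ac)
  qed
  also have "\<dots> \<le> w z * v z * (4 * wt L2 ?t * (1 / (L2 - L1)))"
    using weighted_nonneg[OF f z] weighted_nonneg[OF g z] wt_pos[of L2 ?t] by (intro mult_left_mono I) auto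
  finally show "cmod (conv f g (z, \<xi>)) \<le> 4 / (L2 - L1) * (w z * v z) * wt L2 ?t" by (simp add: mult_ac)
qed

text \<open>Banach's fixed point theorem for a weighted supremum norm. The convergence is locally
  uniform since the weight is continuous, hence the limit is holomorphic.\<close>

lemma weighted_fixpoint:
  assumes D: "open D" and m: "continuous_on D m"
    and T: "\<And>f. holomorphic2_on f D \<Longrightarrow> (\<forall>q\<in>D. cmod (f q) \<le> m q) \<Longrightarrow>
          holomorphic2_on (T f) D \<and> (\<forall>q\<in>D. cmod (T f q) \<le> m q)"
    and contr: "\<And>f g d. holomorphic2_on f D \<Longrightarrow> (\<forall>q\<in>D. cmod (f q) \<le> m q) \<Longrightarrow>
          holomorphic2_on g D \<Longrightarrow> (\<forall>q\<in>D. cmod (g q) \<le> m q) \<Longrightarrow> d \<ge> 0 \<Longrightarrow>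
          (\<forall>q\<in>D. cmod (f q - g q) \<le> d * m q) \<Longrightarrow> (\<forall>q\<in>D. cmod (T f q - T g q) \<le> d / 2 * m q)"
    and m0: "\<And>q. q \<in> D \<Longrightarrow> m q \<ge> 0"
  obtains f where "holomorphic2_on f D" "\<And>q. q \<in> D \<Longrightarrow> cmod (f q) \<le> m q" "\<And>q. q \<in> D \<Longrightarrow> T f q = f q"
proof -
  define F where "F = (\<lambda>n. (T ^^ n) (\<lambda>_. 0))"
  have F0: "F 0 = (\<lambda>_. 0)" and FS: "F (Suc n) = T (F n)" for n by (auto simp: F_def)
  have cls: "holomorphic2_on (F n) D \<and> (\<forall>q\<in>D. cmod (F n q) \<le> m q)" for n
    by (induction n) (use m0 T in \<open>auto simp: F0 FS intro: hol2_intros\<close>)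
  have step: "\<forall>q\<in>D. cmod (F (Suc n) q - F n q) \<le> (1 / 2) ^ n * m q" for n
  proof (induction n)
    case 0
    then show ?case using cls[of 1] by (simp add: F0)
  next
    case (Suc n)
    have "\<forall>q\<in>D. cmod (T (F (Suc n)) q - T (F n) q) \<le> (1 / 2) ^ n / 2 * m q"
      by (rule contr) (use cls Suc in auto)
    then show ?case by (simp add: FS)
  qed
  have tail: "cmod (F (n + k) q - F n q) \<le> 2 * (1 / 2) ^ n * m q" if "q \<in> D" for n k q
  proof -
    have "cmod (F (n + k) q - F n q) \<le> (2 * (1 / 2) ^ n - 2 * (1 / 2) ^ (n + k)) * m q"
    proof (induction k)
      case (Suc k)
      have "cmod (F (n + Suc k) q - F n q) \<le> cmod (F (Suc (n + k)) q - F (n + k) q) + cmod (F (n + k) q - F n q)"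
        using norm_triangle_ineq[of "F (Suc (n + k)) q - F (n + k) q" "F (n + k) q - F n q"] by simp
      also have "\<dots> \<le> (1 / 2) ^ (n + k) * m q + (2 * (1 / 2) ^ n - 2 * (1 / 2) ^ (n + k)) * m q"
        using step[of "n + k"] that Suc by (intro add_mono) auto
      finally show ?case by (simp add: algebra_simps)
    qed simp
    also have "\<dots> \<le> 2 * (1 / 2) ^ n * m q" by (intro mult_right_mono m0 that) simp
    finally show ?thesis .
  qed
  have small: "(\<lambda>n. 2 * (1 / 2) ^ n * c) \<longlonglongrightarrow> (0::real)" for c
    by (intro tendsto_eq_intros LIMSEQ_power_zero) auto
  have cvg: "convergent (\<lambda>n. F n q)" if q: "q \<in> D" for q
  proof -
    have "Cauchy (\<lambda>n. F n q)"
    proof (rule metric_CauchyI)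
      fix e :: real assume "e > 0"
      then have "\<forall>\<^sub>F n in sequentially. 2 * (1 / 2) ^ n * m q < e / 2"
        by (intro order_tendstoD(2)[OF small]) auto
      then obtain N where N: "2 * (1 / 2) ^ N * m q < e / 2" by (auto simp: eventually_sequentially)
      have "dist (F a q) (F N q) < e / 2" if "a \<ge> N" for a
        using tail[OF q, of N "a - N"] that N by (simp add: dist_norm)
      then show "\<exists>M. \<forall>a\<ge>M. \<forall>b\<ge>M. dist (F a q) (F b q) < e"
        by (meson dist_triangle_half_l)
    qed
    then show ?thesis by (simp add: Cauchy_convergent_iff)
  qed
  define f where "f = (\<lambda>q. lim (\<lambda>n. F n q))"
  have lim: "(\<lambda>n. F n q) \<longlonglongrightarrow> f q" if "q \<in> D" for q
    using cvg[OF that] by (simp add: f_def convergent_LIMSEQ_iff)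
  have ftail: "cmod (f q - F n q) \<le> 2 * (1 / 2) ^ n * m q" if q: "q \<in> D" for q n
  proof (rule Lim_bounded[where M = 0])
    show "(\<lambda>k. cmod (F (n + k) q - F n q)) \<longlonglongrightarrow> cmod (f q - F n q)"
      using LIMSEQ_ignore_initial_segment[OF lim[OF q], of n]
      by (intro tendsto_intros) (simp add: add.commute)
  qed (use tail[OF q] in auto)
  have fb: "cmod (f q) \<le> m q" if q: "q \<in> D" for q
    by (rule Lim_bounded[where M = 0, OF tendsto_norm[OF lim[OF q]]]) (use cls q in auto)
  have hol: "holomorphic2_on f D"
  proof (rule holomorphic2_on_uniform_limit[OF D, where f = F])
    show "holomorphic2_on (F n) D" for n using cls by blast
    fix q assume q: "q \<in> D"
    define N where "N = m -` {..<m q + 1} \<inter> D"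
    have "open N" unfolding N_def using continuous_on_open_vimage[OF D, of m] m by auto
    moreover have "uniform_limit N F f sequentially"
    proof (rule uniform_limitI)
      fix e :: real assume e: "e > 0"
      then have "\<forall>\<^sub>F n in sequentially. 2 * (1 / 2) ^ n * (m q + 1) < e"
        by (intro order_tendstoD(2)[OF small])
      then show "\<forall>\<^sub>F n in sequentially. \<forall>x\<in>N. dist (F n x) (f x) < e"
      proof eventually_elim
        case (elim n)
        show ?case
        proof
          fix x assume x: "x \<in> N"
          have "dist (F n x) (f x) \<le> 2 * (1 / 2) ^ n * m x"
            using ftail[of x n] x by (simp add: N_def dist_norm norm_minus_commute)
          also have "\<dots> \<le> 2 * (1 / 2) ^ n * (m q + 1)"
            using x by (intro mult_left_mono) (auto simp: N_def)
          finally show "dist (F n x) (f x) < e" using elim by simp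
        qed
      qed
    qed
    ultimately show "\<exists>N. open N \<and> q \<in> N \<and> N \<subseteq> D \<and> uniform_limit N F f sequentially"
      using q by (intro exI[of _ N]) (auto simp: N_def)
  qed
  have "T f q = f q" if q: "q \<in> D" for q
  proof -
    have "cmod (T f q - F (Suc n) q) \<le> 2 * (1 / 2) ^ n / 2 * m q" for n
      using contr[of f "F n" "2 * (1 / 2) ^ n"] hol fb cls ftail q by (auto simp: FS)
    then have "(\<lambda>n. T f q - F (Suc n) q) \<longlonglongrightarrow> 0"
      by (intro Lim_null_comparison[OF _ small[of "m q / 2"]] always_eventually) (simp add: mult_ac)
    moreover have "(\<lambda>n. T f q - F (Suc n) q) \<longlonglongrightarrow> T f q - f q"
      by (intro tendsto_intros LIMSEQ_Suc lim q)
    ultimately show ?thesis using LIMSEQ_unique by force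
  qed
  with hol fb show ?thesis by (rule that)
qed

section \<open>The Riccati equation in the Borel plane\<close>

text \<open>This domain is invariant under the contraction of \<open>\<xi>\<close> towards 0 and under motion along
  characteristics.\<close>

definition strip2 :: "real \<Rightarrow> (complex \<times> complex) set" where
  "strip2 r = {(z, \<xi>). \<bar>Im z\<bar> + \<bar>Im \<xi>\<bar> < r}"

lemma open_strip2: "open (strip2 r)"
proof -
  have "strip2 r = {q. \<bar>Im (fst q)\<bar> + \<bar>Im (snd q)\<bar> < r}" by (auto simp: strip2_def)
  then show ?thesis by (auto intro!: open_Collect_less continuous_intros)
qed

lemma starlike2_strip2: "starlike2 (strip2 r)"
  unfolding starlike2_def
proof (intro conjI allI impI open_strip2)
  fix z \<xi> and s :: real assume z: "(z, \<xi>) \<in> strip2 r" and s: "0 \<le> s" "s \<le> 1"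
  have "\<bar>s * Im \<xi>\<bar> \<le> \<bar>Im \<xi>\<bar>" using s by (simp add: abs_mult mult_left_le_one_le)
  then show "(z, complex_of_real s * \<xi>) \<in> strip2 r" using z by (simp add: strip2_def)
qed

lemma strip2_horizontal: "(z, \<xi>) \<in> strip2 r \<Longrightarrow> z \<in> horizontal_strip r"
  by (auto simp: strip2_def horizontal_strip_def)

lemma strip2_real: "z \<in> horizontal_strip r \<Longrightarrow> (z, complex_of_real t) \<in> strip2 r"
  by (auto simp: strip2_def horizontal_strip_def)

lemma strip2_char:
  assumes z: "(z, \<xi>) \<in> strip2 r" and s: "0 \<le> s" "s \<le> 1"
  shows "(z + complex_of_real s * \<xi>, complex_of_real (1 - s) * \<xi>) \<in> strip2 r"
proof -
  have "\<bar>Im z + s * Im \<xi>\<bar> \<le> \<bar>Im z\<bar> + s * \<bar>Im \<xi>\<bar>"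
    using s by (intro order_trans[OF abs_triangle_ineq]) (simp add: abs_mult)
  moreover have "\<bar>(1 - s) * Im \<xi>\<bar> = (1 - s) * \<bar>Im \<xi>\<bar>" using s by (simp add: abs_mult)
  ultimately have "\<bar>Im z + s * Im \<xi>\<bar> + \<bar>(1 - s) * Im \<xi>\<bar> \<le> \<bar>Im z\<bar> + \<bar>Im \<xi>\<bar>"
    by (simp add: algebra_simps)
  then show ?thesis using z by (simp add: strip2_def)
qed

lemma open_horizontal_strip: "open (horizontal_strip r)"
  unfolding horizontal_strip_def by (intro open_Collect_conj open_Collect_less continuous_intros)

lemma horizontal_strip_add_real: "z \<in> horizontal_strip r \<Longrightarrow> z + complex_of_real t \<in> horizontal_strip r"
  by (simp add: horizontal_strip_def)

text \<open>A shift of the base point by \<open>a\<close> costs \<open>exp (\<kappa> a)\<close>, but reduces the remaining length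
  from \<open>a + b\<close> to \<open>b\<close> and so gains \<open>exp (L a)\<close>.\<close>

lemma wt_shift:
  assumes ab: "a \<ge> 0" "b \<ge> 0"
  shows "exp (\<kappa> * a) * wt L b \<le> 4 * (wt L (a + b) * exp (- (L - \<kappa> - 1) * a))"
proof -
  have p: "1 + b\<^sup>2 > 0" "1 + (a + b)\<^sup>2 > 0" by (auto simp: add_pos_nonneg)
  have "0 \<le> (a - b)\<^sup>2" "0 \<le> a\<^sup>2 * b\<^sup>2" by auto
  then have "1 + (a + b)\<^sup>2 \<le> 2 * (1 + a\<^sup>2) * (1 + b\<^sup>2)" by (simp add: power2_eq_square algebra_simps)
  also have "\<dots> \<le> 2 * (2 * exp a) * (1 + b\<^sup>2)"
    using p by (intro mult_right_mono mult_left_mono one_plus_square_le_exp ab) auto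
  finally have "1 / (1 + b\<^sup>2) \<le> 4 * exp a / (1 + (a + b)\<^sup>2)" using p by (simp add: field_simps)
  from mult_left_mono[OF this, of "exp (\<kappa> * a + L * b)"]
  have "exp (\<kappa> * a) * wt L b \<le> 4 * exp (\<kappa> * a + L * b + a) / (1 + (a + b)\<^sup>2)"
    by (simp add: wt_def exp_add mult_ac)
  also have "\<kappa> * a + L * b + a = L * (a + b) + (- (L - \<kappa> - 1) * a)" by (simp add: algebra_simps)
  also have "4 * exp (L * (a + b) + (- (L - \<kappa> - 1) * a)) / (1 + (a + b)\<^sup>2) =
      4 * (wt L (a + b) * exp (- (L - \<kappa> - 1) * a))" by (simp add: wt_def exp_add)
  finally show ?thesis .
qed

lemma weighted_cong:
  assumes "weighted D L f w" "\<And>q. q \<in> D \<Longrightarrow> f q = g q"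
  shows "weighted D L g w"
  using assms holomorphic2_on_cong unfolding weighted_def by (metis (no_types, lifting))

lemma weighted_exp_bound:
  assumes "weighted D L f w" "(z, complex_of_real t) \<in> D" "t \<ge> 0"
  shows "cmod (f (z, complex_of_real t)) \<le> w z * exp (L * t)"
proof -
  have "cmod (f (z, complex_of_real t)) \<le> w z * wt L t" using weightedD[OF assms(1,2)] assms(3) by simp
  also have "\<dots> \<le> w z * exp (L * t)"
    by (intro mult_left_mono wt_le_exp weighted_nonneg[OF assms(1,2)])
  finally show ?thesis .
qed

lemma char_int_holomorphic2:
  assumes f: "holomorphic2_on f (strip2 r)"
  shows "holomorphic2_on (char_int f) (strip2 r)"
proof -
  let ?D = "strip2 r"
  let ?G = "\<lambda>s q. snd q * f (fst q + complex_of_real s * snd q, complex_of_real (1 - s) * snd q)"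
  have "holomorphic2_on (\<lambda>q. integral {0..1} (\<lambda>s. ?G s q)) ?D"
  proof (rule holomorphic2_on_integral[OF open_strip2])
    have "continuous_on (?D \<times> {0..1}) (\<lambda>r. f (fst (fst r) + complex_of_real (snd r) * snd (fst r), complex_of_real (1 - snd r) * snd (fst r)))"
      by (rule continuous_on_compose2[OF holomorphic2_on_imp_continuous_on[OF f]])
         (use strip2_char in \<open>auto intro!: continuous_intros simp del: of_real_diff\<close>)
    then show "continuous_on (?D \<times> {0..1}) (\<lambda>(q, s). ?G s q)"
      unfolding case_prod_unfold by (intro continuous_intros)
    show "holomorphic2_on (?G s) ?D" if "s \<in> {0..1}" for s
      by (intro hol2_intros holomorphic2_on_compose[OF f]) (use strip2_char that in auto)
  qed
  then show ?thesis by (simp add: char_int_def case_prod_unfold)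
qed

lemma char_int_integrand_continuous:
  assumes f: "holomorphic2_on f (strip2 r)" and z: "(z, \<xi>) \<in> strip2 r"
  shows "continuous_on {0..1} (\<lambda>s::real. \<xi> * f (z + of_real s * \<xi>, of_real (1 - s) * \<xi>))"
proof -
  have "continuous_on {0..1} (\<lambda>s. f (z + complex_of_real s * \<xi>, complex_of_real (1 - s) * \<xi>))"
    by (rule continuous_on_compose2[OF holomorphic2_on_imp_continuous_on[OF f]])
       (use strip2_char[OF z] in \<open>auto intro!: continuous_intros simp del: of_real_diff\<close>)
  then show ?thesis by (intro continuous_intros)
qed

lemma char_int_diff:
  assumes f: "holomorphic2_on f (strip2 r)" "holomorphic2_on g (strip2 r)" and q: "q \<in> strip2 r"
  shows "char_int f q - char_int g q = char_int (\<lambda>q. f q - g q) q"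
proof -
  obtain z \<xi> where q': "q = (z, \<xi>)" by (cases q)
  note c = char_int_integrand_continuous[OF _ q[unfolded q'], THEN integrable_continuous_interval]
  show ?thesis unfolding char_int_def q' prod.case right_diff_distrib
    by (rule integral_diff[symmetric]) (rule c f)+
qed

locale log_Lipschitz_weight =
  fixes r \<kappa> :: real and \<tau> :: "complex \<Rightarrow> real"
  assumes \<kappa>: "\<kappa> \<ge> 0"
    and \<tau>_pos: "\<And>z. z \<in> horizontal_strip r \<Longrightarrow> \<tau> z > 0"
    and \<tau>_cont: "continuous_on (horizontal_strip r) \<tau>"
    and \<tau>_lip: "\<And>z w. z \<in> horizontal_strip r \<Longrightarrow> w \<in> horizontal_strip r \<Longrightarrow>
        \<tau> w \<le> \<tau> z * exp (\<kappa> * cmod (w - z))"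
begin

lemma weighted_char_int:
  assumes f: "weighted (strip2 r) L f (\<lambda>z. M * \<tau> z)" and L: "L > \<kappa> + 1"
  shows "weighted (strip2 r) L (char_int f) (\<lambda>z. 4 / (L - \<kappa> - 1) * (M * \<tau> z))"
  unfolding weighted_def
proof (intro conjI allI impI)
  have hf: "holomorphic2_on f (strip2 r)" using f by (simp add: weighted_def)
  then show "holomorphic2_on (char_int f) (strip2 r)" by (rule char_int_holomorphic2)
  fix z \<xi> assume z: "(z, \<xi>) \<in> strip2 r"
  let ?t = "cmod \<xi>" and ?l = "L - \<kappa> - 1"
  have zH: "z \<in> horizontal_strip r" by (rule strip2_horizontal[OF z])
  have M: "M \<ge> 0" using weighted_nonneg[OF f z] \<tau>_pos[OF zH] by (simp add: zero_le_mult_iff)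
  obtain I where I: "((\<lambda>s. ?t * exp (- ?l * (s * ?t))) has_integral I) {0..1}" "I \<le> 1 / ?l"
    by (rule exp_scaled_integral[of ?l ?t]) (use L in auto)
  let ?h = "\<lambda>s. M * \<tau> z * (4 * wt L ?t) * (?t * exp (- ?l * (s * ?t)))"
  have h: "(?h has_integral M * \<tau> z * (4 * wt L ?t) * I) {0..1}"
    by (rule has_integral_mult_right[OF I(1)])
  have "norm (integral {0..1} (\<lambda>s::real. \<xi> * f (z + of_real s * \<xi>, of_real (1 - s) * \<xi>))) \<le> integral {0..1} ?h"
  proof (rule integral_norm_bound_integral)
    show "(\<lambda>s::real. \<xi> * f (z + of_real s * \<xi>, of_real (1 - s) * \<xi>)) integrable_on {0..1}"
      by (intro integrable_continuous_interval char_int_integrand_continuous[OF hf z])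
    show "?h integrable_on {0..1}" using h by blast
    fix s :: real assume s: "s \<in> {0..1}"
    have inD: "(z + complex_of_real s * \<xi>, complex_of_real (1 - s) * \<xi>) \<in> strip2 r"
      using strip2_char[OF z] s by (simp del: of_real_diff)
    have n: "cmod (complex_of_real (1 - s) * \<xi>) = (1 - s) * ?t" "cmod (complex_of_real s * \<xi>) = s * ?t"
      using s by (auto simp: norm_mult simp del: of_real_diff)
    have "cmod (f (z + of_real s * \<xi>, of_real (1 - s) * \<xi>)) \<le> M * \<tau> (z + of_real s * \<xi>) * wt L ((1 - s) * ?t)"
      using weightedD[OF f inD] n by simp
    also have "\<dots> \<le> M * (\<tau> z * exp (\<kappa> * (s * ?t))) * wt L ((1 - s) * ?t)"
      using \<tau>_lip[OF zH strip2_horizontal[OF inD]] n M wt_pos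
      by (intro mult_right_mono mult_left_mono) (auto intro: less_imp_le)
    also have "\<dots> = M * \<tau> z * (exp (\<kappa> * (s * ?t)) * wt L ((1 - s) * ?t))" by simp
    also have "\<dots> \<le> M * \<tau> z * (4 * (wt L (s * ?t + (1 - s) * ?t) * exp (- ?l * (s * ?t))))"
      using M \<tau>_pos[OF zH] s by (intro mult_left_mono wt_shift) auto
    also have "s * ?t + (1 - s) * ?t = ?t" by (simp add: algebra_simps)
    finally have "?t * cmod (f (z + of_real s * \<xi>, of_real (1 - s) * \<xi>)) \<le>
        ?t * (M * \<tau> z * (4 * (wt L ?t * exp (- ?l * (s * ?t)))))"
      by (rule mult_left_mono) auto
    then show "norm (\<xi> * f (z + of_real s * \<xi>, of_real (1 - s) * \<xi>)) \<le> ?h s"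
      unfolding norm_mult by (simp only: mult_ac)
  qed
  also have "integral {0..1} ?h = M * \<tau> z * (4 * wt L ?t) * I" by (rule integral_unique[OF h])
  also have "\<dots> \<le> M * \<tau> z * (4 * wt L ?t) * (1 / ?l)"
    using M \<tau>_pos[OF zH] wt_pos[of L ?t] by (intro mult_left_mono I) auto
  finally show "cmod (char_int f (z, \<xi>)) \<le> 4 / ?l * (M * \<tau> z) * wt L ?t"
    by (simp add: char_int_def mult_ac)
qed

end

text \<open>The Borel transform of \<open>h v' = v + h (\<alpha> v\<^sup>2 + \<beta> v + \<gamma>)\<close>, in which \<open>\<alpha>\<close> is represented by
  its leading coefficient \<open>al0\<close> and the Borel transform \<open>a1\<close> of the remaining part, and
  similarly for \<open>\<beta>\<close> and \<open>\<gamma>\<close>.\<close>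

locale Borel_Riccati = log_Lipschitz_weight +
  fixes C :: real and al0 be0 ga0 :: "complex \<Rightarrow> complex" and a1 b1 g1 :: "complex \<times> complex \<Rightarrow> complex"
  assumes C: "C > 0"
    and hol0: "al0 holomorphic_on horizontal_strip r" "be0 holomorphic_on horizontal_strip r"
      "ga0 holomorphic_on horizontal_strip r"
    and hol1: "holomorphic2_on a1 (strip2 r)" "holomorphic2_on b1 (strip2 r)" "holomorphic2_on g1 (strip2 r)"
    and bd0: "\<And>z. z \<in> horizontal_strip r \<Longrightarrow> cmod (al0 z) \<le> C / \<tau> z"
      "\<And>z. z \<in> horizontal_strip r \<Longrightarrow> cmod (be0 z) \<le> C"
      "\<And>z. z \<in> horizontal_strip r \<Longrightarrow> cmod (ga0 z) \<le> C * \<tau> z"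
    and bd1: "\<And>z \<xi>. (z, \<xi>) \<in> strip2 r \<Longrightarrow> cmod (a1 (z, \<xi>)) \<le> C / \<tau> z * exp (cmod \<xi>)"
      "\<And>z \<xi>. (z, \<xi>) \<in> strip2 r \<Longrightarrow> cmod (b1 (z, \<xi>)) \<le> C * exp (cmod \<xi>)"
      "\<And>z \<xi>. (z, \<xi>) \<in> strip2 r \<Longrightarrow> cmod (g1 (z, \<xi>)) \<le> C * \<tau> z * exp (cmod \<xi>)"
begin

definition Borel_rhs :: "(complex \<times> complex \<Rightarrow> complex) \<Rightarrow> complex \<times> complex \<Rightarrow> complex" where
  "Borel_rhs \<phi> q = al0 (fst q) * conv \<phi> \<phi> q + conv a1 (conv \<phi> \<phi>) q + be0 (fst q) * \<phi> q + conv b1 \<phi> q + g1 q"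

text \<open>\<open>B\<close> is the radius of the ball on which the contraction takes place, \<open>Q\<close> bounds the
  right-hand side on that ball, and \<open>L\<close> is large enough for a contraction by the factor
  1/2.\<close>

definition B :: real where "B = 2 * C + 1"
definition Q :: real where "Q = C * (2 * pi * B * B + 2 * (2 * pi) * (2 * pi) * B * B + B + 2 * (2 * pi) * B + 2)"
definition L :: real where "L = \<kappa> + 2 + 16 * Q"

lemma B1: "B \<ge> 1" using C by (simp add: B_def)
lemma Q0: "Q \<ge> 0" using C B1 unfolding Q_def by (intro mult_nonneg_nonneg add_nonneg_nonneg) auto
lemma L2: "L \<ge> \<kappa> + 2" "L \<ge> 2" using Q0 \<kappa> by (auto simp: L_def)

lemma weighted_coeffs:
  "weighted (strip2 r) L a1 (\<lambda>z. 2 * C / \<tau> z)" "weighted (strip2 r) L b1 (\<lambda>z. 2 * C)"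
  "weighted (strip2 r) L g1 (\<lambda>z. 2 * C * \<tau> z)"
proof -
  have e: "exp (cmod \<xi>) \<le> 2 * wt L (cmod \<xi>)" for \<xi> using exp_le_wt[of "cmod \<xi>" 1 L] L2 by simp
  have *: "weighted (strip2 r) L f (\<lambda>z. 2 * w z)"
    if f: "holomorphic2_on f (strip2 r)" "\<And>z \<xi>. (z, \<xi>) \<in> strip2 r \<Longrightarrow> cmod (f (z, \<xi>)) \<le> w z * exp (cmod \<xi>)"
       and w: "\<And>z. z \<in> horizontal_strip r \<Longrightarrow> w z \<ge> 0" for f w
    unfolding weighted_def
  proof (intro conjI allI impI f(1))
    fix z \<xi> assume z: "(z, \<xi>) \<in> strip2 r"
    show "cmod (f (z, \<xi>)) \<le> 2 * w z * wt L (cmod \<xi>)"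
      using order_trans[OF f(2)[OF z] mult_left_mono[OF e w[OF strip2_horizontal[OF z]]]] by (simp add: mult_ac)
  qed
  show "weighted (strip2 r) L a1 (\<lambda>z. 2 * C / \<tau> z)"
    using *[OF hol1(1) bd1(1)] C \<tau>_pos by (simp add: less_imp_le)
  show "weighted (strip2 r) L b1 (\<lambda>z. 2 * C)" using *[OF hol1(2) bd1(2)] C by simp
  show "weighted (strip2 r) L g1 (\<lambda>z. 2 * C * \<tau> z)"
    using *[OF hol1(3) bd1(3)] C \<tau>_pos by (simp add: less_imp_le mult.assoc)
qed

lemma weighted_al0: "weighted (strip2 r) L f w \<Longrightarrow> weighted (strip2 r) L (\<lambda>q. al0 (fst q) * f q) (\<lambda>z. C / \<tau> z * w z)"
  by (rule weighted_mult[OF _ hol0(1) open_horizontal_strip strip2_horizontal bd0(1)])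

lemma weighted_be0: "weighted (strip2 r) L f w \<Longrightarrow> weighted (strip2 r) L (\<lambda>q. be0 (fst q) * f q) (\<lambda>z. C * w z)"
  by (rule weighted_mult[OF _ hol0(2) open_horizontal_strip strip2_horizontal bd0(2)])

lemma weighted_rhs:
  assumes f: "weighted (strip2 r) L \<phi> (\<lambda>z. B * \<tau> z)"
  shows "weighted (strip2 r) L (Borel_rhs \<phi>) (\<lambda>z. Q * \<tau> z)"
proof -
  note cv = weighted_conv[OF starlike2_strip2]
  have "weighted (strip2 r) L (\<lambda>q. al0 (fst q) * conv \<phi> \<phi> q + conv a1 (conv \<phi> \<phi>) q + be0 (fst q) * \<phi> q + conv b1 \<phi> q + g1 q)
     (\<lambda>z. C / \<tau> z * (2 * pi * (B * \<tau> z * (B * \<tau> z))) + 2 * pi * (2 * C / \<tau> z * (2 * pi * (B * \<tau> z * (B * \<tau> z))))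
        + C * (B * \<tau> z) + 2 * pi * (2 * C * (B * \<tau> z)) + 2 * C * \<tau> z)"
    by (intro weighted_add weighted_al0 weighted_be0 cv f weighted_coeffs)
  then have "weighted (strip2 r) L (\<lambda>q. al0 (fst q) * conv \<phi> \<phi> q + conv a1 (conv \<phi> \<phi>) q + be0 (fst q) * \<phi> q + conv b1 \<phi> q + g1 q)
     (\<lambda>z. Q * \<tau> z)"
  proof (rule weighted_mono)
    fix z \<xi> assume "(z, \<xi>) \<in> strip2 r"
    then have "\<tau> z \<noteq> 0" using \<tau>_pos[OF strip2_horizontal] by force
    then show "C / \<tau> z * (2 * pi * (B * \<tau> z * (B * \<tau> z))) + 2 * pi * (2 * C / \<tau> z * (2 * pi * (B * \<tau> z * (B * \<tau> z))))
        + C * (B * \<tau> z) + 2 * pi * (2 * C * (B * \<tau> z)) + 2 * C * \<tau> z \<le> Q * \<tau> z"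
      by (simp add: Q_def algebra_simps)
  qed
  then show ?thesis by (simp add: Borel_rhs_def[abs_def])
qed

lemma weighted_rhs_diff:
  assumes f: "weighted (strip2 r) L \<phi> (\<lambda>z. B * \<tau> z)" and g: "weighted (strip2 r) L \<psi> (\<lambda>z. B * \<tau> z)"
    and d: "weighted (strip2 r) L (\<lambda>q. \<phi> q - \<psi> q) (\<lambda>z. d * (B * \<tau> z))" "d \<ge> 0"
  shows "weighted (strip2 r) L (\<lambda>q. Borel_rhs \<phi> q - Borel_rhs \<psi> q) (\<lambda>z. 2 * d * Q * \<tau> z)"
proof -
  note cv = weighted_conv[OF starlike2_strip2]
  have h: "holomorphic2_on \<phi> (strip2 r)" "holomorphic2_on \<psi> (strip2 r)" using f g by (auto simp: weighted_def)
  note hc = conv_holomorphic2[OF starlike2_strip2]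
  let ?\<delta> = "\<lambda>q. \<phi> q - \<psi> q" and ?\<Delta> = "\<lambda>q. conv \<phi> \<phi> q - conv \<psi> \<psi> q"
  have "weighted (strip2 r) L (\<lambda>q. conv ?\<delta> \<phi> q + conv \<psi> ?\<delta> q)
      (\<lambda>z. 2 * pi * (d * (B * \<tau> z) * (B * \<tau> z)) + 2 * pi * (B * \<tau> z * (d * (B * \<tau> z))))"
    by (intro weighted_add cv d f g)
  then have \<Delta>: "weighted (strip2 r) L ?\<Delta>
      (\<lambda>z. 2 * pi * (d * (B * \<tau> z) * (B * \<tau> z)) + 2 * pi * (B * \<tau> z * (d * (B * \<tau> z))))"
    by (rule weighted_cong) (simp add: conv_diff[OF starlike2_strip2 h h])
  have lin: "conv e f q - conv e g q = conv e (\<lambda>q. f q - g q) q"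
    if "holomorphic2_on e (strip2 r)" "holomorphic2_on f (strip2 r)" "holomorphic2_on g (strip2 r)" "q \<in> strip2 r" for e f g q
  proof -
    have "conv (\<lambda>q. e q - e q) f q = 0" by (simp add: conv_def split: prod.split)
    then show ?thesis using conv_diff[OF starlike2_strip2 that(1,1,2,3,4)] by simp
  qed
  have "weighted (strip2 r) L (\<lambda>q. al0 (fst q) * ?\<Delta> q + conv a1 ?\<Delta> q + be0 (fst q) * ?\<delta> q + conv b1 ?\<delta> q)
     (\<lambda>z. C / \<tau> z * (2 * pi * (d * (B * \<tau> z) * (B * \<tau> z)) + 2 * pi * (B * \<tau> z * (d * (B * \<tau> z))))
       + 2 * pi * (2 * C / \<tau> z * (2 * pi * (d * (B * \<tau> z) * (B * \<tau> z)) + 2 * pi * (B * \<tau> z * (d * (B * \<tau> z)))))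
       + C * (d * (B * \<tau> z)) + 2 * pi * (2 * C * (d * (B * \<tau> z))))"
    by (intro weighted_add weighted_al0 weighted_be0 cv \<Delta> d weighted_coeffs)
  then have "weighted (strip2 r) L (\<lambda>q. Borel_rhs \<phi> q - Borel_rhs \<psi> q)
     (\<lambda>z. C / \<tau> z * (2 * pi * (d * (B * \<tau> z) * (B * \<tau> z)) + 2 * pi * (B * \<tau> z * (d * (B * \<tau> z))))
       + 2 * pi * (2 * C / \<tau> z * (2 * pi * (d * (B * \<tau> z) * (B * \<tau> z)) + 2 * pi * (B * \<tau> z * (d * (B * \<tau> z)))))
       + C * (d * (B * \<tau> z)) + 2 * pi * (2 * C * (d * (B * \<tau> z))))"
  proof (rule weighted_cong)
    fix q assume q: "q \<in> strip2 r"
    show "al0 (fst q) * ?\<Delta> q + conv a1 ?\<Delta> q + be0 (fst q) * ?\<delta> q + conv b1 ?\<delta> q = Borel_rhs \<phi> q - Borel_rhs \<psi> q"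
      using lin[OF hol1(1) hc[OF h(1,1)] hc[OF h(2,2)] q] lin[OF hol1(2) h q]
      by (simp add: Borel_rhs_def algebra_simps)
  qed
  then show ?thesis
  proof (rule weighted_mono)
    fix z \<xi> assume "(z, \<xi>) \<in> strip2 r"
    then have t: "\<tau> z > 0" using \<tau>_pos[OF strip2_horizontal] by force
    have e: "C / \<tau> z * (2 * pi * (d * (B * \<tau> z) * (B * \<tau> z)) + 2 * pi * (B * \<tau> z * (d * (B * \<tau> z))))
       + 2 * pi * (2 * C / \<tau> z * (2 * pi * (d * (B * \<tau> z) * (B * \<tau> z)) + 2 * pi * (B * \<tau> z * (d * (B * \<tau> z)))))
       + C * (d * (B * \<tau> z)) + 2 * pi * (2 * C * (d * (B * \<tau> z)))
       = 2 * d * Q * \<tau> z - d * \<tau> z * C * (B + 4 * pi * B + 4)"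
      using t by (simp add: Q_def algebra_simps)
    have "d * \<tau> z * C * (B + 4 * pi * B + 4) \<ge> 0" using d t C B1 by (intro mult_nonneg_nonneg) auto
    with e show "C / \<tau> z * (2 * pi * (d * (B * \<tau> z) * (B * \<tau> z)) + 2 * pi * (B * \<tau> z * (d * (B * \<tau> z))))
       + 2 * pi * (2 * C / \<tau> z * (2 * pi * (d * (B * \<tau> z) * (B * \<tau> z)) + 2 * pi * (B * \<tau> z * (d * (B * \<tau> z)))))
       + C * (d * (B * \<tau> z)) + 2 * pi * (2 * C * (d * (B * \<tau> z))) \<le> 2 * d * Q * \<tau> z" by linarith
  qed
qed

text \<open>The initial value at \<open>\<xi> = 0\<close> is \<open>- \<gamma>\<^sub>0\<close>; it is transported along the characteristic and
  appears at \<open>z + \<xi>\<close>.\<close>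

definition Borel_map :: "(complex \<times> complex \<Rightarrow> complex) \<Rightarrow> complex \<times> complex \<Rightarrow> complex" where
  "Borel_map \<phi> q = - ga0 (fst q + snd q) - char_int (Borel_rhs \<phi>) q"

lemma strip2_sum: "q \<in> strip2 r \<Longrightarrow> fst q + snd q \<in> horizontal_strip r"
  by (auto simp: strip2_def horizontal_strip_def)

lemma weighted_ga0: "weighted (strip2 r) L (\<lambda>q. ga0 (fst q + snd q)) (\<lambda>z. 2 * C * \<tau> z)"
  unfolding weighted_def
proof (intro conjI allI impI)
  show "holomorphic2_on (\<lambda>q. ga0 (fst q + snd q)) (strip2 r)"
    by (rule holomorphic2_on_compose1[OF hol0(3) open_horizontal_strip]) (auto intro!: hol2_intros strip2_sum)
  fix z \<xi> assume z: "(z, \<xi>) \<in> strip2 r"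
  have zH: "z \<in> horizontal_strip r" "z + \<xi> \<in> horizontal_strip r"
    using strip2_horizontal[OF z] strip2_sum[OF z] by auto
  have "cmod (ga0 (z + \<xi>)) \<le> C * (\<tau> z * exp (\<kappa> * cmod \<xi>))"
    using bd0(3)[OF zH(2)] \<tau>_lip[OF zH] C by (elim order_trans) (auto intro!: mult_left_mono)
  also have "\<dots> \<le> C * (\<tau> z * (2 * wt L (cmod \<xi>)))"
    using C \<tau>_pos[OF zH(1)] L2 by (intro mult_left_mono exp_le_wt) auto
  finally show "cmod (ga0 (fst (z, \<xi>) + snd (z, \<xi>))) \<le> 2 * C * \<tau> z * wt L (cmod \<xi>)" by simp
qed

lemma Borel_map_weighted:
  assumes f: "weighted (strip2 r) L \<phi> (\<lambda>z. B * \<tau> z)"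
  shows "weighted (strip2 r) L (Borel_map \<phi>) (\<lambda>z. B * \<tau> z)"
proof -
  have "weighted (strip2 r) L (\<lambda>q. - ga0 (fst q + snd q) - char_int (Borel_rhs \<phi>) q)
      (\<lambda>z. 2 * C * \<tau> z + 4 / (L - \<kappa> - 1) * (Q * \<tau> z))"
    using L2 by (intro weighted_diff weighted_minus weighted_ga0 weighted_char_int weighted_rhs f) auto
  then show ?thesis unfolding Borel_map_def[abs_def]
  proof (rule weighted_mono)
    fix z \<xi> assume "(z, \<xi>) \<in> strip2 r"
    then have t: "\<tau> z > 0" using \<tau>_pos[OF strip2_horizontal] by force
    have "4 / (L - \<kappa> - 1) * Q \<le> 1" using Q0 by (simp add: L_def divide_le_eq)
    then have "4 / (L - \<kappa> - 1) * Q * \<tau> z \<le> 1 * \<tau> z" using t by (intro mult_right_mono) auto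
    then show "2 * C * \<tau> z + 4 / (L - \<kappa> - 1) * (Q * \<tau> z) \<le> B * \<tau> z" by (simp add: B_def algebra_simps)
  qed
qed

lemma Borel_map_contraction:
  assumes f: "weighted (strip2 r) L \<phi> (\<lambda>z. B * \<tau> z)" and g: "weighted (strip2 r) L \<psi> (\<lambda>z. B * \<tau> z)"
    and d: "weighted (strip2 r) L (\<lambda>q. \<phi> q - \<psi> q) (\<lambda>z. d * (B * \<tau> z))" "d \<ge> 0"
  shows "weighted (strip2 r) L (\<lambda>q. Borel_map \<phi> q - Borel_map \<psi> q) (\<lambda>z. d / 2 * (B * \<tau> z))"
proof -
  have h: "holomorphic2_on (Borel_rhs \<phi>) (strip2 r)" "holomorphic2_on (Borel_rhs \<psi>) (strip2 r)"
    using weighted_rhs[OF f] weighted_rhs[OF g] by (auto simp: weighted_def)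
  have "weighted (strip2 r) L (\<lambda>q. - char_int (\<lambda>q. Borel_rhs \<phi> q - Borel_rhs \<psi> q) q) (\<lambda>z. 4 / (L - \<kappa> - 1) * (2 * d * Q * \<tau> z))"
    using L2 by (intro weighted_minus weighted_char_int weighted_rhs_diff[OF f g d]) auto
  then have "weighted (strip2 r) L (\<lambda>q. Borel_map \<phi> q - Borel_map \<psi> q) (\<lambda>z. 4 / (L - \<kappa> - 1) * (2 * d * Q * \<tau> z))"
    by (rule weighted_cong) (simp add: Borel_map_def char_int_diff[OF h, symmetric])
  then show ?thesis
  proof (rule weighted_mono)
    fix z \<xi> assume "(z, \<xi>) \<in> strip2 r"
    then have t: "\<tau> z > 0" using \<tau>_pos[OF strip2_horizontal] by force
    have "16 * Q / (L - \<kappa> - 1) \<le> 1" using Q0 by (simp add: L_def divide_le_eq)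
    then have "16 * Q / (L - \<kappa> - 1) \<le> B" using B1 by linarith
    then have "16 * Q / (L - \<kappa> - 1) * (d / 2 * \<tau> z) \<le> B * (d / 2 * \<tau> z)"
      using t d(2) by (intro mult_right_mono) auto
    then show "4 / (L - \<kappa> - 1) * (2 * d * Q * \<tau> z) \<le> d / 2 * (B * \<tau> z)" by (simp add: algebra_simps)
  qed
qed

lemma Borel_solution_exists:
  obtains \<phi> where "weighted (strip2 r) L \<phi> (\<lambda>z. B * \<tau> z)" "\<And>q. q \<in> strip2 r \<Longrightarrow> Borel_map \<phi> q = \<phi> q"
proof -
  define m where "m = (\<lambda>q::complex \<times> complex. B * \<tau> (fst q) * wt L (cmod (snd q)))"
  have wm: "weighted (strip2 r) L f (\<lambda>z. d * (B * \<tau> z)) \<longleftrightarrow>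
      holomorphic2_on f (strip2 r) \<and> (\<forall>q\<in>strip2 r. cmod (f q) \<le> d * m q)" for f d
    unfolding weighted_def m_def by (auto simp: mult_ac)
  note wm1 = wm[where d = 1, unfolded mult_1]
  show ?thesis
  proof (rule weighted_fixpoint[of "strip2 r" m Borel_map, OF open_strip2])
    have "continuous_on (strip2 r) (\<lambda>q. \<tau> (fst q))"
      by (rule continuous_on_compose2[OF \<tau>_cont]) (use strip2_horizontal in \<open>auto intro!: continuous_intros\<close>)
    moreover have "1 + (cmod (x::complex))\<^sup>2 \<noteq> 0" for x
      using zero_le_power2[of "cmod x"] by linarith
    ultimately show "continuous_on (strip2 r) m"
      unfolding m_def wt_def by (intro continuous_intros) auto
    show "m q \<ge> 0" if "q \<in> strip2 r" for q
      using \<tau>_pos[of "fst q"] strip2_horizontal[of "fst q" "snd q"] that B1 wt_pos[of L "cmod (snd q)"]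
      by (auto simp: m_def intro!: mult_nonneg_nonneg)
    show "holomorphic2_on (Borel_map f) (strip2 r) \<and> (\<forall>q\<in>strip2 r. cmod (Borel_map f q) \<le> m q)"
      if "holomorphic2_on f (strip2 r)" "\<forall>q\<in>strip2 r. cmod (f q) \<le> m q" for f
      using Borel_map_weighted[of f] that unfolding wm1 by blast
    show "\<forall>q\<in>strip2 r. cmod (Borel_map f q - Borel_map g q) \<le> d / 2 * m q"
      if "holomorphic2_on f (strip2 r)" "\<forall>q\<in>strip2 r. cmod (f q) \<le> m q"
        "holomorphic2_on g (strip2 r)" "\<forall>q\<in>strip2 r. cmod (g q) \<le> m q" "d \<ge> 0"
        "\<forall>q\<in>strip2 r. cmod (f q - g q) \<le> d * m q" for f g d
      using Borel_map_contraction[of f g d] that unfolding wm1 wm by (auto intro: holomorphic2_on_diff)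
  next
    fix f assume "holomorphic2_on f (strip2 r)" "\<And>q. q \<in> strip2 r \<Longrightarrow> cmod (f q) \<le> m q"
      "\<And>q. q \<in> strip2 r \<Longrightarrow> Borel_map f q = f q"
    then show ?thesis using that[of f] unfolding wm1 by blast
  qed
qed

end

section \<open>From the Borel plane to the Riccati equation\<close>

definition exp_bounded :: "real \<Rightarrow> (complex \<Rightarrow> complex) \<Rightarrow> bool" where
  "exp_bounded L g \<longleftrightarrow> continuous_on {0..} (\<lambda>t::real. g (complex_of_real t)) \<and>
     (\<exists>K. \<forall>t\<ge>0. cmod (g (of_real t)) \<le> K * exp (L * t))"

lemma exp_boundedI:
  "continuous_on {0..} (\<lambda>t::real. g (complex_of_real t)) \<Longrightarrow>
   (\<And>t. t \<ge> 0 \<Longrightarrow> cmod (g (of_real t)) \<le> K * exp (L * t)) \<Longrightarrow> exp_bounded L g"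
  unfolding exp_bounded_def by blast

lemma exp_bounded_integrable:
  assumes "exp_bounded L g" "Re p > L"
  shows "(\<lambda>t. exp (- (p * complex_of_real t)) * g (of_real t)) integrable_on {0..}"
  using assms Laplace_integral_from(1)[of g _ L p 0] unfolding exp_bounded_def by blast

lemma Laplace_add:
  assumes "exp_bounded L f" "exp_bounded L g" "Re p > L"
  shows "Laplace (\<lambda>\<xi>. f \<xi> + g \<xi>) p = Laplace f p + Laplace g p"
  unfolding Laplace_def distrib_left
  by (intro integral_add exp_bounded_integrable[OF assms(1,3)] exp_bounded_integrable[OF assms(2,3)])

lemma Laplace_cmult: "Laplace (\<lambda>\<xi>. c * f \<xi>) p = c * Laplace f p"
proof -
  have "Laplace (\<lambda>\<xi>. c * f \<xi>) p = integral {0..} (\<lambda>t. c * (exp (- (p * complex_of_real t)) * f (of_real t)))"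
    unfolding Laplace_def by (rule integral_cong) simp
  then show ?thesis by (simp add: Laplace_def)
qed

lemma Laplace_cong: "(\<And>t. t \<ge> 0 \<Longrightarrow> f (complex_of_real t) = g (of_real t)) \<Longrightarrow> Laplace f p = Laplace g p"
  unfolding Laplace_def by (intro integral_cong) simp

lemma exp_bounded_add: "exp_bounded L f \<Longrightarrow> exp_bounded L g \<Longrightarrow> exp_bounded L (\<lambda>\<xi>. f \<xi> + g \<xi>)"
  unfolding exp_bounded_def
proof (elim conjE exE, intro conjI)
  fix K K' assume b: "\<forall>t\<ge>0. cmod (f (of_real t)) \<le> K * exp (L * t)" "\<forall>t\<ge>0. cmod (g (of_real t)) \<le> K' * exp (L * t)"
  show "\<exists>K. \<forall>t\<ge>0. cmod (f (complex_of_real t) + g (complex_of_real t)) \<le> K * exp (L * t)"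
    by (intro exI[of _ "K + K'"] allI impI norm_triangle_le) (use b in \<open>auto intro!: add_mono simp: distrib_right\<close>)
qed (intro continuous_intros)

lemma exp_bounded_cmult: "exp_bounded L f \<Longrightarrow> exp_bounded L (\<lambda>\<xi>. c * f \<xi>)"
  unfolding exp_bounded_def
proof (elim conjE exE, intro conjI)
  fix K assume b: "\<forall>t\<ge>0. cmod (f (of_real t)) \<le> K * exp (L * t)"
  show "\<exists>K. \<forall>t\<ge>0. cmod (c * f (complex_of_real t)) \<le> K * exp (L * t)"
    by (intro exI[of _ "cmod c * K"] allI impI)
       (use b in \<open>auto intro!: mult_left_mono simp: norm_mult mult.assoc\<close>)
qed (intro continuous_intros)

lemma weighted_exp_bounded:
  assumes f: "weighted D L f w" and z: "\<And>t. t \<ge> 0 \<Longrightarrow> (z, complex_of_real t) \<in> D"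
  shows "exp_bounded L (\<lambda>\<xi>. f (z, \<xi>))"
proof (rule exp_boundedI)
  show "continuous_on {0..} (\<lambda>t::real. f (z, of_real t))"
    by (rule continuous_on_compose2[OF holomorphic2_on_imp_continuous_on[of f D]])
       (use f z in \<open>auto simp: weighted_def intro!: continuous_intros\<close>)
  show "cmod (f (z, of_real t)) \<le> w z * exp (L * t)" if "t \<ge> 0" for t
    by (rule weighted_exp_bound[OF f z[OF that] that])
qed

lemma Laplace_conv:
  assumes f: "weighted D L f w" and g: "weighted D L g v" and z: "\<And>t. t \<ge> 0 \<Longrightarrow> (z, complex_of_real t) \<in> D"
    and p: "Re p > L"
  shows "Laplace (\<lambda>\<xi>. conv f g (z, \<xi>)) p = Laplace (\<lambda>\<xi>. f (z, \<xi>)) p * Laplace (\<lambda>\<xi>. g (z, \<xi>)) p"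
proof -
  define \<Gamma> where "\<Gamma> = (\<lambda>q. f (z, complex_of_real (fst q)) * g (z, complex_of_real (snd q)))"
  have c: "continuous_on {0..} (\<lambda>t::real. f (z, of_real t))" "continuous_on {0..} (\<lambda>t::real. g (z, of_real t))"
    using weighted_exp_bounded[OF f z] weighted_exp_bounded[OF g z] by (auto simp: exp_bounded_def)
  have "continuous_on ({0..} \<times> {0..}) \<Gamma>"
    unfolding \<Gamma>_def
    by (intro continuous_intros continuous_on_compose2[OF c(1), of _ fst] continuous_on_compose2[OF c(2), of _ snd]) auto
  moreover have "cmod (\<Gamma> (s, u)) \<le> w z * v z * exp (L * (s + u))" if "0 \<le> s" "0 \<le> u" for s u
  proof -
    have "cmod (\<Gamma> (s, u)) \<le> (w z * exp (L * s)) * (v z * exp (L * u))"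
      unfolding \<Gamma>_def norm_mult
      using weighted_exp_bound[OF f z[OF that(1)] that(1)] weighted_exp_bound[OF g z[OF that(2)] that(2)]
        weighted_nonneg[OF f z[OF that(1)]]
      by (intro mult_mono) auto
    then show ?thesis by (simp add: distrib_left exp_add mult_ac)
  qed
  ultimately have "integral {0..} (\<lambda>t. exp (- (p * of_real t)) *
            integral {0..1} (\<lambda>s. of_real t * \<Gamma> (s * t, (1 - s) * t))) =
         integral {0..} (\<lambda>s. exp (- (p * of_real s)) * integral {0..} (\<lambda>u. exp (- (p * of_real u)) * \<Gamma> (s, u)))"
    by (rule Laplace_triangle[OF _ p])
  also have "\<dots> = integral {0..} (\<lambda>s. exp (- (p * of_real s)) * f (z, of_real s) * Laplace (\<lambda>\<xi>. g (z, \<xi>)) p)"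
    by (intro integral_cong) (simp add: \<Gamma>_def Laplace_def mult_ac flip: integral_mult_right)
  also have "\<dots> = Laplace (\<lambda>\<xi>. f (z, \<xi>)) p * Laplace (\<lambda>\<xi>. g (z, \<xi>)) p"
    by (simp add: Laplace_def)
  finally show ?thesis by (simp add: Laplace_def conv_def \<Gamma>_def)
qed

text \<open>A function of the form \<open>v(z) = - \<integral> e\<^sup>-\<^sup>p\<^sup>s K(z + s) ds\<close> solves \<open>v' = p v + K\<close>. Splitting
  the integral at \<open>x\<close> gives \<open>v(z + x) = e\<^sup>p\<^sup>x (v(z) + \<integral>\<^sub>0\<^sup>x e\<^sup>-\<^sup>p\<^sup>s K(z + s) ds)\<close>. Its one-sided
  derivative at \<open>x = 0\<close> is the complex derivative, as \<open>v\<close> is holomorphic.\<close>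

lemma Laplace_translate_derivative:
  assumes hol: "v holomorphic_on H" and H: "open H" "z \<in> H" "\<And>x::real. z + of_real x \<in> H"
    and Kc: "continuous_on {0..} (\<lambda>t::real. K (z + complex_of_real t))"
    and bd: "\<And>t. 0 \<le> t \<Longrightarrow> cmod (K (z + of_real t)) \<le> M * exp (L * t)" and p: "Re p > L"
    and v: "\<And>x. 0 \<le> x \<Longrightarrow> v (z + of_real x) = - Laplace (\<lambda>w. K (z + of_real x + w)) p"
  shows "(v has_field_derivative (p * v z + K z)) (at z)"
proof -
  define e where "e = (\<lambda>t::real. exp (- (p * complex_of_real t)))"
  define J where "J = (\<lambda>x. integral {0..x} (\<lambda>t. e t * K (z + of_real t)))"
  have ec: "continuous_on S e" for S unfolding e_def by (intro continuous_intros)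
  have lims: "((\<lambda>T. integral {0..T} (\<lambda>t. e t * K (z + of_real x + of_real t))) \<longlongrightarrow> - v (z + of_real x)) at_top"
    if x: "x \<ge> 0" for x
  proof -
    have "continuous_on {0..} (\<lambda>t::real. K (z + of_real x + of_real t))"
    proof -
      have "continuous_on {0..} (\<lambda>t. K (z + complex_of_real (x + t)))"
        by (rule continuous_on_compose2[OF Kc]) (use x in \<open>auto intro!: continuous_intros\<close>)
      then show ?thesis by (simp add: add.assoc)
    qed
    moreover have "cmod (K (z + of_real x + of_real t)) \<le> M * exp (L * x) * exp (L * t)" if "t \<ge> 0" for t
      using bd[of "x + t"] that x by (simp add: add.assoc distrib_left exp_add)
    ultimately show ?thesis
      using Laplace_integral_tendsto[of "\<lambda>w. K (z + of_real x + w)" "M * exp (L * x)" L p] p v[OF x]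
      by (simp add: e_def)
  qed
  have rel: "v (z + of_real x) = exp (p * of_real x) * (v z + J x)" if x: "x \<ge> 0" for x
  proof -
    have split: "integral {0..T + x} (\<lambda>t. e t * K (z + of_real t)) =
        J x + e x * integral {0..T} (\<lambda>t. e t * K (z + of_real x + of_real t))" if T: "T \<ge> 0" for T
    proof -
      have cc: "continuous_on {0..T + x} (\<lambda>t. e t * K (z + of_real t))"
        by (intro continuous_intros ec continuous_on_subset[OF Kc]) auto
      have "integral {0..T + x} (\<lambda>t. e t * K (z + of_real t)) =
          J x + integral {x..T + x} (\<lambda>t. e t * K (z + of_real t))"
        unfolding J_def using x T
        using Henstock_Kurzweil_Integration.integral_combine[of 0 x "T + x", OF _ _ integrable_continuous_interval[OF cc]]
        by simp
      also have "integral {x..T + x} (\<lambda>t. e t * K (z + of_real t)) =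
          integral {0..T} (\<lambda>t. e (x + t) * K (z + of_real (x + t)))"
        using integral_shift_Icc_real[of 0 T "\<lambda>t. e t * K (z + of_real t)" x] by (simp add: o_def)
      also have "\<dots> = integral {0..T} (\<lambda>t. e x * (e t * K (z + of_real x + of_real t)))"
        by (intro integral_cong) (simp add: e_def distrib_left exp_add add.assoc exp_diff exp_minus field_simps)
      finally show ?thesis by simp
    qed
    have "filterlim (\<lambda>T::real. T + x) at_top at_top" by real_asymp
    from filterlim_compose[OF lims[of 0] this]
    have l1: "((\<lambda>T. integral {0..T + x} (\<lambda>t. e t * K (z + of_real t))) \<longlongrightarrow> - v z) at_top" by simp
    have l2: "((\<lambda>T. J x + e x * integral {0..T} (\<lambda>t. e t * K (z + of_real x + of_real t))) \<longlongrightarrow>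
        J x + e x * (- v (z + of_real x))) at_top"
      by (intro tendsto_intros lims x)
    have ev: "\<forall>\<^sub>F T in at_top. integral {0..T + x} (\<lambda>t. e t * K (z + of_real t)) =
        J x + e x * integral {0..T} (\<lambda>t. e t * K (z + of_real x + of_real t))"
      using eventually_ge_at_top[of 0] by eventually_elim (rule split)
    have "- v z = J x + e x * (- v (z + of_real x))"
      by (rule tendsto_unique[OF trivial_limit_at_top_linorder l1 tendsto_cong[OF ev, THEN iffD2, OF l2]])
    then have "e x * v (z + of_real x) = v z + J x" by (simp add: algebra_simps)
    then have "exp (p * of_real x) * (e x * v (z + of_real x)) = exp (p * of_real x) * (v z + J x)" by simp
    then show ?thesis by (simp add: e_def mult.assoc[symmetric] flip: exp_add)
  qed
  have "(J has_vector_derivative e 0 * K (z + of_real 0)) (at 0 within {0..1})"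
    unfolding J_def
    by (rule integral_has_vector_derivative) (auto intro!: continuous_intros ec continuous_on_subset[OF Kc])
  then have dJ: "(J has_vector_derivative K z) (at 0 within {0..1})" by (simp add: e_def)
  have dexp: "((\<lambda>x::real. exp (p * of_real x)) has_vector_derivative p * exp (p * of_real 0)) (at 0 within {0..1})"
    by (rule has_vector_derivative_real_field[of "\<lambda>w. exp (p * w)", THEN has_vector_derivative_eq_rhs])
       (auto intro!: derivative_eq_intros)
  have J0: "J 0 = 0" by (simp add: J_def)
  have "((\<lambda>x. exp (p * of_real x) * (v z + J x)) has_vector_derivative
      (exp (p * of_real 0) * (0 + K z) + p * exp (p * of_real 0) * (v z + J 0))) (at 0 within {0..1})"
    by (rule has_vector_derivative_mult[OF dexp has_vector_derivative_add[OF has_vector_derivative_const dJ]])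
  then have "((\<lambda>x. exp (p * of_real x) * (v z + J x)) has_vector_derivative (p * v z + K z)) (at 0 within {0..1})"
    by (simp add: J0 add.commute)
  then have d1: "((\<lambda>x. v (z + of_real x)) has_vector_derivative (p * v z + K z)) (at 0 within {0..1})"
    by (rule has_vector_derivative_transform[rotated 2]) (auto simp: rel)
  have dv: "(v has_field_derivative deriv v z) (at z)" by (rule holomorphic_derivI[OF hol H(1,2)])
  have "((\<lambda>w. v (z + w)) has_field_derivative deriv v z) (at (of_real 0))"
    using dv DERIV_shift[of v "deriv v z" 0 z] by (simp add: add.commute)
  from has_vector_derivative_real_field[OF this, of "{0..1}"]
  have d2: "((\<lambda>x. v (z + of_real x)) has_vector_derivative deriv v z) (at 0 within {0..1})" by simp
  have "deriv v z = p * v z + K z"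
    using vector_derivative_unique_within_closed_interval[of 0 1 0] d1 d2 by auto
  with dv show ?thesis by simp
qed

context log_Lipschitz_weight
begin

lemma weighted_Laplace_holomorphic:
  assumes f: "weighted (strip2 r) L f (\<lambda>z. M * \<tau> z)" and p: "Re p > L"
  shows "(\<lambda>z. Laplace (\<lambda>\<xi>. f (z, \<xi>)) p) holomorphic_on horizontal_strip r"
proof (rule holomorphic_onI)
  fix z assume z: "z \<in> horizontal_strip r"
  obtain d where d: "d > 0" "ball z d \<subseteq> horizontal_strip r"
    using open_horizontal_strip z open_contains_ball by blast
  have M: "M \<ge> 0"
    using weighted_nonneg[OF f strip2_real[OF z]] \<tau>_pos[OF z] by (simp add: zero_le_mult_iff)
  have "holomorphic2_on (\<lambda>(x, p). Laplace (\<lambda>t. f (x, t)) p) (ball z d \<times> {p. Re p > L})"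
  proof (rule holomorphic2_on_Laplace[where K = "M * (\<tau> z * exp (\<kappa> * d))"])
    show "holomorphic2_on f (strip2 r)" using f by (simp add: weighted_def)
    fix x and t :: real assume x: "x \<in> ball z d" "t \<ge> 0"
    then have xH: "x \<in> horizontal_strip r" using d by auto
    show "(x, complex_of_real t) \<in> strip2 r" by (rule strip2_real[OF xH])
    have "\<tau> x \<le> \<tau> z * exp (\<kappa> * cmod (x - z))" by (rule \<tau>_lip[OF z xH])
    also have "\<dots> \<le> \<tau> z * exp (\<kappa> * d)"
      using x \<kappa> \<tau>_pos[OF z] by (intro mult_left_mono) (auto simp: dist_norm norm_minus_commute intro!: mult_left_mono)
    finally have "M * \<tau> x \<le> M * (\<tau> z * exp (\<kappa> * d))" using M by (rule mult_left_mono)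
    with weighted_exp_bound[OF f strip2_real[OF xH] x(2)]
    show "cmod (f (x, of_real t)) \<le> M * (\<tau> z * exp (\<kappa> * d)) * exp (L * t)"
      by (elim order_trans) (simp add: mult_right_mono)
  qed auto
  from holomorphic2_on_slice1[OF this, of "ball z d" p] p
  have "(\<lambda>z. Laplace (\<lambda>\<xi>. f (z, \<xi>)) p) holomorphic_on ball z d" by simp
  then have "(\<lambda>z. Laplace (\<lambda>\<xi>. f (z, \<xi>)) p) field_differentiable at z"
    using d(1) holomorphic_on_imp_differentiable_at[of _ "ball z d" z] by simp
  then show "(\<lambda>z. Laplace (\<lambda>\<xi>. f (z, \<xi>)) p) field_differentiable at z within horizontal_strip r"
    by (rule field_differentiable_at_within)
qed

end

context Borel_Riccati
begin

text \<open>The Laplace integral of the fixed point equation is \<open>v(z) = - \<integral> e\<^sup>-\<^sup>p\<^sup>s K(z + s) ds\<close>,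
  where \<open>K\<close> is \<open>\<alpha> v\<^sup>2 + \<beta> v + \<gamma>\<close> by the convolution theorem.\<close>

lemma Laplace_solves_Riccati:
  assumes w: "weighted (strip2 r) L \<phi> (\<lambda>z. B * \<tau> z)" and fp: "\<And>q. q \<in> strip2 r \<Longrightarrow> Borel_map \<phi> q = \<phi> q"
    and p: "Re p > L" and z: "z \<in> horizontal_strip r"
  defines "v \<equiv> \<lambda>z. Laplace (\<lambda>\<xi>. \<phi> (z, \<xi>)) p"
  shows "(v has_field_derivative (p * v z + (al0 z + Laplace (\<lambda>\<xi>. a1 (z, \<xi>)) p) * (v z)\<^sup>2
           + (be0 z + Laplace (\<lambda>\<xi>. b1 (z, \<xi>)) p) * v z + (ga0 z + Laplace (\<lambda>\<xi>. g1 (z, \<xi>)) p))) (at z)"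
proof -
  note wr = weighted_rhs[OF w]
  define K where "K = (\<lambda>z. ga0 z + Laplace (\<lambda>\<xi>. Borel_rhs \<phi> (z, \<xi>)) p)"
  have holK: "K holomorphic_on horizontal_strip r"
    unfolding K_def by (intro holomorphic_intros hol0 weighted_Laplace_holomorphic[OF wr p])
  have holv: "v holomorphic_on horizontal_strip r"
    unfolding v_def by (rule weighted_Laplace_holomorphic[OF w p])
  have sr: "(z, complex_of_real t) \<in> strip2 r" if "z \<in> horizontal_strip r" for z t by (rule strip2_real[OF that])
  define M where "M = C + Q / (Re p - L)"
  have M: "M \<ge> 0" using C Q0 p by (simp add: M_def)
  have Kb: "cmod (K z) \<le> M * \<tau> z" if z: "z \<in> horizontal_strip r" for z
  proof -
    have "cmod (Laplace (\<lambda>\<xi>. Borel_rhs \<phi> (z, \<xi>)) p) \<le> Q * \<tau> z / (Re p - L)"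
      using weighted_exp_bounded[OF wr sr[OF z]]
      by (intro Laplace_bound[OF _ _ p]) (auto simp: exp_bounded_def intro: weighted_exp_bound[OF wr sr[OF z]])
    then show ?thesis
      using bd0(3)[OF z] by (simp add: K_def M_def distrib_right) (intro norm_triangle_le add_mono; simp)
  qed
  have Kb': "cmod (K (z + of_real t)) \<le> M * \<tau> z * exp (\<kappa> * t)"
    if z: "z \<in> horizontal_strip r" and t: "t \<ge> 0" for z t
  proof -
    have zt: "z + of_real t \<in> horizontal_strip r" by (rule horizontal_strip_add_real[OF z])
    have "M * \<tau> (z + of_real t) \<le> M * (\<tau> z * exp (\<kappa> * t))"
      using \<tau>_lip[OF z zt] t by (intro mult_left_mono M) simp
    then show ?thesis using Kb[OF zt] by (simp add: mult.assoc)
  qed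
  have Kc: "continuous_on {0..} (\<lambda>t::real. K (z + of_real t))" if "z \<in> horizontal_strip r" for z
    by (rule continuous_on_compose2[OF holomorphic_on_imp_continuous_on[OF holK]])
       (use horizontal_strip_add_real[OF that] in \<open>auto intro!: continuous_intros\<close>)
  have L\<kappa>: "exp (\<kappa> * t) \<le> exp (L * t)" if "t \<ge> 0" for t
    using that L2 by (simp add: mult_right_mono)
  have vK: "v z = - Laplace (\<lambda>w. K (z + w)) p" if z: "z \<in> horizontal_strip r" for z
  proof -
    let ?e = "\<lambda>t::real. exp (- (p * complex_of_real t))"
    have hr: "holomorphic2_on (Borel_rhs \<phi>) (strip2 r)" using wr by (simp add: weighted_def)
    have okg: "exp_bounded L (\<lambda>w. ga0 (z + w))"
    proof (rule exp_boundedI[where K = "C * \<tau> z"])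
      show "continuous_on {0..} (\<lambda>t::real. ga0 (z + of_real t))"
        by (rule continuous_on_compose2[OF holomorphic_on_imp_continuous_on[OF hol0(3)]])
           (use horizontal_strip_add_real[OF z] in \<open>auto intro!: continuous_intros\<close>)
      fix t :: real assume t: "t \<ge> 0"
      have zt: "z + of_real t \<in> horizontal_strip r" by (rule horizontal_strip_add_real[OF z])
      have "C * \<tau> (z + of_real t) \<le> C * (\<tau> z * exp (L * t))"
        using \<tau>_lip[OF z zt] t C \<tau>_pos[OF z] L\<kappa>[OF t]
        by (intro mult_left_mono order_trans[OF \<tau>_lip[OF z zt]]) auto
      then show "cmod (ga0 (z + of_real t)) \<le> C * \<tau> z * exp (L * t)"
        using bd0(3)[OF zt] by (simp add: mult.assoc)
    qed
    have wch: "weighted (strip2 r) L (char_int (Borel_rhs \<phi>)) (\<lambda>z. 4 / (L - \<kappa> - 1) * (Q * \<tau> z))"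
      using L2 by (intro weighted_char_int wr) auto
    have "v z = Laplace (\<lambda>\<xi>. (-1) * ga0 (z + \<xi>) + (-1) * char_int (Borel_rhs \<phi>) (z, \<xi>)) p"
      unfolding v_def by (rule Laplace_cong) (use fp[OF sr[OF z]] in \<open>simp add: Borel_map_def\<close>)
    also have "\<dots> = - Laplace (\<lambda>\<xi>. ga0 (z + \<xi>)) p - Laplace (\<lambda>\<xi>. char_int (Borel_rhs \<phi>) (z, \<xi>)) p"
      by (subst Laplace_add[OF exp_bounded_cmult[OF okg] exp_bounded_cmult[OF weighted_exp_bounded[OF wch sr[OF z]]] p])
         (simp only: Laplace_cmult, simp)
    also have "Laplace (\<lambda>\<xi>. char_int (Borel_rhs \<phi>) (z, \<xi>)) p = Laplace (\<lambda>w. Laplace (\<lambda>\<xi>. Borel_rhs \<phi> (z + w, \<xi>)) p) p"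
    proof -
      define \<Gamma> where "\<Gamma> = (\<lambda>q. Borel_rhs \<phi> (z + complex_of_real (fst q), complex_of_real (snd q)))"
      have "continuous_on ({0..} \<times> {0..}) \<Gamma>"
        unfolding \<Gamma>_def
        by (rule continuous_on_compose2[OF holomorphic2_on_imp_continuous_on[OF hr]])
           (use sr[OF horizontal_strip_add_real[OF z]] in \<open>auto intro!: continuous_intros\<close>)
      moreover have "cmod (\<Gamma> (s, u)) \<le> Q * \<tau> z * exp (L * (s + u))" if "0 \<le> s" "0 \<le> u" for s u
      proof -
        have zt: "z + of_real s \<in> horizontal_strip r" by (rule horizontal_strip_add_real[OF z])
        have "cmod (\<Gamma> (s, u)) \<le> Q * \<tau> (z + of_real s) * exp (L * u)"
          unfolding \<Gamma>_def using weighted_exp_bound[OF wr sr[OF zt] that(2)] by simp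
        also have "\<dots> \<le> Q * (\<tau> z * exp (L * s)) * exp (L * u)"
          using \<tau>_lip[OF z zt] that Q0 \<tau>_pos[OF z] L\<kappa>[OF that(1)]
          by (intro mult_right_mono mult_left_mono order_trans[OF \<tau>_lip[OF z zt]]) auto
        finally show ?thesis by (simp add: distrib_left exp_add mult.assoc)
      qed
      ultimately have "integral {0..} (\<lambda>t. ?e t * integral {0..1} (\<lambda>s. of_real t * \<Gamma> (s * t, (1 - s) * t))) =
         integral {0..} (\<lambda>s. ?e s * integral {0..} (\<lambda>u. ?e u * \<Gamma> (s, u)))"
        by (rule Laplace_triangle[OF _ p])
      then show ?thesis by (simp add: Laplace_def char_int_def \<Gamma>_def)
    qed
    also have "- Laplace (\<lambda>\<xi>. ga0 (z + \<xi>)) p - Laplace (\<lambda>w. Laplace (\<lambda>\<xi>. Borel_rhs \<phi> (z + w, \<xi>)) p) p = - Laplace (\<lambda>w. K (z + w)) p"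
    proof -
      have "exp_bounded L (\<lambda>w. Laplace (\<lambda>\<xi>. Borel_rhs \<phi> (z + w, \<xi>)) p)"
      proof (rule exp_boundedI[where K = "(M + C) * \<tau> z"])
        show "continuous_on {0..} (\<lambda>t::real. Laplace (\<lambda>\<xi>. Borel_rhs \<phi> (z + of_real t, \<xi>)) p)"
          by (rule continuous_on_compose2[OF holomorphic_on_imp_continuous_on[OF weighted_Laplace_holomorphic[OF wr p]]])
             (use horizontal_strip_add_real[OF z] in \<open>auto intro!: continuous_intros\<close>)
        fix t :: real assume t: "t \<ge> 0"
        have zt: "z + of_real t \<in> horizontal_strip r" by (rule horizontal_strip_add_real[OF z])
        have "cmod (Laplace (\<lambda>\<xi>. Borel_rhs \<phi> (z + of_real t, \<xi>)) p) \<le> cmod (K (z + of_real t)) + cmod (ga0 (z + of_real t))"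
          using norm_triangle_ineq4[of "K (z + of_real t)" "ga0 (z + of_real t)"] by (simp add: K_def)
        also have "\<dots> \<le> (M + C) * \<tau> (z + of_real t)"
          using Kb[OF zt] bd0(3)[OF zt] by (simp add: distrib_right)
        also have "\<dots> \<le> (M + C) * (\<tau> z * exp (L * t))"
          using M C t \<tau>_pos[OF z] L\<kappa>[OF t] \<tau>_lip[OF z zt]
          by (intro mult_left_mono order_trans[OF \<tau>_lip[OF z zt]]) auto
        finally show "cmod (Laplace (\<lambda>\<xi>. Borel_rhs \<phi> (z + of_real t, \<xi>)) p) \<le> (M + C) * \<tau> z * exp (L * t)"
          by (simp add: mult.assoc)
      qed
      from Laplace_add[OF okg this p] show ?thesis by (simp add: K_def)
    qed
    finally show ?thesis .
  qed
  have "(v has_field_derivative (p * v z + K z)) (at z)"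
  proof (rule Laplace_translate_derivative[OF holv open_horizontal_strip z horizontal_strip_add_real[OF z] Kc[OF z] _ p])
    show "cmod (K (z + of_real t)) \<le> M * \<tau> z * exp (L * t)" if "0 \<le> t" for t
      using Kb'[OF z that] L\<kappa>[OF that] M \<tau>_pos[OF z] by (elim order_trans) (intro mult_left_mono; simp)
    show "v (z + of_real x) = - Laplace (\<lambda>w. K (z + of_real x + w)) p" if "0 \<le> x" for x
      by (rule vK[OF horizontal_strip_add_real[OF z]])
  qed
  moreover have "Laplace (\<lambda>\<xi>. Borel_rhs \<phi> (z, \<xi>)) p = (al0 z + Laplace (\<lambda>\<xi>. a1 (z, \<xi>)) p) * (v z)\<^sup>2
           + (be0 z + Laplace (\<lambda>\<xi>. b1 (z, \<xi>)) p) * v z + Laplace (\<lambda>\<xi>. g1 (z, \<xi>)) p"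
  proof -
    note cv = weighted_conv[OF starlike2_strip2]
    note ok = weighted_exp_bounded[OF _ sr[OF z]]
    note wc = cv[OF w w] cv[OF weighted_coeffs(1) cv[OF w w]] cv[OF weighted_coeffs(2) w]
    note ok' = ok[OF w] ok[OF wc(1)] ok[OF wc(2)] ok[OF wc(3)] ok[OF weighted_coeffs(3)]
    note lc = Laplace_conv[OF _ _ sr[OF z] p]
    have "Laplace (\<lambda>\<xi>. Borel_rhs \<phi> (z, \<xi>)) p = Laplace (\<lambda>\<xi>. al0 z * conv \<phi> \<phi> (z, \<xi>) + conv a1 (conv \<phi> \<phi>) (z, \<xi>)
        + be0 z * \<phi> (z, \<xi>) + conv b1 \<phi> (z, \<xi>) + g1 (z, \<xi>)) p" by (simp add: Borel_rhs_def)
    also have "\<dots> = al0 z * Laplace (\<lambda>\<xi>. conv \<phi> \<phi> (z, \<xi>)) p + Laplace (\<lambda>\<xi>. conv a1 (conv \<phi> \<phi>) (z, \<xi>)) p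
        + be0 z * Laplace (\<lambda>\<xi>. \<phi> (z, \<xi>)) p + Laplace (\<lambda>\<xi>. conv b1 \<phi> (z, \<xi>)) p + Laplace (\<lambda>\<xi>. g1 (z, \<xi>)) p"
      by (subst Laplace_add[OF _ _ p]; (intro exp_bounded_add exp_bounded_cmult ok')?)+ (simp add: Laplace_cmult)
    also have "\<dots> = (al0 z + Laplace (\<lambda>\<xi>. a1 (z, \<xi>)) p) * (v z)\<^sup>2
           + (be0 z + Laplace (\<lambda>\<xi>. b1 (z, \<xi>)) p) * v z + Laplace (\<lambda>\<xi>. g1 (z, \<xi>)) p"
      by (simp add: lc[OF w w] lc[OF weighted_coeffs(1) cv[OF w w]] lc[OF weighted_coeffs(2) w] v_def
          power2_eq_square algebra_simps)
    finally show ?thesis .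
  qed
  ultimately show ?thesis by (simp add: K_def algebra_simps)
qed

end

text \<open>This is the Borel transform of \<open>y = \<sigma> v + \<rho> v y\<close>, that is of \<open>y = \<sigma> v / (1 - \<rho> v)\<close>.\<close>

lemma linear_convolution_equation:
  assumes D: "starlike2 D" and f: "weighted D L f (\<lambda>_. M)" and M: "M \<ge> 0"
    and s: "\<sigma> holomorphic_on H" "\<rho> holomorphic_on H" "open H"
    and H: "\<And>z \<xi>. (z, \<xi>) \<in> D \<Longrightarrow> z \<in> H"
    and sb: "\<And>z. z \<in> H \<Longrightarrow> cmod (\<sigma> z) \<le> N" "\<And>z. z \<in> H \<Longrightarrow> cmod (\<rho> z) \<le> N" and N: "N \<ge> 0"
  obtains g L' M' where "L' > L" "weighted D L' g (\<lambda>_. M')" "M' \<ge> 0"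
    "\<And>q. q \<in> D \<Longrightarrow> g q = \<sigma> (fst q) * f q + \<rho> (fst q) * conv f g q"
proof -
  define L' where "L' = L + 8 * N * M + 1"
  have L: "L' > L" using M N by (simp add: L'_def add_nonneg_pos)
  define M' where "M' = 2 * N * M"
  have M': "M' \<ge> 0" using M N by (simp add: M'_def)
  define T where "T = (\<lambda>g q. \<sigma> (fst q) * f q + \<rho> (fst q) * conv f g q)"
  have fL: "weighted D L' f (\<lambda>_. M)"
    unfolding weighted_def
  proof (intro conjI allI impI)
    show "holomorphic2_on f D" using f by (simp add: weighted_def)
    fix z \<xi> assume z: "(z, \<xi>) \<in> D"
    have "wt L (cmod \<xi>) \<le> wt L' (cmod \<xi>)"
      unfolding wt_def using L by (intro divide_right_mono) (auto intro: mult_right_mono add_nonneg_nonneg)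
    then show "cmod (f (z, \<xi>)) \<le> M * wt L' (cmod \<xi>)"
      using weightedD[OF f z] M by (meson mult_left_mono order_trans)
  qed
  have half: "N * (4 / (L' - L) * (M * x)) \<le> x / 2" if "x \<ge> 0" for x
  proof -
    have "8 * N * M / (L' - L) \<le> 1" using L mult_nonneg_nonneg[OF N M] by (simp add: L'_def divide_le_eq)
    then have "8 * N * M / (L' - L) * (x / 2) \<le> 1 * (x / 2)" using that by (intro mult_right_mono) auto
    moreover have "N * (4 / (L' - L) * (M * x)) = 8 * N * M / (L' - L) * (x / 2)"
      using L by (simp add: field_simps)
    ultimately show ?thesis by linarith
  qed
  define m where "m = (\<lambda>q::complex \<times> complex. M' * wt L' (cmod (snd q)))"
  have wm: "weighted D L' g (\<lambda>z. d * M') \<longleftrightarrow> holomorphic2_on g D \<and> (\<forall>q\<in>D. cmod (g q) \<le> d * m q)" for g d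
    unfolding weighted_def m_def by (auto simp: mult_ac)
  note wm1 = wm[where d = 1, unfolded mult_1]
  have oD: "open D" using D by (simp add: starlike2_def)
  have convsmall: "weighted D L' (\<lambda>q. \<rho> (fst q) * conv f g q) (\<lambda>_. x / 2)"
    if "weighted D L' g (\<lambda>_. x)" "x \<ge> 0" for g x
    by (rule weighted_mono[OF weighted_mult[OF weighted_conv_small[OF D f that(1) L] s(2,3) H sb(2)]])
       (use half[OF that(2)] in auto)
  show ?thesis
  proof (rule weighted_fixpoint[of D m T, OF oD])
    have "1 + (cmod (x::complex))\<^sup>2 \<noteq> 0" for x
      using zero_le_power2[of "cmod x"] by linarith
    then show "continuous_on D m" unfolding m_def wt_def by (intro continuous_intros) auto
    show "m q \<ge> 0" for q using M' wt_pos[of L' "cmod (snd q)"] by (simp add: m_def)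
    show "holomorphic2_on (T g) D \<and> (\<forall>q\<in>D. cmod (T g q) \<le> m q)"
      if "holomorphic2_on g D" "\<forall>q\<in>D. cmod (g q) \<le> m q" for g
    proof -
      have g: "weighted D L' g (\<lambda>_. M')" using that wm1 by blast
      have "weighted D L' (T g) (\<lambda>_. N * M + M' / 2)"
        unfolding T_def
        by (intro weighted_add weighted_mult[OF fL s(1,3) H sb(1)] convsmall g M')
      then have "weighted D L' (T g) (\<lambda>_. M')" by (rule weighted_mono) (simp add: M'_def)
      then show ?thesis using wm1 by blast
    qed
    show "\<forall>q\<in>D. cmod (T g q - T h q) \<le> d / 2 * m q"
      if gh: "holomorphic2_on g D" "\<forall>q\<in>D. cmod (g q) \<le> m q" "holomorphic2_on h D" "\<forall>q\<in>D. cmod (h q) \<le> m q" "d \<ge> 0"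
        "\<forall>q\<in>D. cmod (g q - h q) \<le> d * m q" for g h d
    proof -
      have fh: "holomorphic2_on f D" using f by (simp add: weighted_def)
      have "weighted D L' (\<lambda>q. g q - h q) (\<lambda>_. d * M')"
        using gh wm by (auto intro: holomorphic2_on_diff)
      then have "weighted D L' (\<lambda>q. \<rho> (fst q) * conv f (\<lambda>q. g q - h q) q) (\<lambda>_. d * M' / 2)"
        using gh M' by (intro convsmall) auto
      then have "weighted D L' (\<lambda>q. T g q - T h q) (\<lambda>_. d * M' / 2)"
      proof (rule weighted_cong)
        fix q assume q: "q \<in> D"
        have "conv (\<lambda>q. f q - f q) g q = 0" by (simp add: conv_def split: prod.split)
        then show "\<rho> (fst q) * conv f (\<lambda>q. g q - h q) q = T g q - T h q"
          using conv_diff[OF D fh fh gh(1,3) q] by (simp add: T_def right_diff_distrib[symmetric])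
      qed
      then show ?thesis using wm[of _ "d / 2"] by simp
    qed
  next
    fix g assume g: "holomorphic2_on g D" "\<And>q. q \<in> D \<Longrightarrow> cmod (g q) \<le> m q" "\<And>q. q \<in> D \<Longrightarrow> T g q = g q"
    have "weighted D L' g (\<lambda>_. M')" using g(1,2) wm1 by blast
    from that[OF L this M'] show ?thesis using g(3) unfolding T_def by metis
  qed
qed

section \<open>The Riccati equation on a strip\<close>

lemma power_div_fact_le_exp: "0 \<le> x \<Longrightarrow> x ^ k / fact k \<le> exp (x::real)"
proof -
  assume x: "0 \<le> x"
  have "(\<Sum>n\<in>{k}. x ^ n /\<^sub>R fact n) \<le> (\<Sum>n. x ^ n /\<^sub>R fact n)"
  proof (rule sum_le_suminf)
    show "summable (\<lambda>n. x ^ n /\<^sub>R fact n)" by (rule summable_exp_generic)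
  qed (use x in auto)
  then show ?thesis by (simp add: exp_def divide_inverse mult.commute)
qed

lemma exp_bounded_monomial: "exp_bounded 1 (\<lambda>\<xi>. \<xi> ^ k / fact k)"
  by (rule exp_boundedI[where K = 1])
     (use power_div_fact_le_exp in \<open>auto intro!: continuous_intros simp: norm_divide norm_power\<close>)

lemma Laplace_monomial:
  assumes p: "Re p > 1"
  shows "Laplace (\<lambda>\<xi>. \<xi> ^ k / fact k) p = (1 / p) ^ Suc k"
proof (induction k)
  case 0
  have "Laplace (\<lambda>_. 0) p = p * Laplace (\<lambda>_. 1) p - 1"
    by (rule Laplace_deriv[where L = 1 and K = 1 and K' = 0]) (use p in auto)
  moreover have "Laplace (\<lambda>_. 0) p = 0" by (simp add: Laplace_def)
  moreover have "p \<noteq> 0" using p by auto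
  ultimately show ?case by (simp add: field_simps)
next
  case (Suc k)
  have "Laplace (\<lambda>\<xi>. \<xi> ^ k / fact k) p = p * Laplace (\<lambda>\<xi>. \<xi> ^ Suc k / fact (Suc k)) p - 0 ^ Suc k / fact (Suc k)"
  proof (rule Laplace_deriv[where L = 1 and K = 1 and K' = 1])
    show "((\<lambda>\<xi>. \<xi> ^ Suc k / fact (Suc k)) has_field_derivative complex_of_real t ^ k / fact k) (at (of_real t))" for t
    proof -
      have "((\<lambda>\<xi>::complex. \<xi> ^ Suc k / fact (Suc k)) has_field_derivative
          (1 + of_nat k) * (1 * of_real t ^ k) / fact (Suc k)) (at (of_real t))"
        by (intro DERIV_cdivide DERIV_power_Suc DERIV_ident)
      moreover have "(1 + of_nat k) * (1 * complex_of_real t ^ k) / fact (Suc k) = of_real t ^ k / fact k"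
        using of_nat_neq_0[of k, where 'a = complex] by (simp add: add.commute)
      ultimately show ?thesis by simp
    qed
  qed (use p exp_bounded_monomial power_div_fact_le_exp in \<open>auto simp: exp_bounded_def norm_divide norm_power norm_mult
        simp flip: power_Suc fact_Suc\<close>)
  then show ?case using p Suc.IH by (auto simp: field_simps)
qed

lemma exp_bounded_sum: "finite I \<Longrightarrow> (\<And>i. i \<in> I \<Longrightarrow> exp_bounded L (f i)) \<Longrightarrow> exp_bounded L (\<lambda>\<xi>. \<Sum>i\<in>I. f i \<xi>)"
proof (induction I rule: finite_induct)
  case empty
  show ?case by (rule exp_boundedI[where K = 0]) auto
qed (auto intro: exp_bounded_add)

lemma Laplace_sum:
  assumes "finite I" "\<And>i. i \<in> I \<Longrightarrow> exp_bounded L (f i)" "Re p > L"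
  shows "Laplace (\<lambda>\<xi>. \<Sum>i\<in>I. f i \<xi>) p = (\<Sum>i\<in>I. Laplace (f i) p)"
  using assms
proof (induction I rule: finite_induct)
  case empty
  show ?case by (simp add: Laplace_def)
next
  case (insert i I)
  have "Laplace (\<lambda>\<xi>. f i \<xi> + (\<Sum>i\<in>I. f i \<xi>)) p = Laplace (f i) p + Laplace (\<lambda>\<xi>. \<Sum>i\<in>I. f i \<xi>) p"
    by (rule Laplace_add[OF _ exp_bounded_sum]) (use insert in auto)
  then show ?case using insert by simp
qed

text \<open>The Borel transform of \<open>X\<^sub>1 h + X\<^sub>2 h\<^sup>2 + \<dots> + X\<^sub>N h\<^sup>N\<close>.\<close>

definition higher_Borel :: "nat \<Rightarrow> (nat \<Rightarrow> complex \<Rightarrow> complex) \<Rightarrow> complex \<times> complex \<Rightarrow> complex" where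
  "higher_Borel N X = (\<lambda>(z, \<xi>). \<Sum>k<N. X (Suc k) z * (\<xi> ^ k / fact k))"

lemma higher_Borel_holomorphic2:
  assumes "\<And>k. X k holomorphic_on horizontal_strip r"
  shows "holomorphic2_on (higher_Borel N X) (strip2 r)"
proof -
  have "holomorphic2_on (\<lambda>q. \<Sum>k<N. X (Suc k) (fst q) * (snd q ^ k * (1 / fact k))) (strip2 r)"
    by (intro hol2_intros holomorphic2_on_compose1[OF assms open_horizontal_strip]) (use strip2_horizontal in auto)
  then show ?thesis by (simp add: higher_Borel_def case_prod_unfold)
qed

lemma higher_Borel_bound:
  assumes "\<And>k. cmod (X k z) \<le> w" "w \<ge> 0"
  shows "cmod (higher_Borel N X (z, \<xi>)) \<le> of_nat N * w * exp (cmod \<xi>)"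
proof -
  have "cmod (X (Suc k) z * (\<xi> ^ k / fact k)) \<le> w * exp (cmod \<xi>)" for k
    unfolding norm_mult using assms power_div_fact_le_exp[of "cmod \<xi>" k]
    by (intro mult_mono) (auto simp: norm_divide norm_power)
  then have "cmod (\<Sum>k<N. X (Suc k) z * (\<xi> ^ k / fact k)) \<le> of_nat (card {..<N}) * (w * exp (cmod \<xi>))"
    by (rule sum_norm_bound)
  then show ?thesis by (simp add: higher_Borel_def mult.assoc)
qed

lemma Laplace_higher_Borel:
  assumes "Re p > 1"
  shows "X 0 z + Laplace (\<lambda>\<xi>. higher_Borel N X (z, \<xi>)) p = (\<Sum>k\<le>N. X k z * (1 / p) ^ k)"
proof -
  have "Laplace (\<lambda>\<xi>. higher_Borel N X (z, \<xi>)) p = (\<Sum>k<N. Laplace (\<lambda>\<xi>. X (Suc k) z * (\<xi> ^ k / fact k)) p)"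
    unfolding higher_Borel_def prod.case using assms
    by (intro Laplace_sum[where L = 1] exp_bounded_cmult exp_bounded_monomial) auto
  also have "\<dots> = (\<Sum>k<N. X (Suc k) z * (1 / p) ^ Suc k)"
    by (intro sum.cong refl) (simp only: Laplace_cmult Laplace_monomial[OF assms])
  finally show ?thesis by (simp add: sum.atMost_shift)
qed

text \<open>Gronwall's inequality. The Euclidean norm is chosen because its square is
  differentiable and the inequality then has no additional constant factor; such a factor
  would spoil the Lipschitz property of the logarithm.\<close>

lemma norm_growth_bound:
  fixes y1 y2 :: "real \<Rightarrow> complex"
  assumes d: "\<And>t. 0 \<le> t \<Longrightarrow> t \<le> 1 \<Longrightarrow> (y1 has_vector_derivative d1 t) (at t)"
      "\<And>t. 0 \<le> t \<Longrightarrow> t \<le> 1 \<Longrightarrow> (y2 has_vector_derivative d2 t) (at t)"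
    and b: "\<And>t. 0 \<le> t \<Longrightarrow> t \<le> 1 \<Longrightarrow> cmod (d1 t) \<le> k * (cmod (y1 t) + cmod (y2 t))"
      "\<And>t. 0 \<le> t \<Longrightarrow> t \<le> 1 \<Longrightarrow> cmod (d2 t) \<le> k * (cmod (y1 t) + cmod (y2 t))"
    and k: "k \<ge> 0"
  shows "(cmod (y1 1))\<^sup>2 + (cmod (y2 1))\<^sup>2 \<le> ((cmod (y1 0))\<^sup>2 + (cmod (y2 0))\<^sup>2) * exp (4 * k)"
proof -
  define \<rho> where "\<rho> = (\<lambda>t. y1 t \<bullet> y1 t + y2 t \<bullet> y2 t)"
  have n: "\<rho> t = (cmod (y1 t))\<^sup>2 + (cmod (y2 t))\<^sup>2" for t by (simp add: \<rho>_def dot_square_norm)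
  have d\<rho>: "(\<rho> has_real_derivative (2 * (y1 t \<bullet> d1 t) + 2 * (y2 t \<bullet> d2 t))) (at t)" if "0 \<le> t" "t \<le> 1" for t
    unfolding \<rho>_def has_real_derivative_iff_has_vector_derivative
    by (rule has_vector_derivative_eq_rhs[OF has_vector_derivative_add[OF
          bounded_bilinear.has_vector_derivative[OF bounded_bilinear_inner d(1)[OF that] d(1)[OF that]]
          bounded_bilinear.has_vector_derivative[OF bounded_bilinear_inner d(2)[OF that] d(2)[OF that]]]])
       (simp add: inner_commute)
  have "\<rho> 1 * exp (- 4 * k * 1) \<le> \<rho> 0 * exp (- 4 * k * 0)"
  proof (rule DERIV_nonpos_imp_nonincreasing[of 0 1 "\<lambda>t. \<rho> t * exp (- 4 * k * t)"])
    fix t :: real assume t: "0 \<le> t" "t \<le> 1"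
    have "((\<lambda>t. \<rho> t * exp (- 4 * k * t)) has_real_derivative
        ((2 * (y1 t \<bullet> d1 t) + 2 * (y2 t \<bullet> d2 t)) - 4 * k * \<rho> t) * exp (- 4 * k * t)) (at t)"
      by (rule derivative_eq_intros d\<rho>[OF t] refl)+ (simp add: algebra_simps)
    moreover have "(2 * (y1 t \<bullet> d1 t) + 2 * (y2 t \<bullet> d2 t)) - 4 * k * \<rho> t \<le> 0"
    proof -
      have "y1 t \<bullet> d1 t \<le> cmod (y1 t) * (k * (cmod (y1 t) + cmod (y2 t)))"
        using b(1)[OF t] by (intro order_trans[OF norm_cauchy_schwarz] mult_left_mono) auto
      moreover have "y2 t \<bullet> d2 t \<le> cmod (y2 t) * (k * (cmod (y1 t) + cmod (y2 t)))"
        using b(2)[OF t] by (intro order_trans[OF norm_cauchy_schwarz] mult_left_mono) auto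
      moreover have "k * (cmod (y1 t) - cmod (y2 t))\<^sup>2 \<ge> 0" using k by simp
      ultimately show ?thesis unfolding n by (simp add: power2_eq_square algebra_simps)
    qed
    ultimately show "\<exists>y. ((\<lambda>t. \<rho> t * exp (- 4 * k * t)) has_real_derivative y) (at t) \<and> y \<le> 0"
      by (intro exI conjI) (auto simp: mult_nonpos_nonneg)
  qed simp
  then have "\<rho> 1 \<le> \<rho> 0 * exp (4 * k)" by (simp add: exp_minus field_simps)
  then show ?thesis by (simp add: n)
qed

lemma convex_horizontal_strip: "convex (horizontal_strip r)"
proof -
  have "horizontal_strip r = {z. Im z > - r} \<inter> {z. Im z < r}" by (auto simp: horizontal_strip_def)
  then show ?thesis by (simp add: convex_Int convex_halfspace_Im_gt convex_halfspace_Im_lt)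
qed

text \<open>The equation in the coordinate \<open>z\<close>, normalised so that the square root of the leading
  discriminant is 1.\<close>

locale strip_Riccati =
  fixes r M :: real and N :: nat and A B C :: "nat \<Rightarrow> complex \<Rightarrow> complex"
  assumes r: "r > 0" and M: "M \<ge> 1"
    and hol: "\<And>k. A k holomorphic_on horizontal_strip r" "\<And>k. B k holomorphic_on horizontal_strip r"
      "\<And>k. C k holomorphic_on horizontal_strip r"
    and bd: "\<And>k z. z \<in> horizontal_strip r \<Longrightarrow> cmod (A k z) \<le> M" "\<And>k z. z \<in> horizontal_strip r \<Longrightarrow> cmod (B k z) \<le> M"
      "\<And>k z. z \<in> horizontal_strip r \<Longrightarrow> cmod (C k z) \<le> M"
    and bd': "\<And>z. z \<in> horizontal_strip r \<Longrightarrow> cmod (deriv (A 0) z) \<le> M"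
      "\<And>z. z \<in> horizontal_strip r \<Longrightarrow> cmod (deriv (B 0) z) \<le> M" "\<And>z. z \<in> horizontal_strip r \<Longrightarrow> cmod (deriv (C 0) z) \<le> M"
    and disc: "\<And>z. z \<in> horizontal_strip r \<Longrightarrow> (B 0 z)\<^sup>2 - 4 * A 0 z * C 0 z = 1"
    and A0: "\<And>z. z \<in> horizontal_strip r \<Longrightarrow> A 0 z \<noteq> 0"
    and fin: "\<And>k z. k > N \<Longrightarrow> z \<in> horizontal_strip r \<Longrightarrow> A k z = 0 \<and> B k z = 0 \<and> C k z = 0"
begin

abbreviation "H \<equiv> horizontal_strip r"

text \<open>With the other leading root \<open>f1 = f0 - 1 / A\<^sub>0\<close>, \<open>g0\<close> is \<open>A\<^sub>0 f1\<close>. The forms \<open>q2\<close> and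
  \<open>q1\<close> are the quadratic polynomial with coefficients \<open>X\<close>, \<open>Y\<close>, \<open>Z\<close>, evaluated at \<open>f0\<close>, and
  at \<open>f1\<close> after multiplication by \<open>A\<^sub>0\<^sup>2\<close>.\<close>

definition f0 :: "complex \<Rightarrow> complex" where "f0 z = (1 - B 0 z) / (2 * A 0 z)"
definition g0 :: "complex \<Rightarrow> complex" where "g0 z = A 0 z * f0 z - 1"
definition q1 :: "complex \<Rightarrow> complex \<Rightarrow> complex \<Rightarrow> complex \<Rightarrow> complex" where
  "q1 z X Y Z = X * (g0 z)\<^sup>2 + Y * A 0 z * g0 z + Z * (A 0 z)\<^sup>2"
definition q2 :: "complex \<Rightarrow> complex \<Rightarrow> complex \<Rightarrow> complex \<Rightarrow> complex" where
  "q2 z X Y Z = X * (f0 z)\<^sup>2 + Y * f0 z + Z"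

lemmas oH = open_horizontal_strip[of r]

lemma f0_eqs:
  assumes z: "z \<in> H"
  shows "2 * A 0 z * f0 z + B 0 z = 1" "A 0 z * (f0 z)\<^sup>2 + B 0 z * f0 z + C 0 z = 0" "g0 z * f0 z = C 0 z"
proof -
  have a: "A 0 z \<noteq> 0" by (rule A0[OF z])
  show 1: "2 * A 0 z * f0 z + B 0 z = 1" using a by (simp add: f0_def)
  have "4 * A 0 z * (A 0 z * (f0 z)\<^sup>2 + B 0 z * f0 z + C 0 z) = (2 * A 0 z * f0 z + B 0 z)\<^sup>2 - ((B 0 z)\<^sup>2 - 4 * A 0 z * C 0 z)"
    by (simp add: power2_eq_square algebra_simps)
  then have "4 * A 0 z * (A 0 z * (f0 z)\<^sup>2 + B 0 z * f0 z + C 0 z) = 0" unfolding 1 disc[OF z] by simp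
  then show 2: "A 0 z * (f0 z)\<^sup>2 + B 0 z * f0 z + C 0 z = 0" using a by simp
  have "B 0 z = 1 - 2 * A 0 z * f0 z" using 1 by (simp add: algebra_simps)
  then show "g0 z * f0 z = C 0 z" using 2 by (simp add: g0_def power2_eq_square) algebra
qed

lemma f0_holomorphic: "f0 holomorphic_on H"
  unfolding f0_def[abs_def] by (intro holomorphic_intros hol) (use A0 in auto)

lemma g0_holomorphic: "g0 holomorphic_on H"
  unfolding g0_def[abs_def] by (intro holomorphic_intros hol f0_holomorphic)

text \<open>Both identities come from differentiating the relations between \<open>f0\<close> and the
  coefficients; the second one is the analogue of the first for the other leading root.\<close>

lemma f0_deriv:
  assumes z: "z \<in> H"
  shows "deriv f0 z = - q2 z (deriv (A 0) z) (deriv (B 0) z) (deriv (C 0) z)"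
    and "(A 0 z)\<^sup>2 * deriv f0 z + deriv (A 0) z = q1 z (deriv (A 0) z) (deriv (B 0) z) (deriv (C 0) z)"
proof -
  note dA = holomorphic_derivI[OF hol(1)[of 0] oH z] and dB = holomorphic_derivI[OF hol(2)[of 0] oH z]
    and dC = holomorphic_derivI[OF hol(3)[of 0] oH z] and df = holomorphic_derivI[OF f0_holomorphic oH z]
  let ?A' = "deriv (A 0) z" and ?B' = "deriv (B 0) z" and ?C' = "deriv (C 0) z" and ?f' = "deriv f0 z"
  have ev: "\<forall>\<^sub>F w in nhds z. w \<in> H" by (rule eventually_nhds_in_open[OF oH z])
  have "((\<lambda>w. A 0 w * (f0 w)\<^sup>2 + B 0 w * f0 w + C 0 w) has_field_derivative
      (?A' * (f0 z)\<^sup>2 + A 0 z * (2 * f0 z * ?f') + (?B' * f0 z + B 0 z * ?f') + ?C')) (at z)"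
    by (auto intro!: derivative_eq_intros dA dB dC df simp: algebra_simps)
  moreover have "((\<lambda>w. A 0 w * (f0 w)\<^sup>2 + B 0 w * f0 w + C 0 w) has_field_derivative 0) (at z)"
    by (rule DERIV_cong_ev[THEN iffD1, OF refl _ refl DERIV_const[of 0]]) (use ev f0_eqs(2) in \<open>auto elim: eventually_mono\<close>)
  ultimately have e1: "?A' * (f0 z)\<^sup>2 + A 0 z * (2 * f0 z * ?f') + (?B' * f0 z + B 0 z * ?f') + ?C' = 0"
    by (rule DERIV_unique)
  have "((\<lambda>w. 2 * A 0 w * f0 w + B 0 w) has_field_derivative (2 * (?A' * f0 z + A 0 z * ?f') + ?B')) (at z)"
    by (auto intro!: derivative_eq_intros dA dB dC df simp: algebra_simps)
  moreover have "((\<lambda>w. 2 * A 0 w * f0 w + B 0 w) has_field_derivative 0) (at z)"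
    by (rule DERIV_cong_ev[THEN iffD1, OF refl _ refl DERIV_const[of 1]]) (use ev f0_eqs(1) in \<open>auto elim: eventually_mono\<close>)
  ultimately have e2: "2 * (?A' * f0 z + A 0 z * ?f') + ?B' = 0" by (rule DERIV_unique)
  have e3: "B 0 z = 1 - 2 * A 0 z * f0 z" using f0_eqs(1)[OF z] by (simp add: algebra_simps)
  show *: "?f' = - q2 z ?A' ?B' ?C'"
    using e1 unfolding q2_def e3 by (simp add: algebra_simps power2_eq_square) algebra
  have B': "?B' = - 2 * (?A' * f0 z + A 0 z * ?f')" using e2 by algebra
  have C': "?C' = - (?f' + ?A' * (f0 z)\<^sup>2 + ?B' * f0 z)" using * unfolding q2_def by algebra
  show "(A 0 z)\<^sup>2 * ?f' + ?A' = q1 z ?A' ?B' ?C'"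
    unfolding q1_def g0_def C' B' by (simp add: algebra_simps power2_eq_square)
qed

lemma small_bounds:
  assumes z: "z \<in> H"
  shows "cmod (A 0 z * f0 z) \<le> M" "cmod (g0 z) \<le> 2 * M"
proof -
  have "A 0 z * f0 z = (1 - B 0 z) / 2" using A0[OF z] by (simp add: f0_def)
  then have "cmod (A 0 z * f0 z) \<le> (1 + M) / 2"
    unfolding \<open>A 0 z * f0 z = (1 - B 0 z) / 2\<close> norm_divide
    using norm_triangle_ineq4[of 1 "B 0 z"] bd(2)[OF z, of 0] by simp
  then show 1: "cmod (A 0 z * f0 z) \<le> M" using M by simp
  show "cmod (g0 z) \<le> 2 * M"
    using norm_triangle_ineq4[of "A 0 z * f0 z" 1] 1 M by (simp add: g0_def)
qed

text \<open>Although \<open>f0\<close> may be unbounded, \<open>A\<^sub>0\<close>, \<open>g0\<close>, \<open>A\<^sub>0 f0\<close> and \<open>g0 f0 = C\<^sub>0\<close> are all bounded,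
  so \<open>|g0|\<^sup>2 + |A\<^sub>0|\<^sup>2\<close> is at most a constant times \<open>1 / (1 + |f0|\<^sup>2)\<close>.\<close>

lemma q1_bound:
  assumes z: "z \<in> H" and b: "cmod X \<le> M" "cmod Y \<le> M" "cmod Z \<le> M"
  shows "cmod (q1 z X Y Z) * (1 + (cmod (f0 z))\<^sup>2) \<le> 24 * M ^ 3"
proof -
  define g a f where "g = cmod (g0 z)" and "a = cmod (A 0 z)" and "f = cmod (f0 z)"
  have pos: "g \<ge> 0" "a \<ge> 0" "f \<ge> 0" by (auto simp: g_def a_def f_def)
  have gf: "g * f \<le> M" using f0_eqs(3)[OF z] bd(3)[OF z, of 0] by (metis norm_mult g_def f_def)
  have af: "a * f \<le> M" using small_bounds(1)[OF z] by (simp add: norm_mult a_def f_def)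
  have gM: "g \<le> 2 * M" "a \<le> M" using small_bounds(2)[OF z] bd(1)[OF z, of 0] by (auto simp: g_def a_def)
  have M2: "M \<ge> 0" using M by simp
  have s: "(g\<^sup>2 + a\<^sup>2) * (1 + f\<^sup>2) \<le> 8 * M\<^sup>2"
  proof -
    have "(g\<^sup>2 + a\<^sup>2) * (1 + f\<^sup>2) = g\<^sup>2 + a\<^sup>2 + (g * f)\<^sup>2 + (a * f)\<^sup>2" by (simp add: power2_eq_square algebra_simps)
    also have "\<dots> \<le> (2 * M)\<^sup>2 + M\<^sup>2 + M\<^sup>2 + M\<^sup>2"
      using pos gf af gM by (intro add_mono power_mono) auto
    also have "\<dots> \<le> 8 * M\<^sup>2" by (simp add: power_mult_distrib)
    finally show ?thesis .
  qed
  have ag: "a * g \<le> g\<^sup>2 + a\<^sup>2"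
  proof -
    have "0 \<le> (a - g)\<^sup>2" by simp
    then have "2 * (a * g) \<le> g\<^sup>2 + a\<^sup>2" by (simp add: power2_eq_square algebra_simps)
    moreover have "0 \<le> a * g" using pos by simp
    ultimately show ?thesis by linarith
  qed
  have "cmod (q1 z X Y Z) \<le> cmod X * g\<^sup>2 + cmod Y * (a * g) + cmod Z * a\<^sup>2"
    unfolding q1_def g_def a_def by (intro norm_triangle_le add_mono) (auto simp: norm_mult norm_power)
  also have "\<dots> \<le> M * (g\<^sup>2 + a\<^sup>2) + M * (g\<^sup>2 + a\<^sup>2) + M * (g\<^sup>2 + a\<^sup>2)"
    using b M2 pos ag by (intro add_mono mult_mono) auto
  finally have "cmod (q1 z X Y Z) * (1 + f\<^sup>2) \<le> 3 * M * (g\<^sup>2 + a\<^sup>2) * (1 + f\<^sup>2)"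
    by (intro mult_right_mono) auto
  also have "\<dots> = 3 * M * ((g\<^sup>2 + a\<^sup>2) * (1 + f\<^sup>2))" by simp
  also have "\<dots> \<le> 3 * M * (8 * M\<^sup>2)" using s M2 by (intro mult_left_mono) auto
  finally show ?thesis by (simp add: f_def power2_eq_square power3_eq_cube)
qed

lemma q2_bound:
  assumes b: "cmod X \<le> M" "cmod Y \<le> M" "cmod Z \<le> M"
  shows "cmod (q2 z X Y Z) \<le> 3 * M * (1 + (cmod (f0 z))\<^sup>2)"
proof -
  let ?f = "cmod (f0 z)"
  have M2: "M \<ge> 0" using M by simp
  have f: "?f \<le> 1 + ?f\<^sup>2"
    using zero_le_power2[of "?f - 1/2"] by (simp add: power2_eq_square algebra_simps)
  have "cmod (q2 z X Y Z) \<le> cmod X * ?f\<^sup>2 + cmod Y * ?f + cmod Z"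
    unfolding q2_def by (intro norm_triangle_le add_mono) (auto simp: norm_mult norm_power)
  also have "\<dots> \<le> M * (1 + ?f\<^sup>2) + M * (1 + ?f\<^sup>2) + M * (1 + ?f\<^sup>2)"
  proof (intro add_mono)
    show "cmod X * ?f\<^sup>2 \<le> M * (1 + ?f\<^sup>2)" "cmod Y * ?f \<le> M * (1 + ?f\<^sup>2)"
      using b M2 f by (auto intro!: mult_mono)
    show "cmod Z \<le> M * (1 + ?f\<^sup>2)" using b(3) M2 by (simp add: distrib_left add_increasing2)
  qed
  finally show ?thesis by simp
qed

lemma E_exists:
  obtains E where "\<And>z. z \<in> H \<Longrightarrow> (E has_field_derivative (- A 0 z * deriv f0 z * E z)) (at z)" "\<And>z. E z \<noteq> 0"
proof -
  have "(\<lambda>z. - A 0 z * deriv f0 z) holomorphic_on H"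
    by (intro holomorphic_intros hol holomorphic_deriv f0_holomorphic oH)
  then obtain F where F: "\<And>z. z \<in> H \<Longrightarrow> (F has_field_derivative (- A 0 z * deriv f0 z)) (at z within H)"
    by (rule holomorphic_convex_primitive'[OF convex_horizontal_strip oH]) blast
  show ?thesis
  proof (rule that[of "\<lambda>z. exp (F z)"])
    fix z assume z: "z \<in> H"
    have "(F has_field_derivative (- A 0 z * deriv f0 z)) (at z)" using F[OF z] at_within_open[OF z oH] by simp
    then show "((\<lambda>z. exp (F z)) has_field_derivative (- A 0 z * deriv f0 z * exp (F z))) (at z)"
      by (auto intro!: derivative_eq_intros)
  qed simp
qed

end

section \<open>Normal form relative to the leading roots\<close>

text \<open>The vector \<open>(E f0, E)\<close> spans the line of the root \<open>f0\<close>, and the choice of \<open>E\<close> makes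
  its derivative point along the line of the other root.\<close>

locale strip_frame = strip_Riccati +
  fixes E :: "complex \<Rightarrow> complex"
  assumes dE: "\<And>z. z \<in> H \<Longrightarrow> (E has_field_derivative (- A 0 z * deriv f0 z * E z)) (at z)"
    and E0: "\<And>z. E z \<noteq> 0"
begin

definition \<tau> :: "complex \<Rightarrow> real" where
  "\<tau> z = (cmod (E z))\<^sup>2 + (cmod (E z * f0 z))\<^sup>2"

lemma \<tau>_eq: "\<tau> z = (cmod (E z))\<^sup>2 * (1 + (cmod (f0 z))\<^sup>2)"
  by (simp add: \<tau>_def norm_mult power_mult_distrib distrib_left)

lemma \<tau>_gt0: "\<tau> z > 0"
  using E0[of z] by (simp add: \<tau>_def add_pos_nonneg)

lemma E_holomorphic: "E holomorphic_on H"
  using dE by (auto simp: holomorphic_on_def field_differentiable_def intro: has_field_derivative_at_within)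

lemma dEf:
  assumes z: "z \<in> H"
  shows "((\<lambda>z. E z * f0 z) has_field_derivative (- g0 z * E z * deriv f0 z)) (at z)"
  using DERIV_mult[OF dE[OF z] holomorphic_derivI[OF f0_holomorphic oH z]]
  by (rule DERIV_cong) (simp add: g0_def algebra_simps)

text \<open>The identities \<open>A\<^sub>0 f0 = O(1)\<close> and \<open>g0 f0 = C\<^sub>0\<close> remove the dangerous square of \<open>f0\<close>
  from \<open>f0'\<close>.\<close>

lemma frame_derivative_bounds:
  assumes z: "z \<in> H"
  shows "cmod (- A 0 z * deriv f0 z * E z) \<le> 3 * M\<^sup>2 * (cmod (E z) + cmod (E z * f0 z))"
    and "cmod (- g0 z * E z * deriv f0 z) \<le> 3 * M\<^sup>2 * (cmod (E z) + cmod (E z * f0 z))"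
proof -
  have M0: "M \<ge> 0" using M by simp
  have MM0: "M\<^sup>2 \<ge> 0" by simp
  let ?A' = "deriv (A 0) z" and ?B' = "deriv (B 0) z" and ?C' = "deriv (C 0) z"
  have lin: "cmod (x * E z + y * (E z * f0 z)) \<le> 3 * M\<^sup>2 * (cmod (E z) + cmod (E z * f0 z))"
    if "cmod x \<le> 3 * M\<^sup>2" "cmod y \<le> 3 * M\<^sup>2" for x y
  proof -
    have "cmod (x * E z + y * (E z * f0 z)) \<le> cmod x * cmod (E z) + cmod y * cmod (E z * f0 z)"
      using norm_triangle_ineq[of "x * E z" "y * (E z * f0 z)"] by (simp only: norm_mult)
    also have "\<dots> \<le> 3 * M\<^sup>2 * cmod (E z) + 3 * M\<^sup>2 * cmod (E z * f0 z)"
      by (intro add_mono mult_right_mono that) auto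
    finally show ?thesis by (simp only: distrib_left)
  qed
  have MM: "cmod (x * y) \<le> c * M\<^sup>2" if "cmod x \<le> M" "cmod y \<le> c * M" for x y c
    using mult_mono[OF that M0 norm_ge_zero] by (simp add: norm_mult power2_eq_square mult_ac)
  note sb = small_bounds[OF z] bd(1)[OF z, of 0] bd(3)[OF z, of 0]
  have e1: "- A 0 z * deriv f0 z * E z = (?B' * (A 0 z * f0 z) + ?C' * A 0 z) * E z + (?A' * (A 0 z * f0 z)) * (E z * f0 z)"
    by (simp add: f0_deriv(1)[OF z] q2_def power2_eq_square algebra_simps)
  show "cmod (- A 0 z * deriv f0 z * E z) \<le> 3 * M\<^sup>2 * (cmod (E z) + cmod (E z * f0 z))"
    unfolding e1
  proof (rule lin)
    have "cmod (?B' * (A 0 z * f0 z)) \<le> 1 * M\<^sup>2" "cmod (?C' * A 0 z) \<le> 1 * M\<^sup>2" "cmod (?A' * (A 0 z * f0 z)) \<le> 1 * M\<^sup>2"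
      using sb by (intro MM bd'[OF z]; simp)+
    then show "cmod (?B' * (A 0 z * f0 z) + ?C' * A 0 z) \<le> 3 * M\<^sup>2" "cmod (?A' * (A 0 z * f0 z)) \<le> 3 * M\<^sup>2"
      using norm_triangle_ineq[of "?B' * (A 0 z * f0 z)" "?C' * A 0 z"] MM0 by linarith+
  qed
  have "- g0 z * E z * deriv f0 z = E z * (?A' * (g0 z * f0 z) * f0 z + ?B' * (g0 z * f0 z) + ?C' * g0 z)"
    by (simp add: f0_deriv(1)[OF z] q2_def power2_eq_square algebra_simps)
  also have "\<dots> = (?B' * C 0 z + ?C' * g0 z) * E z + (?A' * C 0 z) * (E z * f0 z)"
    unfolding f0_eqs(3)[OF z] by (simp add: algebra_simps)
  finally have e2: "- g0 z * E z * deriv f0 z = (?B' * C 0 z + ?C' * g0 z) * E z + (?A' * C 0 z) * (E z * f0 z)" .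
  show "cmod (- g0 z * E z * deriv f0 z) \<le> 3 * M\<^sup>2 * (cmod (E z) + cmod (E z * f0 z))"
    unfolding e2
  proof (rule lin)
    have "cmod (?B' * C 0 z) \<le> 1 * M\<^sup>2" "cmod (?C' * g0 z) \<le> 2 * M\<^sup>2" "cmod (?A' * C 0 z) \<le> 1 * M\<^sup>2"
      using sb by (intro MM bd'[OF z]; simp)+
    then show "cmod (?B' * C 0 z + ?C' * g0 z) \<le> 3 * M\<^sup>2" "cmod (?A' * C 0 z) \<le> 3 * M\<^sup>2"
      using norm_triangle_ineq[of "?B' * C 0 z" "?C' * g0 z"] MM0 by linarith+
  qed
qed

lemma \<tau>_log_Lipschitz:
  assumes z: "z \<in> H" and w: "w \<in> H"
  shows "\<tau> w \<le> \<tau> z * exp (12 * M\<^sup>2 * cmod (w - z))"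
proof -
  let ?s = "\<lambda>t::complex. z + t * (w - z)"
  have inH: "?s (of_real t) \<in> H" if "0 \<le> t" "t \<le> 1" for t
  proof -
    have "(1 - t) *\<^sub>R z + t *\<^sub>R w \<in> H"
      using convex_horizontal_strip[of r] z w that unfolding convex_alt by blast
    then show ?thesis by (simp add: scaleR_conv_of_real algebra_simps)
  qed
  have chain: "((\<lambda>t. f (?s (of_real t))) has_vector_derivative (w - z) * f' (?s (of_real t))) (at t)"
    if "0 \<le> t" "t \<le> 1" and f: "\<And>z. z \<in> H \<Longrightarrow> (f has_field_derivative f' z) (at z)" for f f' and t :: real
  proof -
    have "((\<lambda>t. f (?s t)) has_field_derivative f' (?s (of_real t)) * (w - z)) (at (of_real t))"
      by (rule DERIV_chain2[where f = f and g = ?s, OF f[OF inH[OF that(1,2)]]]) (auto intro!: derivative_eq_intros)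
    from has_vector_derivative_real_field[OF this] show ?thesis by (simp add: mult.commute)
  qed
  have b: "cmod ((w - z) * x) \<le> 3 * M\<^sup>2 * cmod (w - z) * y" if "cmod x \<le> 3 * M\<^sup>2 * y" for x y
    using mult_left_mono[OF that norm_ge_zero[of "w - z"]] by (simp add: norm_mult mult_ac)
  have "(cmod (E (?s (of_real 1))))\<^sup>2 + (cmod (E (?s (of_real 1)) * f0 (?s (of_real 1))))\<^sup>2 \<le>
     ((cmod (E (?s (of_real 0))))\<^sup>2 + (cmod (E (?s (of_real 0)) * f0 (?s (of_real 0))))\<^sup>2) * exp (4 * (3 * M\<^sup>2 * cmod (w - z)))"
    by (rule norm_growth_bound[where ?y1.0 = "\<lambda>t. E (?s (of_real t))" and ?y2.0 = "\<lambda>t. E (?s (of_real t)) * f0 (?s (of_real t))",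
          OF chain[where f = E] chain[where f = "\<lambda>z. E z * f0 z"]])
       (auto intro!: b frame_derivative_bounds inH dE dEf)
  then show ?thesis by (simp add: \<tau>_def mult.assoc)
qed

text \<open>The coefficients of the equation for \<open>v\<close>. The derivatives of \<open>A\<^sub>0\<close>, \<open>B\<^sub>0\<close>, \<open>C\<^sub>0\<close>, which
  stem from the \<open>z\<close>-dependence of the substitution, enter at order 0 only.\<close>

definition al :: "nat \<Rightarrow> complex \<Rightarrow> complex" where
  "al k z = (q1 z (A (Suc k) z) (B (Suc k) z) (C (Suc k) z) -
     (if k = 0 then q1 z (deriv (A 0) z) (deriv (B 0) z) (deriv (C 0) z) else 0)) * (1 / (E z)\<^sup>2)"
definition be :: "nat \<Rightarrow> complex \<Rightarrow> complex" where
  "be k z = B (Suc k) z * B 0 z - 2 * A (Suc k) z * C 0 z - 2 * A 0 z * C (Suc k) z"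
definition ga :: "nat \<Rightarrow> complex \<Rightarrow> complex" where
  "ga k z = (E z)\<^sup>2 * (q2 z (A (Suc k) z) (B (Suc k) z) (C (Suc k) z) +
     (if k = 0 then q2 z (deriv (A 0) z) (deriv (B 0) z) (deriv (C 0) z) else 0))"

lemma coeffs_holomorphic: "al k holomorphic_on H" "be k holomorphic_on H" "ga k holomorphic_on H"
proof -
  have d: "deriv (A 0) holomorphic_on H" "deriv (B 0) holomorphic_on H" "deriv (C 0) holomorphic_on H"
    by (intro holomorphic_deriv hol oH)+
  note h = hol E_holomorphic f0_holomorphic g0_holomorphic d
  show "al k holomorphic_on H" unfolding al_def[abs_def] q1_def
    by (cases "k = 0"; simp; intro holomorphic_intros h) (use E0 in auto)
  show "be k holomorphic_on H" unfolding be_def[abs_def] by (intro holomorphic_intros h)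
  show "ga k holomorphic_on H" unfolding ga_def[abs_def] q2_def
    by (cases "k = 0"; simp; intro holomorphic_intros h)
qed

definition Cb :: real where "Cb = 48 * M ^ 3"

lemma coeffs_bound:
  assumes z: "z \<in> H"
  shows "cmod (al k z) \<le> Cb / \<tau> z" "cmod (be k z) \<le> Cb" "cmod (ga k z) \<le> Cb * \<tau> z"
proof -
  have M0: "M \<ge> 0" using M by simp
  have M3: "M \<le> M ^ 3" "M\<^sup>2 \<le> M ^ 3" using M power_increasing[of 1 3 M] power_increasing[of 2 3 M] by auto
  define s where "s = 1 + (cmod (f0 z))\<^sup>2"
  have s: "s > 0" by (simp add: s_def add_pos_nonneg)
  define e where "e = (cmod (E z))\<^sup>2"
  have e: "e > 0" using E0 by (simp add: e_def)
  have \<tau>: "\<tau> z = e * s" by (simp add: \<tau>_eq e_def s_def)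
  have b1: "cmod (q1 z (A (Suc k) z) (B (Suc k) z) (C (Suc k) z) -
     (if k = 0 then q1 z (deriv (A 0) z) (deriv (B 0) z) (deriv (C 0) z) else 0)) * s \<le> Cb"
  proof -
    have "cmod (q1 z (A (Suc k) z) (B (Suc k) z) (C (Suc k) z) -
     (if k = 0 then q1 z (deriv (A 0) z) (deriv (B 0) z) (deriv (C 0) z) else 0)) * s \<le>
       (cmod (q1 z (A (Suc k) z) (B (Suc k) z) (C (Suc k) z)) + cmod (q1 z (deriv (A 0) z) (deriv (B 0) z) (deriv (C 0) z))) * s"
      using s by (intro mult_right_mono order_trans[OF norm_triangle_ineq4] add_left_mono) auto
    also have "\<dots> \<le> 24 * M ^ 3 + 24 * M ^ 3"
      unfolding distrib_right s_def by (intro add_mono q1_bound bd bd' z)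
    finally show ?thesis by (simp add: Cb_def)
  qed
  have "cmod (al k z) * (e * s) \<le> Cb"
    using b1 e by (simp add: al_def norm_mult norm_divide norm_power flip: e_def)
  then show "cmod (al k z) \<le> Cb / \<tau> z" using e s by (simp add: \<tau> pos_le_divide_eq)
  have b2: "cmod (q2 z (A (Suc k) z) (B (Suc k) z) (C (Suc k) z) +
     (if k = 0 then q2 z (deriv (A 0) z) (deriv (B 0) z) (deriv (C 0) z) else 0)) \<le> Cb * s"
  proof -
    have "cmod (q2 z (A (Suc k) z) (B (Suc k) z) (C (Suc k) z) +
     (if k = 0 then q2 z (deriv (A 0) z) (deriv (B 0) z) (deriv (C 0) z) else 0)) \<le>
       cmod (q2 z (A (Suc k) z) (B (Suc k) z) (C (Suc k) z)) + cmod (q2 z (deriv (A 0) z) (deriv (B 0) z) (deriv (C 0) z))"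
      by (intro order_trans[OF norm_triangle_ineq] add_left_mono) auto
    also have "\<dots> \<le> 3 * M * s + 3 * M * s"
      unfolding s_def by (intro add_mono q2_bound bd bd' z)
    also have "\<dots> = 6 * M * s" by simp
    also have "\<dots> \<le> Cb * s" using s M3 M0 by (intro mult_right_mono) (auto simp: Cb_def)
    finally show ?thesis .
  qed
  have "cmod (ga k z) \<le> e * (Cb * s)"
    unfolding ga_def norm_mult norm_power e_def by (intro mult_left_mono b2) auto
  then show "cmod (ga k z) \<le> Cb * \<tau> z" by (simp add: \<tau> mult_ac)
  have MM: "cmod (x * y) \<le> M\<^sup>2" if "cmod x \<le> M" "cmod y \<le> M" for x y
    using mult_mono[OF that M0 norm_ge_zero] by (simp add: norm_mult power2_eq_square)
  have "cmod (be k z) \<le> cmod (B (Suc k) z * B 0 z) + 2 * cmod (A (Suc k) z * C 0 z) + 2 * cmod (A 0 z * C (Suc k) z)"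
    unfolding be_def by (intro norm_triangle_le_diff add_mono) (auto simp: norm_mult)
  also have "\<dots> \<le> M\<^sup>2 + 2 * M\<^sup>2 + 2 * M\<^sup>2" by (intro add_mono mult_left_mono MM bd z) auto
  also have "\<dots> \<le> Cb" using M3 M0 by (simp add: Cb_def)
  finally show "cmod (be k z) \<le> Cb" .
qed

lemma Cb_pos: "Cb > 0" using M by (simp add: Cb_def)

sublocale BR: Borel_Riccati r "12 * M\<^sup>2" \<tau> "Cb * (1 + real N)" "al 0" "be 0" "ga 0"
  "higher_Borel N al" "higher_Borel N be" "higher_Borel N ga"
proof
  show "0 \<le> 12 * M\<^sup>2" by simp
  show "\<tau> z > 0" for z by (rule \<tau>_gt0)
  show "continuous_on H \<tau>"
    unfolding \<tau>_def[abs_def]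
    by (intro continuous_intros holomorphic_on_imp_continuous_on E_holomorphic f0_holomorphic)
  show "\<tau> w \<le> \<tau> z * exp (12 * M\<^sup>2 * cmod (w - z))" if "z \<in> H" "w \<in> H" for z w
    by (rule \<tau>_log_Lipschitz[OF that])
  show "0 < Cb * (1 + real N)" using Cb_pos by (simp add: add_pos_nonneg)
  show "al 0 holomorphic_on H" "be 0 holomorphic_on H" "ga 0 holomorphic_on H" by (rule coeffs_holomorphic)+
  show "holomorphic2_on (higher_Borel N al) (strip2 r)" "holomorphic2_on (higher_Borel N be) (strip2 r)"
    "holomorphic2_on (higher_Borel N ga) (strip2 r)"
    by (intro higher_Borel_holomorphic2 coeffs_holomorphic)+
  have C1: "Cb * x \<le> Cb * (1 + real N) * x" if "x \<ge> 0" for x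
    using Cb_pos that by (intro mult_right_mono) (auto simp: distrib_left)
  fix z assume z: "z \<in> H"
  show "cmod (al 0 z) \<le> Cb * (1 + real N) / \<tau> z"
    using coeffs_bound(1)[OF z, of 0] C1[of "1 / \<tau> z"] \<tau>_gt0[of z] by simp
  show "cmod (be 0 z) \<le> Cb * (1 + real N)" using coeffs_bound(2)[OF z, of 0] C1[of 1] by simp
  show "cmod (ga 0 z) \<le> Cb * (1 + real N) * \<tau> z"
    using coeffs_bound(3)[OF z, of 0] C1[of "\<tau> z"] \<tau>_gt0[of z] by simp
next
  have C2: "real N * (Cb * x) * e \<le> Cb * (1 + real N) * x * e" if "x \<ge> 0" "e \<ge> 0" for x e
  proof -
    have "Cb * (1 + real N) * x * e = real N * (Cb * x) * e + Cb * x * e" by (simp add: algebra_simps)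
    moreover have "0 \<le> Cb * x * e" using Cb_pos that by simp
    ultimately show ?thesis by linarith
  qed
  fix z \<xi> assume "(z, \<xi>) \<in> strip2 r"
  then have z: "z \<in> H" by (rule strip2_horizontal)
  show "cmod (higher_Borel N al (z, \<xi>)) \<le> Cb * (1 + real N) / \<tau> z * exp (cmod \<xi>)"
  proof -
    have "cmod (higher_Borel N al (z, \<xi>)) \<le> real N * (Cb * (1 / \<tau> z)) * exp (cmod \<xi>)"
      by (rule higher_Borel_bound) (use coeffs_bound(1)[OF z] Cb_pos \<tau>_gt0[of z] in auto)
    also have "\<dots> \<le> Cb * (1 + real N) * (1 / \<tau> z) * exp (cmod \<xi>)"
      by (rule C2) (use \<tau>_gt0[of z] in auto)
    finally show ?thesis by simp
  qed
  show "cmod (higher_Borel N be (z, \<xi>)) \<le> Cb * (1 + real N) * exp (cmod \<xi>)"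
  proof -
    have "cmod (higher_Borel N be (z, \<xi>)) \<le> real N * (Cb * 1) * exp (cmod \<xi>)"
      by (rule higher_Borel_bound) (use coeffs_bound(2)[OF z] Cb_pos in auto)
    also have "\<dots> \<le> Cb * (1 + real N) * 1 * exp (cmod \<xi>)" by (rule C2) auto
    finally show ?thesis by simp
  qed
  show "cmod (higher_Borel N ga (z, \<xi>)) \<le> Cb * (1 + real N) * \<tau> z * exp (cmod \<xi>)"
  proof -
    have "cmod (higher_Borel N ga (z, \<xi>)) \<le> real N * (Cb * \<tau> z) * exp (cmod \<xi>)"
      by (rule higher_Borel_bound) (use coeffs_bound(3)[OF z] Cb_pos \<tau>_gt0[of z] in auto)
    also have "\<dots> \<le> Cb * (1 + real N) * \<tau> z * exp (cmod \<xi>)"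
      by (rule C2) (use \<tau>_gt0[of z] in auto)
    finally show ?thesis .
  qed
qed

lemma truncated_sums:
  assumes z: "z \<in> H" and p: "p \<noteq> 0"
  shows "p * (\<Sum>k\<le>N. A k z * (1 / p) ^ k) = p * A 0 z + (\<Sum>k\<le>N. A (Suc k) z * (1 / p) ^ k)"
    "p * (\<Sum>k\<le>N. B k z * (1 / p) ^ k) = p * B 0 z + (\<Sum>k\<le>N. B (Suc k) z * (1 / p) ^ k)"
    "p * (\<Sum>k\<le>N. C k z * (1 / p) ^ k) = p * C 0 z + (\<Sum>k\<le>N. C (Suc k) z * (1 / p) ^ k)"
proof -
  have *: "p * (\<Sum>k\<le>N. X k * (1 / p) ^ k) = p * X 0 + (\<Sum>k\<le>N. X (Suc k) * (1 / p) ^ k)"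
    if "X (Suc N) = 0" for X :: "nat \<Rightarrow> complex"
  proof -
    have "(\<Sum>k\<le>N. X k * (1 / p) ^ k) = (\<Sum>k\<le>Suc N. X k * (1 / p) ^ k)" using that by simp
    also have "\<dots> = X 0 + (1 / p) * (\<Sum>k\<le>N. X (Suc k) * (1 / p) ^ k)"
      unfolding sum.atMost_Suc_shift by (simp add: sum_distrib_left mult_ac)
    finally show ?thesis using p by (simp add: field_simps)
  qed
  show "p * (\<Sum>k\<le>N. A k z * (1 / p) ^ k) = p * A 0 z + (\<Sum>k\<le>N. A (Suc k) z * (1 / p) ^ k)"
    "p * (\<Sum>k\<le>N. B k z * (1 / p) ^ k) = p * B 0 z + (\<Sum>k\<le>N. B (Suc k) z * (1 / p) ^ k)"
    "p * (\<Sum>k\<le>N. C k z * (1 / p) ^ k) = p * C 0 z + (\<Sum>k\<le>N. C (Suc k) z * (1 / p) ^ k)"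
    by (rule *; use fin[of "Suc N" z] z in simp)+
qed

lemma summed_coeffs:
  defines "At \<equiv> \<lambda>p z. \<Sum>k\<le>N. A (Suc k) z * (1 / p) ^ k" and "Bt \<equiv> \<lambda>p z. \<Sum>k\<le>N. B (Suc k) z * (1 / p) ^ k"
    and "Ct \<equiv> \<lambda>p z. \<Sum>k\<le>N. C (Suc k) z * (1 / p) ^ k"
  shows "(\<Sum>k\<le>N. al k z * (1 / p) ^ k) * (E z)\<^sup>2 = q1 z (At p z) (Bt p z) (Ct p z) - q1 z (deriv (A 0) z) (deriv (B 0) z) (deriv (C 0) z)"
    "(\<Sum>k\<le>N. be k z * (1 / p) ^ k) = Bt p z * B 0 z - 2 * At p z * C 0 z - 2 * A 0 z * Ct p z"
    "(\<Sum>k\<le>N. ga k z * (1 / p) ^ k) = (E z)\<^sup>2 * (q2 z (At p z) (Bt p z) (Ct p z) + q2 z (deriv (A 0) z) (deriv (B 0) z) (deriv (C 0) z))"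
proof -
  have delta: "(\<Sum>k\<le>N. (if k = 0 then x else 0) * (1 / p) ^ k) = x" for x :: complex
    by (simp add: sum.atMost_shift)
  have e: "al k z * (E z)\<^sup>2 = q1 z (A (Suc k) z) (B (Suc k) z) (C (Suc k) z) -
     (if k = 0 then q1 z (deriv (A 0) z) (deriv (B 0) z) (deriv (C 0) z) else 0)" for k
    using E0[of z] by (simp add: al_def)
  have "(\<Sum>k\<le>N. al k z * (1 / p) ^ k) * (E z)\<^sup>2 = (\<Sum>k\<le>N. (al k z * (E z)\<^sup>2) * (1 / p) ^ k)"
    unfolding sum_distrib_right by (rule sum.cong) (simp_all add: mult_ac)
  also have "\<dots> = (\<Sum>k\<le>N. q1 z (A (Suc k) z) (B (Suc k) z) (C (Suc k) z) * (1 / p) ^ k) -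
      (\<Sum>k\<le>N. (if k = 0 then q1 z (deriv (A 0) z) (deriv (B 0) z) (deriv (C 0) z) else 0) * (1 / p) ^ k)"
    unfolding e left_diff_distrib sum_subtractf ..
  also have "\<dots> = q1 z (At p z) (Bt p z) (Ct p z) - q1 z (deriv (A 0) z) (deriv (B 0) z) (deriv (C 0) z)"
    unfolding delta by (simp add: q1_def At_def Bt_def Ct_def sum_distrib_left sum_distrib_right sum.distrib distrib_right distrib_left mult_ac)
  finally show "(\<Sum>k\<le>N. al k z * (1 / p) ^ k) * (E z)\<^sup>2 = q1 z (At p z) (Bt p z) (Ct p z) - q1 z (deriv (A 0) z) (deriv (B 0) z) (deriv (C 0) z)" .
  show "(\<Sum>k\<le>N. be k z * (1 / p) ^ k) = Bt p z * B 0 z - 2 * At p z * C 0 z - 2 * A 0 z * Ct p z"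
    by (simp add: be_def At_def Bt_def Ct_def sum_distrib_left sum_distrib_right sum_subtractf left_diff_distrib
        right_diff_distrib mult_ac)
  have "(\<Sum>k\<le>N. ga k z * (1 / p) ^ k) = (E z)\<^sup>2 * (\<Sum>k\<le>N. (q2 z (A (Suc k) z) (B (Suc k) z) (C (Suc k) z) +
     (if k = 0 then q2 z (deriv (A 0) z) (deriv (B 0) z) (deriv (C 0) z) else 0)) * (1 / p) ^ k)"
    unfolding ga_def by (simp only: sum_distrib_left mult.assoc)
  also have "\<dots> = (E z)\<^sup>2 * ((\<Sum>k\<le>N. q2 z (A (Suc k) z) (B (Suc k) z) (C (Suc k) z) * (1 / p) ^ k) +
     (\<Sum>k\<le>N. (if k = 0 then q2 z (deriv (A 0) z) (deriv (B 0) z) (deriv (C 0) z) else 0) * (1 / p) ^ k))"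
    unfolding distrib_right sum.distrib ..
  also have "\<dots> = (E z)\<^sup>2 * (q2 z (At p z) (Bt p z) (Ct p z) + q2 z (deriv (A 0) z) (deriv (B 0) z) (deriv (C 0) z))"
    unfolding delta by (simp add: q2_def At_def Bt_def Ct_def sum_distrib_left sum_distrib_right sum.distrib distrib_right distrib_left mult_ac)
  finally show "(\<Sum>k\<le>N. ga k z * (1 / p) ^ k) = (E z)\<^sup>2 * (q2 z (At p z) (Bt p z) (Ct p z) + q2 z (deriv (A 0) z) (deriv (B 0) z) (deriv (C 0) z))" .
qed

text \<open>Multiplication by \<open>(E\<^sup>2 - A\<^sub>0 v)\<^sup>2\<close> turns the claim into an identity between quadratic
  forms in \<open>E\<^sup>2\<close> and \<open>v\<close>, which is checked coefficient by coefficient.\<close>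

lemma Moebius_to_Riccati:
  assumes z: "z \<in> H" and p: "p \<noteq> 0" and nz: "(E z)\<^sup>2 - A 0 z * v z \<noteq> 0"
    and dv: "(v has_field_derivative (p * v z + (\<Sum>k\<le>N. al k z * (1 / p) ^ k) * (v z)\<^sup>2
           + (\<Sum>k\<le>N. be k z * (1 / p) ^ k) * v z + (\<Sum>k\<le>N. ga k z * (1 / p) ^ k))) (at z)"
  defines "y \<equiv> \<lambda>z. v z / ((E z)\<^sup>2 - A 0 z * v z)"
  shows "((\<lambda>z. f0 z + y z) has_field_derivative
         p * ((\<Sum>k\<le>N. A k z * (1 / p) ^ k) * (f0 z + y z)\<^sup>2
            + (\<Sum>k\<le>N. B k z * (1 / p) ^ k) * (f0 z + y z)
            + (\<Sum>k\<le>N. C k z * (1 / p) ^ k))) (at z)"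
proof -
  define At Bt Ct where "At = (\<Sum>k\<le>N. A (Suc k) z * (1 / p) ^ k)" and "Bt = (\<Sum>k\<le>N. B (Suc k) z * (1 / p) ^ k)"
    and "Ct = (\<Sum>k\<le>N. C (Suc k) z * (1 / p) ^ k)"
  define al' be' ga' where "al' = (\<Sum>k\<le>N. al k z * (1 / p) ^ k)" and "be' = (\<Sum>k\<le>N. be k z * (1 / p) ^ k)"
    and "ga' = (\<Sum>k\<le>N. ga k z * (1 / p) ^ k)"
  let ?A' = "deriv (A 0) z" and ?B' = "deriv (B 0) z" and ?C' = "deriv (C 0) z" and ?f' = "deriv f0 z"
  define u w where "u = (E z)\<^sup>2" and "w = u - A 0 z * v z"
  have w0: "w \<noteq> 0" using nz by (simp add: w_def u_def)
  have sc: "al' * u = q1 z At Bt Ct - q1 z ?A' ?B' ?C'" "be' = Bt * B 0 z - 2 * At * C 0 z - 2 * A 0 z * Ct"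
    "ga' = u * (q2 z At Bt Ct + q2 z ?A' ?B' ?C')"
    using summed_coeffs[of z p] by (simp_all add: al'_def be'_def ga'_def At_def Bt_def Ct_def u_def)
  define dv' where "dv' = p * v z + al' * (v z)\<^sup>2 + be' * v z + ga'"
  have dv2: "(v has_field_derivative dv') (at z)" using dv by (simp add: dv'_def al'_def be'_def ga'_def)
  have du: "((\<lambda>z. (E z)\<^sup>2 - A 0 z * v z) has_field_derivative
      (- 2 * A 0 z * ?f' * u - (?A' * v z + A 0 z * dv'))) (at z)"
    by (auto intro!: derivative_eq_intros dE[OF z] dv2 holomorphic_derivI[OF hol(1) oH z] simp: u_def power2_eq_square algebra_simps)
  have dy: "((\<lambda>z. f0 z + y z) has_field_derivative
      ?f' + (dv' * w - v z * (- 2 * A 0 z * ?f' * u - (?A' * v z + A 0 z * dv'))) / (w * w)) (at z)"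
    unfolding y_def w_def u_def
    by (rule DERIV_add[OF holomorphic_derivI[OF f0_holomorphic oH z] DERIV_divide[OF dv2 du nz, unfolded u_def]])
  have yz: "y z = v z / w" by (simp add: y_def w_def u_def)
  have target: "p * ((\<Sum>k\<le>N. A k z * (1 / p) ^ k) * F\<^sup>2 + (\<Sum>k\<le>N. B k z * (1 / p) ^ k) * F + (\<Sum>k\<le>N. C k z * (1 / p) ^ k))
     = p * (A 0 z * F\<^sup>2 + B 0 z * F + C 0 z) + (At * F\<^sup>2 + Bt * F + Ct)" for F
  proof -
    have "p * ((\<Sum>k\<le>N. A k z * (1 / p) ^ k) * F\<^sup>2 + (\<Sum>k\<le>N. B k z * (1 / p) ^ k) * F + (\<Sum>k\<le>N. C k z * (1 / p) ^ k))
      = (p * (\<Sum>k\<le>N. A k z * (1 / p) ^ k)) * F\<^sup>2 + (p * (\<Sum>k\<le>N. B k z * (1 / p) ^ k)) * F + p * (\<Sum>k\<le>N. C k z * (1 / p) ^ k)"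
      by (simp only: distrib_left mult.assoc)
    then show ?thesis unfolding truncated_sums[OF z p] At_def[symmetric] Bt_def[symmetric] Ct_def[symmetric]
      by (simp add: algebra_simps)
  qed
  have f1: "2 * A 0 z * f0 z + B 0 z = 1" "g0 z * f0 z = C 0 z" "A 0 z * f0 z = g0 z + 1"
    using f0_eqs[OF z] by (simp_all add: g0_def)
  have f2: "?f' + q2 z ?A' ?B' ?C' = 0" "(A 0 z)\<^sup>2 * ?f' + ?A' = q1 z ?A' ?B' ?C'"
    using f0_deriv[OF z] by simp_all
  have "(?f' + (dv' * w - v z * (- 2 * A 0 z * ?f' * u - (?A' * v z + A 0 z * dv'))) / (w * w)) * w\<^sup>2 =
     ?f' * w\<^sup>2 + dv' * (w + A 0 z * v z) + 2 * A 0 z * ?f' * u * v z + ?A' * (v z)\<^sup>2"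
    using w0 by (simp add: field_simps power2_eq_square)
  also have "\<dots> = ?f' * w\<^sup>2 + dv' * u + 2 * A 0 z * ?f' * u * v z + ?A' * (v z)\<^sup>2" by (simp add: w_def)
  also have "\<dots> = p * v z * u + (?f' * w\<^sup>2 + (q1 z At Bt Ct - q1 z ?A' ?B' ?C') * (v z)\<^sup>2 + be' * v z * u + ga' * u
      + 2 * A 0 z * ?f' * u * v z + ?A' * (v z)\<^sup>2)"
    unfolding dv'_def sc(1)[symmetric] by (simp add: algebra_simps)
  also have "\<dots> = p * v z * u + (At * (f0 z * u - g0 z * v z)\<^sup>2 + Bt * (f0 z * u - g0 z * v z) * w + Ct * w\<^sup>2)"
  proof -
    have "?f' * w\<^sup>2 + (q1 z At Bt Ct - q1 z ?A' ?B' ?C') * (v z)\<^sup>2 + be' * v z * u + ga' * u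
      + 2 * A 0 z * ?f' * u * v z + ?A' * (v z)\<^sup>2 =
      (?f' + q2 z At Bt Ct + q2 z ?A' ?B' ?C') * u\<^sup>2 + be' * v z * u + (q1 z At Bt Ct + ((A 0 z)\<^sup>2 * ?f' + ?A' - q1 z ?A' ?B' ?C')) * (v z)\<^sup>2"
      unfolding w_def sc(3) by (simp add: algebra_simps power2_eq_square)
    also have "\<dots> = q2 z At Bt Ct * u\<^sup>2 + be' * v z * u + q1 z At Bt Ct * (v z)\<^sup>2"
    proof -
      have "?f' + q2 z At Bt Ct + q2 z ?A' ?B' ?C' = q2 z At Bt Ct" using f2(1) by algebra
      then show ?thesis unfolding f2(2) by simp
    qed
    also have "\<dots> = At * (f0 z * u - g0 z * v z)\<^sup>2 + Bt * (f0 z * u - g0 z * v z) * w + Ct * w\<^sup>2"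
      unfolding q1_def q2_def sc(2) w_def using f1 by algebra
    finally show ?thesis by simp
  qed
  also have "\<dots> = (p * (A 0 z * (f0 z + y z)\<^sup>2 + B 0 z * (f0 z + y z) + C 0 z) + (At * (f0 z + y z)\<^sup>2 + Bt * (f0 z + y z) + Ct)) * w\<^sup>2"
  proof -
    have Fw: "(f0 z + y z) * w = f0 z * u - g0 z * v z"
    proof -
      have "(f0 z + y z) * w = f0 z * w + v z" using w0 by (simp add: yz distrib_right)
      also have "\<dots> = f0 z * u - g0 z * v z" by (simp add: w_def g0_def algebra_simps)
      finally show ?thesis .
    qed
    have yw: "y z * w = v z" using w0 by (simp add: yz)
    have e: "A 0 z * (f0 z + y z)\<^sup>2 + B 0 z * (f0 z + y z) + C 0 z = y z + A 0 z * (y z)\<^sup>2"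
      using f0_eqs(2)[OF z] f1(1) by algebra
    have "(A 0 z * (f0 z + y z)\<^sup>2 + B 0 z * (f0 z + y z) + C 0 z) * w\<^sup>2 = v z * u"
    proof -
      have uu: "u = w + A 0 z * v z" by (simp add: w_def)
      have "(y z + A 0 z * (y z)\<^sup>2) * w\<^sup>2 = (y z * w) * (w + A 0 z * (y z * w))"
        by (simp add: algebra_simps power2_eq_square)
      then show ?thesis unfolding e yw uu[symmetric] .
    qed
    moreover have "(At * (f0 z + y z)\<^sup>2 + Bt * (f0 z + y z) + Ct) * w\<^sup>2 =
        At * (f0 z * u - g0 z * v z)\<^sup>2 + Bt * (f0 z * u - g0 z * v z) * w + Ct * w\<^sup>2"
      unfolding Fw[symmetric] by (simp add: algebra_simps power2_eq_square)
    ultimately show ?thesis by (simp only: distrib_right mult.assoc)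
  qed
  finally have "?f' + (dv' * w - v z * (- 2 * A 0 z * ?f' * u - (?A' * v z + A 0 z * dv'))) / (w * w) =
     p * (A 0 z * (f0 z + y z)\<^sup>2 + B 0 z * (f0 z + y z) + C 0 z) + (At * (f0 z + y z)\<^sup>2 + Bt * (f0 z + y z) + Ct)"
    using w0 by simp
  then show ?thesis using dy unfolding target by simp
qed

text \<open>The substitution is inverted by \<open>y = v / (E\<^sup>2 - A\<^sub>0 v) = \<sigma> v / (1 - \<rho> v)\<close> with
  \<open>\<sigma> = 1 / E\<^sup>2\<close> and \<open>\<rho> = A\<^sub>0 / E\<^sup>2\<close>. These may be unbounded on the strip, but only a
  neighbourhood of 0 is needed now, as no further integration along characteristics occurs.\<close>

lemma local_Borel_solution:
  obtains \<psi> K L where "K > 0" "L > 0" "holomorphic2_on \<psi> (ball 0 (r / 2) \<times> tube (r / 2))"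
    "\<And>z \<xi>. z \<in> ball 0 (r / 2) \<Longrightarrow> \<xi> \<in> tube (r / 2) \<Longrightarrow> cmod (\<psi> (z, \<xi>)) \<le> K * exp (L * cmod \<xi>)"
    "\<And>z p. z \<in> ball 0 (r / 2) \<Longrightarrow> Re p > L \<Longrightarrow>
       ((\<lambda>z. f0 z + Laplace (\<lambda>\<xi>. \<psi> (z, \<xi>)) p) has_field_derivative
         p * ((\<Sum>k\<le>N. A k z * (1 / p) ^ k) * (f0 z + Laplace (\<lambda>\<xi>. \<psi> (z, \<xi>)) p)\<^sup>2
            + (\<Sum>k\<le>N. B k z * (1 / p) ^ k) * (f0 z + Laplace (\<lambda>\<xi>. \<psi> (z, \<xi>)) p)
            + (\<Sum>k\<le>N. C k z * (1 / p) ^ k))) (at z)"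
proof -
  obtain \<phi> where \<phi>: "weighted (strip2 r) BR.L \<phi> (\<lambda>z. BR.B * \<tau> z)" "\<And>q. q \<in> strip2 r \<Longrightarrow> BR.Borel_map \<phi> q = \<phi> q"
    using BR.Borel_solution_exists by metis
  define V where "V = ball (0::complex) (r / 2)"
  define D where "D = V \<times> {\<xi>. \<bar>Im \<xi>\<bar> < r / 2}"
  have Imz: "\<bar>Im z\<bar> < r / 2" if "z \<in> V" for z
    using that abs_Im_le_cmod[of z] by (simp add: V_def)
  have VH: "z \<in> H" if "z \<in> V" for z using Imz[OF that] r by (auto simp: horizontal_strip_def)
  have Dsub: "D \<subseteq> strip2 r" using Imz by (force simp: D_def strip2_def)
  have starD: "starlike2 D"
    unfolding starlike2_def
  proof (intro conjI allI impI)
    have "open {\<xi>. \<bar>Im \<xi>\<bar> < r / 2}" by (intro open_Collect_less continuous_intros)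
    then show "open D" unfolding D_def V_def by (intro open_Times open_ball)
    fix z \<xi> and s :: real assume z: "(z, \<xi>) \<in> D" and s: "0 \<le> s" "s \<le> 1"
    have "\<bar>s * Im \<xi>\<bar> \<le> \<bar>Im \<xi>\<bar>" using s by (simp add: abs_mult mult_left_le_one_le)
    then show "(z, complex_of_real s * \<xi>) \<in> D" using z by (simp add: D_def)
  qed
  have cpt: "compact (cball (0::complex) (r / 2))" by simp
  have cH: "cball 0 (r / 2) \<subseteq> H"
    using abs_Im_le_cmod r by (auto simp: horizontal_strip_def abs_less_iff[symmetric] intro: order_trans) (smt (verit) abs_Im_le_cmod)+
  have bnd: "\<exists>b\<ge>0. \<forall>z\<in>V. cmod (f z) \<le> b" if "continuous_on H f" for f :: "complex \<Rightarrow> complex"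
  proof -
    have "compact (f ` cball 0 (r / 2))"
      by (rule compact_continuous_image[OF continuous_on_subset[OF that cH] cpt])
    then obtain b where b: "\<And>z. z \<in> cball 0 (r / 2) \<Longrightarrow> cmod (f z) \<le> b"
      using compact_imp_bounded bounded_iff by (metis imageI)
    have "cmod (f z) \<le> max b 0" if "z \<in> V" for z
    proof -
      have "z \<in> cball 0 (r / 2)" using that by (simp add: V_def)
      from b[OF this] show ?thesis by simp
    qed
    then show ?thesis by (intro exI[of _ "max b 0"]) auto
  qed
  define \<sigma> where "\<sigma> = (\<lambda>z. 1 / (E z)\<^sup>2)"
  define \<rho> where "\<rho> = (\<lambda>z. A 0 z / (E z)\<^sup>2)"
  have h\<sigma>: "\<sigma> holomorphic_on H" "\<rho> holomorphic_on H"
    unfolding \<sigma>_def \<rho>_def using E0 by (auto intro!: holomorphic_intros E_holomorphic hol)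
  obtain b1 b2 b3 where b: "b1 \<ge> 0" "\<And>z. z \<in> V \<Longrightarrow> cmod (\<sigma> z) \<le> b1" "b2 \<ge> 0" "\<And>z. z \<in> V \<Longrightarrow> cmod (\<rho> z) \<le> b2"
    "b3 \<ge> 0" "\<And>z. z \<in> V \<Longrightarrow> cmod (complex_of_real (\<tau> z)) \<le> b3"
    using bnd[OF holomorphic_on_imp_continuous_on[OF h\<sigma>(1)]] bnd[OF holomorphic_on_imp_continuous_on[OF h\<sigma>(2)]]
      bnd[OF continuous_on_of_real[OF BR.\<tau>_cont]] by blast
  have b3: "\<tau> z \<le> b3" if "z \<in> V" for z using b(6)[OF that] by simp
  define N1 where "N1 = max b1 b2"
  have B0: "BR.B \<ge> 0" using BR.B1 by simp
  have w: "weighted D BR.L \<phi> (\<lambda>_. BR.B * b3)"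
  proof -
    have "weighted D BR.L \<phi> (\<lambda>z. BR.B * \<tau> z)"
      using \<phi>(1) Dsub holomorphic2_on_subset unfolding weighted_def by blast
    then show ?thesis
      by (rule weighted_mono) (use b3 B0 in \<open>auto simp: D_def intro!: mult_left_mono\<close>)
  qed
  obtain \<psi> L' M' where \<psi>: "L' > BR.L" "weighted D L' \<psi> (\<lambda>_. M')" "M' \<ge> 0"
    "\<And>q. q \<in> D \<Longrightarrow> \<psi> q = \<sigma> (fst q) * \<phi> q + \<rho> (fst q) * conv \<phi> \<psi> q"
  proof (rule linear_convolution_equation[OF starD w, of \<sigma> V \<rho> N1])
    show "0 \<le> BR.B * b3" using B0 b by simp
    show "\<sigma> holomorphic_on V" "\<rho> holomorphic_on V" using h\<sigma> VH by (auto elim: holomorphic_on_subset)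
    show "open V" by (simp add: V_def)
    show "cmod (\<sigma> z) \<le> N1" "cmod (\<rho> z) \<le> N1" if "z \<in> V" for z using b(2,4)[OF that] by (auto simp: N1_def)
    show "0 \<le> N1" using b by (simp add: N1_def)
  qed (auto simp: D_def)
  have L'0: "L' > 0" using \<psi>(1) BR.L2(2) by simp
  have wL': "weighted D L' \<phi> (\<lambda>_. BR.B * b3)"
    unfolding weighted_def
  proof (intro conjI allI impI)
    show "holomorphic2_on \<phi> D" using w by (simp add: weighted_def)
    fix z \<xi> assume z: "(z, \<xi>) \<in> D"
    have "wt BR.L (cmod \<xi>) \<le> wt L' (cmod \<xi>)"
      unfolding wt_def using \<psi>(1) by (intro divide_right_mono) (auto intro: mult_right_mono add_nonneg_nonneg)
    then show "cmod (\<phi> (z, \<xi>)) \<le> BR.B * b3 * wt L' (cmod \<xi>)"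
      using weightedD[OF w z] mult_nonneg_nonneg[OF B0 b(5)] by (meson mult_left_mono order_trans)
  qed
  have tubeD: "(z, \<xi>) \<in> D" if "z \<in> V" "\<xi> \<in> tube (r / 2)" for z \<xi>
  proof -
    have "infdist \<xi> (complex_of_real ` {0..}) < r / 2" using that by (simp add: tube_def)
    moreover have "complex_of_real ` {0..} \<noteq> {}" by auto
    ultimately obtain t where "dist \<xi> (complex_of_real t) < r / 2"
      using infdist_notempty cInf_less_iff by (smt (verit, ccfv_SIG) bdd_below_image_dist imageE image_is_empty)
    then have "\<bar>Im \<xi>\<bar> < r / 2" using abs_Im_le_cmod[of "\<xi> - of_real t"] by (simp add: dist_norm)
    then show ?thesis using that by (simp add: D_def)
  qed
  have rayD: "(z, complex_of_real t) \<in> D" if "z \<in> V" for z t using that r by (simp add: D_def)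
  show ?thesis
  proof (rule that[of "M' + 1" L' \<psi>])
    show "M' + 1 > 0" using \<psi>(3) by simp
    show "L' > 0" by (rule L'0)
    have "ball 0 (r / 2) \<times> tube (r / 2) \<subseteq> D" using tubeD by (auto simp: V_def)
    then show "holomorphic2_on \<psi> (ball 0 (r / 2) \<times> tube (r / 2))"
      using \<psi>(2) holomorphic2_on_subset unfolding weighted_def by blast
    show "cmod (\<psi> (z, \<xi>)) \<le> (M' + 1) * exp (L' * cmod \<xi>)"
      if "z \<in> ball 0 (r / 2)" "\<xi> \<in> tube (r / 2)" for z \<xi>
    proof -
      have "cmod (\<psi> (z, \<xi>)) \<le> M' * wt L' (cmod \<xi>)"
        using weightedD[OF \<psi>(2) tubeD] that by (simp add: V_def)
      also have "\<dots> \<le> (M' + 1) * exp (L' * cmod \<xi>)"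
        using \<psi>(3) wt_le_exp[of L' "cmod \<xi>"] less_imp_le[OF wt_pos[of L' "cmod \<xi>"]] by (intro mult_mono) auto
      finally show ?thesis .
    qed
    fix z p :: complex assume zV: "z \<in> ball 0 (r / 2)" and p: "Re p > L'"
    define v where "v = (\<lambda>z. Laplace (\<lambda>\<xi>. \<phi> (z, \<xi>)) p)"
    have p0: "p \<noteq> 0" using p L'0 by auto
    have pL: "Re p > BR.L" "Re p > 1" using p \<psi>(1) BR.L2(2) by auto
    have dv: "(v has_field_derivative (p * v z + (\<Sum>k\<le>N. al k z * (1 / p) ^ k) * (v z)\<^sup>2
           + (\<Sum>k\<le>N. be k z * (1 / p) ^ k) * v z + (\<Sum>k\<le>N. ga k z * (1 / p) ^ k))) (at z)" if "z \<in> V" for z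
      using BR.Laplace_solves_Riccati[OF \<phi> pL(1) VH[OF that]]
      unfolding Laplace_higher_Borel[OF pL(2)] v_def .
    have y: "Laplace (\<lambda>\<xi>. \<psi> (z, \<xi>)) p * ((E z)\<^sup>2 - A 0 z * v z) = v z \<and> (E z)\<^sup>2 - A 0 z * v z \<noteq> 0"
      if z: "z \<in> V" for z
    proof -
      note ok\<phi> = weighted_exp_bounded[OF wL' rayD[OF z]]
      note okc = weighted_exp_bounded[OF weighted_conv[OF starD wL' \<psi>(2)] rayD[OF z]]
      have "Laplace (\<lambda>\<xi>. \<psi> (z, \<xi>)) p = Laplace (\<lambda>\<xi>. \<sigma> z * \<phi> (z, \<xi>) + \<rho> z * conv \<phi> \<psi> (z, \<xi>)) p"
        by (rule Laplace_cong) (use \<psi>(4)[OF rayD[OF z]] in simp)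
      also have "\<dots> = \<sigma> z * v z + \<rho> z * (v z * Laplace (\<lambda>\<xi>. \<psi> (z, \<xi>)) p)"
        by (subst Laplace_add[OF exp_bounded_cmult[OF ok\<phi>] exp_bounded_cmult[OF okc] p])
           (simp only: Laplace_cmult Laplace_conv[OF wL' \<psi>(2) rayD[OF z] p] v_def)
      finally have e: "(E z)\<^sup>2 * Laplace (\<lambda>\<xi>. \<psi> (z, \<xi>)) p = v z + A 0 z * v z * Laplace (\<lambda>\<xi>. \<psi> (z, \<xi>)) p"
        using E0[of z] by (simp add: \<sigma>_def \<rho>_def field_simps)
      then have e2: "Laplace (\<lambda>\<xi>. \<psi> (z, \<xi>)) p * ((E z)\<^sup>2 - A 0 z * v z) = v z" by (simp add: algebra_simps)
      \<comment> \<open>At a zero of the denominator the equation would give \<open>v z = 0\<close>, hence \<open>E z = 0\<close>.\<close>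
      have "(E z)\<^sup>2 - A 0 z * v z \<noteq> 0"
      proof
        assume h: "(E z)\<^sup>2 - A 0 z * v z = 0"
        then have "v z = 0" using e2 by simp
        then show False using h E0[of z] by simp
      qed
      with e2 show ?thesis by simp
    qed
    have y_eq: "v z / ((E z)\<^sup>2 - A 0 z * v z) = Laplace (\<lambda>\<xi>. \<psi> (z, \<xi>)) p" if "z \<in> V" for z
      using y[OF that] by (simp add: divide_eq_eq)
    have z: "z \<in> V" using zV by (simp add: V_def)
    have "((\<lambda>z. f0 z + v z / ((E z)\<^sup>2 - A 0 z * v z)) has_field_derivative
         p * ((\<Sum>k\<le>N. A k z * (1 / p) ^ k) * (f0 z + Laplace (\<lambda>\<xi>. \<psi> (z, \<xi>)) p)\<^sup>2
            + (\<Sum>k\<le>N. B k z * (1 / p) ^ k) * (f0 z + Laplace (\<lambda>\<xi>. \<psi> (z, \<xi>)) p)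
            + (\<Sum>k\<le>N. C k z * (1 / p) ^ k))) (at z)"
      using Moebius_to_Riccati[OF VH[OF z] p0 conjunct2[OF y[OF z]] dv[OF z]] unfolding y_eq[OF z] .
    moreover have "\<forall>\<^sub>F x in nhds z. f0 x + v x / ((E x)\<^sup>2 - A 0 x * v x) = f0 x + Laplace (\<lambda>\<xi>. \<psi> (x, \<xi>)) p"
      using eventually_nhds_in_open[of V z] z y_eq by (auto simp: V_def elim!: eventually_mono)
    ultimately show "((\<lambda>z. f0 z + Laplace (\<lambda>\<xi>. \<psi> (z, \<xi>)) p) has_field_derivative
         p * ((\<Sum>k\<le>N. A k z * (1 / p) ^ k) * (f0 z + Laplace (\<lambda>\<xi>. \<psi> (z, \<xi>)) p)\<^sup>2
            + (\<Sum>k\<le>N. B k z * (1 / p) ^ k) * (f0 z + Laplace (\<lambda>\<xi>. \<psi> (z, \<xi>)) p)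
            + (\<Sum>k\<le>N. C k z * (1 / p) ^ k))) (at z)"
      by (subst (asm) DERIV_cong_ev[OF refl _ refl])
  qed
qed

end

section \<open>Exact solutions for one branch\<close>

text \<open>Cauchy's estimate; halving the strip leaves room for discs of a fixed radius.\<close>

lemma strip_deriv_bound:
  assumes hol: "f holomorphic_on horizontal_strip r" and r: "r > 0"
    and bd: "\<And>z. z \<in> horizontal_strip r \<Longrightarrow> cmod (f z) \<le> M" and z: "z \<in> horizontal_strip (r / 2)"
  shows "cmod (deriv f z) \<le> M * (4 / r)"
proof -
  have sub: "cball z (r / 4) \<subseteq> horizontal_strip r"
  proof
    fix w assume "w \<in> cball z (r / 4)"
    then have "\<bar>Im (w - z)\<bar> \<le> r / 4"
      using abs_Im_le_cmod[of "w - z"] by (simp add: dist_norm norm_minus_commute)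
    then have "Im w - Im z \<le> r / 4" "Im z - Im w \<le> r / 4" unfolding abs_le_iff minus_complex.simps by linarith+
    moreover have "- (r / 2) < Im z" "Im z < r / 2" using z by (auto simp: horizontal_strip_def)
    ultimately have "- r < Im w" "Im w < r" using r by linarith+
    then show "w \<in> horizontal_strip r" by (simp add: horizontal_strip_def)
  qed
  have "cmod ((deriv ^^ 1) f z) \<le> fact 1 * M / (r / 4) ^ 1"
  proof (rule Cauchy_inequality)
    show "f holomorphic_on ball z (r / 4)" by (rule holomorphic_on_subset[OF hol]) (use sub in force)
    show "continuous_on (cball z (r / 4)) f"
      by (rule holomorphic_on_imp_continuous_on[OF holomorphic_on_subset[OF hol sub]])
    show "cmod (f w) \<le> M" if "cmod (z - w) = r / 4" for w
      by (rule bd) (use that sub in \<open>auto simp: dist_norm\<close>)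
  qed (use r in auto)
  then show ?thesis by simp
qed

lemma horizontal_strip_mono: "r \<le> r' \<Longrightarrow> horizontal_strip r \<subseteq> horizontal_strip r'"
  by (auto simp: horizontal_strip_def)

text \<open>Since \<open>|\<Psi>'| = 1 / |\<surd>D\<^sub>0|\<close>, boundedness relative to \<open>\<surd>D\<^sub>0\<close> is boundedness of the
  transformed coefficients. There are finitely many of them, which gives a common bound.\<close>

lemma strip_Riccati_of_uniformization:
  assumes r: "r > 0" and X: "open X"
    and coeffs: "holomorphic_poly_on a X" "holomorphic_poly_on b X" "holomorphic_poly_on c X"
    and \<Psi>: "\<Psi> holomorphic_on horizontal_strip r" "\<Psi> ` horizontal_strip r \<subseteq> X"
    and d\<Psi>: "\<And>z. z \<in> horizontal_strip r \<Longrightarrow> disc0 a b c (\<Psi> z) * (deriv \<Psi> z)\<^sup>2 = 1"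
    and a0: "\<forall>x\<in>\<Psi> ` horizontal_strip r. coeff (a x) 0 \<noteq> 0"
    and bdd: "\<forall>k. bounded ((\<lambda>x. norm (coeff (a x) k / csqrt (disc0 a b c x))) ` \<Psi> ` horizontal_strip r)"
             "\<forall>k. bounded ((\<lambda>x. norm (coeff (b x) k / csqrt (disc0 a b c x))) ` \<Psi> ` horizontal_strip r)"
             "\<forall>k. bounded ((\<lambda>x. norm (coeff (c x) k / csqrt (disc0 a b c x))) ` \<Psi> ` horizontal_strip r)"
  obtains M N where "strip_Riccati (r / 2) M N (\<lambda>k z. deriv \<Psi> z * coeff (a (\<Psi> z)) k)
     (\<lambda>k z. deriv \<Psi> z * coeff (b (\<Psi> z)) k) (\<lambda>k z. deriv \<Psi> z * coeff (c (\<Psi> z)) k)"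
    "\<And>x. x \<in> X \<Longrightarrow> degree (a x) \<le> N \<and> degree (b x) \<le> N \<and> degree (c x) \<le> N"
proof -
  let ?H = "horizontal_strip r"
  obtain Na Nb Nc where Nabc: "\<forall>x\<in>X. degree (a x) \<le> Na" "\<forall>x\<in>X. degree (b x) \<le> Nb" "\<forall>x\<in>X. degree (c x) \<le> Nc"
    using coeffs unfolding holomorphic_poly_on_def by blast
  define N where "N = max Na (max Nb Nc)"
  have N: "degree (a x) \<le> N \<and> degree (b x) \<le> N \<and> degree (c x) \<le> N" if "x \<in> X" for x
    using Nabc that by (auto simp: N_def le_max_iff_disj)
  have oH: "open ?H" by (rule open_horizontal_strip)
  have csq: "cmod (csqrt (disc0 a b c (\<Psi> z))) * cmod (deriv \<Psi> z) = 1" if "z \<in> ?H" for z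
  proof -
    have "(cmod (csqrt (disc0 a b c (\<Psi> z))) * cmod (deriv \<Psi> z))\<^sup>2 = cmod (disc0 a b c (\<Psi> z) * (deriv \<Psi> z)\<^sup>2)"
      by (simp add: power_mult_distrib norm_mult norm_power flip: norm_power)
    then have "(cmod (csqrt (disc0 a b c (\<Psi> z))) * cmod (deriv \<Psi> z))\<^sup>2 = 1" using d\<Psi>[OF that] by simp
    moreover have "0 \<le> cmod (csqrt (disc0 a b c (\<Psi> z))) * cmod (deriv \<Psi> z)" by simp
    ultimately show ?thesis unfolding power2_eq_1_iff by linarith
  qed
  have bound: "\<exists>m. \<forall>k. \<forall>z\<in>?H. cmod (deriv \<Psi> z * coeff (e (\<Psi> z)) k) \<le> m"
    if b: "\<forall>k. bounded ((\<lambda>x. norm (coeff (e x) k / csqrt (disc0 a b c x))) ` \<Psi> ` ?H)"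
      and dN: "\<And>x. x \<in> X \<Longrightarrow> degree (e x) \<le> N" for e :: "complex \<Rightarrow> complex poly"
  proof -
    have "\<forall>k. \<exists>m. \<forall>z\<in>?H. cmod (coeff (e (\<Psi> z)) k / csqrt (disc0 a b c (\<Psi> z))) \<le> m"
      using b by (simp add: bounded_iff image_image)
    then obtain m where m: "\<And>k z. z \<in> ?H \<Longrightarrow> cmod (coeff (e (\<Psi> z)) k / csqrt (disc0 a b c (\<Psi> z))) \<le> m k"
      by metis
    have m': "cmod (deriv \<Psi> z * coeff (e (\<Psi> z)) k) \<le> m k" if "z \<in> ?H" for z k
    proof -
      have "cmod (csqrt (disc0 a b c (\<Psi> z))) \<noteq> 0" using csq[OF that] by auto
      then have "cmod (deriv \<Psi> z) = 1 / cmod (csqrt (disc0 a b c (\<Psi> z)))"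
        using csq[OF that] by (simp add: eq_divide_eq mult.commute)
      then show ?thesis using m[OF that, of k] by (simp add: norm_mult norm_divide)
    qed
    have "cmod (deriv \<Psi> z * coeff (e (\<Psi> z)) k) \<le> (\<Sum>k\<le>N. \<bar>m k\<bar>)" if z: "z \<in> ?H" for z k
    proof (cases "k \<le> N")
      case True
      have "cmod (deriv \<Psi> z * coeff (e (\<Psi> z)) k) \<le> \<bar>m k\<bar>" using m'[OF z, of k] by simp
      also have "\<dots> \<le> (\<Sum>k\<le>N. \<bar>m k\<bar>)" by (rule member_le_sum) (use True in auto)
      finally show ?thesis .
    next
      case False
      then have "coeff (e (\<Psi> z)) k = 0" using dN[of "\<Psi> z"] \<Psi>(2) z by (intro coeff_eq_0) force
      then show ?thesis by (simp add: sum_nonneg)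
    qed
    then show ?thesis by blast
  qed
  obtain ma mb mc where mm: "\<And>k z. z \<in> ?H \<Longrightarrow> cmod (deriv \<Psi> z * coeff (a (\<Psi> z)) k) \<le> ma"
    "\<And>k z. z \<in> ?H \<Longrightarrow> cmod (deriv \<Psi> z * coeff (b (\<Psi> z)) k) \<le> mb"
    "\<And>k z. z \<in> ?H \<Longrightarrow> cmod (deriv \<Psi> z * coeff (c (\<Psi> z)) k) \<le> mc"
    using bound[OF bdd(1)] bound[OF bdd(2)] bound[OF bdd(3)] N by metis
  define m where "m = max 1 (max ma (max mb mc))"
  define M where "M = max m (m * (4 / r))"
  have mm': "cmod (deriv \<Psi> z * coeff (a (\<Psi> z)) k) \<le> m" "cmod (deriv \<Psi> z * coeff (b (\<Psi> z)) k) \<le> m"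
    "cmod (deriv \<Psi> z * coeff (c (\<Psi> z)) k) \<le> m" if "z \<in> ?H" for z k
    using mm[OF that, of k] by (auto simp: m_def)
  have holc: "(\<lambda>z. deriv \<Psi> z * coeff (e (\<Psi> z)) k) holomorphic_on ?H" if "holomorphic_poly_on e X" for e k
  proof -
    have "(\<lambda>x. coeff (e x) k) holomorphic_on X" using that by (simp add: holomorphic_poly_on_def)
    then have "(\<lambda>z. coeff (e (\<Psi> z)) k) holomorphic_on ?H"
      using holomorphic_on_compose_gen[OF \<Psi>(1) _ \<Psi>(2), unfolded o_def] by blast
    then show ?thesis by (intro holomorphic_on_mult holomorphic_deriv \<Psi>(1) oH)
  qed
  have sub: "horizontal_strip (r / 2) \<subseteq> ?H" using r by (intro horizontal_strip_mono) simp
  have "strip_Riccati (r / 2) M N (\<lambda>k z. deriv \<Psi> z * coeff (a (\<Psi> z)) k)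
     (\<lambda>k z. deriv \<Psi> z * coeff (b (\<Psi> z)) k) (\<lambda>k z. deriv \<Psi> z * coeff (c (\<Psi> z)) k)"
  proof
    show "r / 2 > 0" using r by simp
    show "1 \<le> M" by (simp add: M_def m_def)
    show "(\<lambda>z. deriv \<Psi> z * coeff (a (\<Psi> z)) k) holomorphic_on horizontal_strip (r / 2)"
      "(\<lambda>z. deriv \<Psi> z * coeff (b (\<Psi> z)) k) holomorphic_on horizontal_strip (r / 2)"
      "(\<lambda>z. deriv \<Psi> z * coeff (c (\<Psi> z)) k) holomorphic_on horizontal_strip (r / 2)" for k
      by (rule holomorphic_on_subset[OF holc[OF coeffs(1)] sub] holomorphic_on_subset[OF holc[OF coeffs(2)] sub]
          holomorphic_on_subset[OF holc[OF coeffs(3)] sub])+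
    fix z assume z2: "z \<in> horizontal_strip (r / 2)"
    then have z: "z \<in> ?H" using sub by blast
    show "cmod (deriv \<Psi> z * coeff (a (\<Psi> z)) k) \<le> M" "cmod (deriv \<Psi> z * coeff (b (\<Psi> z)) k) \<le> M"
      "cmod (deriv \<Psi> z * coeff (c (\<Psi> z)) k) \<le> M" for k
      using mm'[OF z, of k] by (auto simp: M_def)
    have dM: "x \<le> m * (4 / r) \<Longrightarrow> x \<le> M" for x by (simp add: M_def le_max_iff_disj)
    show "cmod (deriv (\<lambda>z. deriv \<Psi> z * coeff (a (\<Psi> z)) 0) z) \<le> M"
      by (rule dM, rule strip_deriv_bound[OF holc[OF coeffs(1)] r mm'(1) z2])
    show "cmod (deriv (\<lambda>z. deriv \<Psi> z * coeff (b (\<Psi> z)) 0) z) \<le> M"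
      by (rule dM, rule strip_deriv_bound[OF holc[OF coeffs(2)] r mm'(2) z2])
    show "cmod (deriv (\<lambda>z. deriv \<Psi> z * coeff (c (\<Psi> z)) 0) z) \<le> M"
      by (rule dM, rule strip_deriv_bound[OF holc[OF coeffs(3)] r mm'(3) z2])
    have "disc0 a b c (\<Psi> z) * (deriv \<Psi> z)\<^sup>2 = 1" by (rule d\<Psi>[OF z])
    then show "(deriv \<Psi> z * coeff (b (\<Psi> z)) 0)\<^sup>2 - 4 * (deriv \<Psi> z * coeff (a (\<Psi> z)) 0) * (deriv \<Psi> z * coeff (c (\<Psi> z)) 0) = 1"
      by (simp add: disc0_def power2_eq_square algebra_simps)
    have "deriv \<Psi> z \<noteq> 0" using d\<Psi>[OF z] by auto
    then show "deriv \<Psi> z * coeff (a (\<Psi> z)) 0 \<noteq> 0" using a0 z by simp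
    fix k assume k: "N < k"
    have "\<Psi> z \<in> X" using z \<Psi>(2) by blast
    then have "coeff (a (\<Psi> z)) k = 0 \<and> coeff (b (\<Psi> z)) k = 0 \<and> coeff (c (\<Psi> z)) k = 0"
      using N[of "\<Psi> z"] k by (auto intro!: coeff_eq_0)
    then show "deriv \<Psi> z * coeff (a (\<Psi> z)) k = 0 \<and> deriv \<Psi> z * coeff (b (\<Psi> z)) k = 0 \<and> deriv \<Psi> z * coeff (c (\<Psi> z)) k = 0"
      by simp
  qed
  then show ?thesis using N by (rule that) auto
qed

lemma poly_sum_degree:
  fixes p :: "complex poly"
  assumes "degree p \<le> N"
  shows "poly p h = (\<Sum>k\<le>N. coeff p k * h ^ k)"
  unfolding poly_altdef by (rule sum.mono_neutral_left) (use assms in \<open>auto intro!: coeff_eq_0\<close>)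

text \<open>The choice of the branch \<open>sqD\<close> selects the leading root. The relation \<open>sqD(\<Psi>) \<Psi>' = 1\<close>
  is only given near 0, but its square extends to the whole strip by the identity theorem.\<close>

lemma one_sided_solution:
  assumes r: "r > 0" and X: "open X"
    and coeffs: "holomorphic_poly_on a X" "holomorphic_poly_on b X" "holomorphic_poly_on c X"
    and \<Psi>: "\<Psi> holomorphic_on horizontal_strip r" "\<Psi> ` horizontal_strip r \<subseteq> X" "\<Psi> 0 = x0"
    and V: "open V" "x0 \<in> V" "sqD holomorphic_on V" "\<forall>x\<in>V. (sqD x)\<^sup>2 = disc0 a b c x"
    and d\<Psi>: "\<forall>\<^sub>F z in nhds 0. sqD (\<Psi> z) * deriv \<Psi> z = 1"
    and a0: "\<forall>x\<in>\<Psi> ` horizontal_strip r. coeff (a x) 0 \<noteq> 0"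
    and bdd: "\<forall>k. bounded ((\<lambda>x. norm (coeff (a x) k / csqrt (disc0 a b c x))) ` \<Psi> ` horizontal_strip r)"
             "\<forall>k. bounded ((\<lambda>x. norm (coeff (b x) k / csqrt (disc0 a b c x))) ` \<Psi> ` horizontal_strip r)"
             "\<forall>k. bounded ((\<lambda>x. norm (coeff (c x) k / csqrt (disc0 a b c x))) ` \<Psi> ` horizontal_strip r)"
  obtains U1 R1 F f where "open U1" "x0 \<in> U1" "U1 \<subseteq> V" "R1 > 0"
    "\<And>U R. open U \<Longrightarrow> U \<subseteq> U1 \<Longrightarrow> 0 < R \<Longrightarrow> R \<le> R1 \<Longrightarrow>
       the_formal_Riccati_solution a b c U (\<lambda>x. (- coeff (b x) 0 + sqD x) / (2 * coeff (a x) 0)) F \<and>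
       Riccati_solution a b c U (Borel_disc R) f \<and> Gevrey_asymptotic f F U (Borel_disc R) \<and>
       uniform_Borel_resummation f F U (Borel_disc R)"
proof -
  let ?H = "horizontal_strip r"
  have oH: "open ?H" by (rule open_horizontal_strip)
  have zH: "0 \<in> ?H" using r by (simp add: horizontal_strip_def)
  have cont\<Psi>: "isCont \<Psi> 0"
    using holomorphic_on_imp_continuous_on[OF \<Psi>(1)] continuous_on_eq_continuous_at[OF oH] zH by blast
  have evV: "\<forall>\<^sub>F z in nhds 0. \<Psi> z \<in> V"
  proof -
    have "(\<Psi> \<longlongrightarrow> \<Psi> 0) (nhds 0)" using cont\<Psi> by (simp add: tendsto_nhds_iff isCont_def)
    then show ?thesis using V(1,2) \<Psi>(3) topological_tendstoD by blast
  qed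
  have "\<forall>\<^sub>F z in nhds 0. \<Psi> z \<in> V \<and> sqD (\<Psi> z) * deriv \<Psi> z = 1"
    using evV d\<Psi> by eventually_elim simp
  then obtain e where e: "e > 0" "\<And>z. z \<in> ball 0 e \<Longrightarrow> \<Psi> z \<in> V \<and> sqD (\<Psi> z) * deriv \<Psi> z = 1"
    unfolding eventually_nhds_metric by (auto simp: dist_commute)
  have hold0: "disc0 a b c holomorphic_on X"
    unfolding disc0_def[abs_def] using coeffs by (intro holomorphic_intros) (auto simp: holomorphic_poly_on_def)
  have d\<Psi>2: "disc0 a b c (\<Psi> z) * (deriv \<Psi> z)\<^sup>2 = 1" if z: "z \<in> ?H" for z
  proof (rule analytic_continuation_open[where s = "ball 0 e \<inter> ?H" and s' = ?H and g = "\<lambda>_. 1"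
        and f = "\<lambda>z. disc0 a b c (\<Psi> z) * (deriv \<Psi> z)\<^sup>2"])
    show "connected ?H" by (intro convex_connected convex_horizontal_strip)
    show "ball 0 e \<inter> ?H \<noteq> {}" using e zH by (metis IntI centre_in_ball empty_iff)
    have "(\<lambda>z. disc0 a b c (\<Psi> z)) holomorphic_on ?H"
      using holomorphic_on_compose_gen[OF \<Psi>(1) hold0 \<Psi>(2)] by (simp add: o_def)
    then show "(\<lambda>z. disc0 a b c (\<Psi> z) * (deriv \<Psi> z)\<^sup>2) holomorphic_on ?H"
      by (intro holomorphic_intros holomorphic_deriv \<Psi>(1) oH)
    fix z assume z: "z \<in> ball 0 e \<inter> ?H"
    then have "\<Psi> z \<in> V" "sqD (\<Psi> z) * deriv \<Psi> z = 1" using e(2) by auto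
    then have "(sqD (\<Psi> z))\<^sup>2 = disc0 a b c (\<Psi> z)" using V(4) by blast
    then have "disc0 a b c (\<Psi> z) * (deriv \<Psi> z)\<^sup>2 = (sqD (\<Psi> z) * deriv \<Psi> z)\<^sup>2"
      by (simp only: power_mult_distrib)
    then show "disc0 a b c (\<Psi> z) * (deriv \<Psi> z)\<^sup>2 = 1"
      by (simp only: \<open>sqD (\<Psi> z) * deriv \<Psi> z = 1\<close> power_one)
  qed (use oH z in auto)
  obtain M N where SR: "strip_Riccati (r / 2) M N (\<lambda>k z. deriv \<Psi> z * coeff (a (\<Psi> z)) k)
     (\<lambda>k z. deriv \<Psi> z * coeff (b (\<Psi> z)) k) (\<lambda>k z. deriv \<Psi> z * coeff (c (\<Psi> z)) k)"
    and N: "\<And>x. x \<in> X \<Longrightarrow> degree (a x) \<le> N \<and> degree (b x) \<le> N \<and> degree (c x) \<le> N"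
    by (rule strip_Riccati_of_uniformization[OF r X coeffs \<Psi>(1,2) d\<Psi>2 a0 bdd]) (assumption, rule that)
  let ?A = "\<lambda>k z. deriv \<Psi> z * coeff (a (\<Psi> z)) k" and ?B = "\<lambda>k z. deriv \<Psi> z * coeff (b (\<Psi> z)) k"
    and ?C = "\<lambda>k z. deriv \<Psi> z * coeff (c (\<Psi> z)) k"
  interpret S: strip_Riccati "r / 2" M N ?A ?B ?C by (rule SR)
  obtain E where E: "\<And>z. z \<in> S.H \<Longrightarrow> (E has_field_derivative (- ?A 0 z * deriv S.f0 z * E z)) (at z)" "\<And>z. E z \<noteq> 0"
    by (rule S.E_exists) (rule that)
  interpret SF: strip_frame "r / 2" M N ?A ?B ?C E
    by unfold_locales (use E in auto)
  obtain \<psi> K L where \<psi>: "K > 0" "L > 0" "holomorphic2_on \<psi> (ball 0 (r / 2 / 2) \<times> tube (r / 2 / 2))"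
    "\<And>z \<xi>. z \<in> ball 0 (r / 2 / 2) \<Longrightarrow> \<xi> \<in> tube (r / 2 / 2) \<Longrightarrow> cmod (\<psi> (z, \<xi>)) \<le> K * exp (L * cmod \<xi>)"
    and \<psi>_eq: "\<And>z p. z \<in> ball 0 (r / 2 / 2) \<Longrightarrow> Re p > L \<Longrightarrow>
       ((\<lambda>z. S.f0 z + Laplace (\<lambda>\<xi>. \<psi> (z, \<xi>)) p) has_field_derivative
         p * ((\<Sum>k\<le>N. ?A k z * (1 / p) ^ k) * (S.f0 z + Laplace (\<lambda>\<xi>. \<psi> (z, \<xi>)) p)\<^sup>2
            + (\<Sum>k\<le>N. ?B k z * (1 / p) ^ k) * (S.f0 z + Laplace (\<lambda>\<xi>. \<psi> (z, \<xi>)) p)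
            + (\<Sum>k\<le>N. ?C k z * (1 / p) ^ k))) (at z)"
    by (rule SF.local_Borel_solution) (rule that)
  have "deriv \<Psi> 0 \<noteq> 0" using d\<Psi>2[OF zH] by auto
  then obtain e1 where e1: "e1 > 0" "inj_on \<Psi> (ball 0 e1)"
    using has_complex_derivative_locally_injective[OF \<Psi>(1) zH oH] by blast
  define \<rho> where "\<rho> = min (min e e1) (r / 8)"
  have \<rho>: "\<rho> > 0" "\<rho> \<le> e" "\<rho> \<le> e1" "\<rho> \<le> r / 8" using e(1) e1(1) r by (auto simp: \<rho>_def)
  define G where "G = ball (0::complex) \<rho>"
  have cS: "cball 0 (r / 8) \<subseteq> S.H"
  proof
    fix z assume "z \<in> cball (0::complex) (r / 8)"
    then have "\<bar>Im z\<bar> \<le> r / 8" using abs_Im_le_cmod[of z] by simp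
    then show "z \<in> S.H" using r by (auto simp: horizontal_strip_def abs_le_iff)
  qed
  have GS: "G \<subseteq> S.H" using cS \<rho>(4) by (force simp: G_def)
  have SH: "S.H \<subseteq> ?H" using r by (intro horizontal_strip_mono) simp
  have hol\<Psi>G: "\<Psi> holomorphic_on G" using \<Psi>(1) GS SH by (blast intro: holomorphic_on_subset)
  have injG: "inj_on \<Psi> G" 
    by (rule inj_on_subset[OF e1(2)]) (use \<rho>(3) in \<open>auto simp: G_def\<close>)
  have oG: "open G" by (simp add: G_def)
  obtain \<Phi> where \<Phi>: "\<Phi> holomorphic_on \<Psi> ` G" "\<And>z. z \<in> G \<Longrightarrow> deriv \<Psi> z * deriv \<Phi> (\<Psi> z) = 1"
    "\<And>z. z \<in> G \<Longrightarrow> \<Phi> (\<Psi> z) = z"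
    by (rule holomorphic_has_inverse[OF hol\<Psi>G oG injG]) (rule that)
  define U1 where "U1 = \<Psi> ` G"
  have oU1: "open U1"
    unfolding U1_def by (rule open_mapping_thm3[OF hol\<Psi>G oG injG])
  have \<Phi>G: "\<Phi> x \<in> G" "\<Psi> (\<Phi> x) = x" if "x \<in> U1" for x
    using that \<Phi>(3) by (auto simp: U1_def)
  have inV: "x \<in> V" "sqD x * deriv \<Psi> (\<Phi> x) = 1" if "x \<in> U1" for x
    using e(2)[of "\<Phi> x"] \<Phi>G[OF that] \<rho>(2) by (auto simp: G_def)
  have U1X: "U1 \<subseteq> X" using \<Psi>(2) GS SH by (auto simp: U1_def)
  define F0 where "F0 = (\<lambda>x. S.f0 (\<Phi> x))"
  define \<phi> where "\<phi> = (\<lambda>q. \<psi> (\<Phi> (fst q), snd q))"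
  have F0_eq: "F0 x = (- coeff (b x) 0 + sqD x) / (2 * coeff (a x) 0)" if x: "x \<in> U1" for x
  proof -
    have nz: "deriv \<Psi> (\<Phi> x) \<noteq> 0" using inV(2)[OF x] by auto
    have s: "sqD x = 1 / deriv \<Psi> (\<Phi> x)" using inV(2)[OF x] nz by (simp add: eq_divide_eq)
    show ?thesis using nz by (simp add: F0_def S.f0_def \<Phi>G(2)[OF x] s divide_simps)
  qed
  have holF0: "F0 holomorphic_on U1"
    unfolding F0_def using \<Phi>G(1) GS
    by (intro holomorphic_on_compose_gen[OF \<Phi>(1)[folded U1_def] S.f0_holomorphic, unfolded o_def]) auto
  have "compact (S.f0 ` cball 0 (r / 8))"
    by (intro compact_continuous_image continuous_on_subset[OF holomorphic_on_imp_continuous_on[OF S.f0_holomorphic] cS] compact_cball)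
  then have "bounded (S.f0 ` cball 0 (r / 8))" by (rule compact_imp_bounded)
  then obtain B where "\<forall>y\<in>S.f0 ` cball 0 (r / 8). cmod y \<le> B" unfolding bounded_iff by blast
  then have B: "cmod (S.f0 z) \<le> B" if "z \<in> cball 0 (r / 8)" for z using that by (rule bspec[OF _ imageI])
  have "0 \<in> cball (0::complex) (r / 8)" using r by simp
  then have B0: "B \<ge> 0" using B norm_ge_zero order_trans by blast
  have F0b: "cmod (F0 x) \<le> B" if "x \<in> U1" for x
    unfolding F0_def by (rule B) (use \<Phi>G(1)[OF that] \<rho>(4) in \<open>auto simp: G_def\<close>)
  have Gq: "z \<in> ball 0 (r / 2 / 2)" if "z \<in> G" for z using that \<rho>(4) r by (simp add: G_def)
  define R1 where "R1 = 1 / (L + 1)"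
  have R1: "R1 > 0" using \<psi>(2) by (simp add: R1_def)
  show ?thesis
  proof (rule that[OF oU1 _ _ R1, of "Borel_coeff F0 \<phi>" "Borel_sum F0 \<phi>"])
    show "x0 \<in> U1" using \<Psi>(3) \<rho>(1) by (auto simp: U1_def G_def intro!: image_eqI[of _ _ 0])
    show "U1 \<subseteq> V" using inV by auto
    fix U R assume U: "open U" "U \<subseteq> U1" and R: "0 < R" "R \<le> R1"
    have "L + 1 \<le> 1 / R"
    proof -
      have "1 / R1 \<le> 1 / R" using R by (intro divide_left_mono) auto
      then show ?thesis by (simp add: R1_def)
    qed
    have hol\<phi>: "holomorphic2_on \<phi> (U \<times> tube (r / 2 / 2))"
      unfolding \<phi>_def
    proof (rule holomorphic2_on_compose[OF \<psi>(3)])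
      show "holomorphic2_on (\<lambda>w. \<Phi> (fst w)) (U \<times> tube (r / 2 / 2))"
        using U by (intro holomorphic2_on_compose1[OF \<Phi>(1)[folded U1_def] oU1] hol2_intros) auto
    qed (use U \<Phi>G Gq in \<open>auto intro: hol2_intros\<close>)
    interpret BD: Borel_data U F0 \<phi> "r / 2 / 2" K L B R
    proof
      show "cmod (\<phi> (x, \<xi>)) \<le> K * exp (L * cmod \<xi>)" if "x \<in> U" "\<xi> \<in> tube (r / 2 / 2)" for x \<xi>
        unfolding \<phi>_def using \<psi>(4)[of "\<Phi> x" \<xi>] Gq \<Phi>G U that by auto
      show "F0 holomorphic_on U" using holF0 U(2) by (rule holomorphic_on_subset)
      show "cmod (F0 x) \<le> B" if "x \<in> U" for x using F0b U that by auto
    qed (use U hol\<phi> r \<psi> B0 R \<open>L + 1 \<le> 1 / R\<close> in auto)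
    have Ric: "Riccati_solution a b c U (Borel_disc R) (Borel_sum F0 \<phi>)"
      unfolding Riccati_solution_def
    proof (intro conjI ballI BD.Borel_sum_holomorphic2)
      fix x h assume x: "x \<in> U" and h: "h \<in> Borel_disc R"
      have x1: "x \<in> U1" using x U by auto
      define z where "z = \<Phi> x"
      have zG: "z \<in> G" "\<Psi> z = x" using \<Phi>G[OF x1] by (auto simp: z_def)
      define p where "p = 1 / h"
      have h0: "h \<noteq> 0" by (rule Borel_disc_nz[OF h R(1)])
      have ph: "1 / p = h" "h * p = 1" using h0 by (auto simp: p_def)
      have pL: "Re p > L" using BD.disc[OF h] by (simp add: p_def)
      let ?g = "\<lambda>z. S.f0 z + Laplace (\<lambda>\<xi>. \<psi> (z, \<xi>)) p"
      have fg: "Borel_sum F0 \<phi> (y, h) = ?g (\<Phi> y)" for y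
        by (simp add: Borel_sum_def F0_def \<phi>_def p_def)
      define Fv where "Fv = Borel_sum F0 \<phi> (x, h)"
      have gz: "?g z = Fv" by (simp add: Fv_def fg z_def)
      have dz: "deriv \<Psi> z * deriv \<Phi> x = 1" using \<Phi>(2)[OF zG(1)] zG(2) by simp
      have "((\<lambda>y. ?g (\<Phi> y)) has_field_derivative
         (p * ((\<Sum>k\<le>N. ?A k z * (1 / p) ^ k) * (?g z)\<^sup>2 + (\<Sum>k\<le>N. ?B k z * (1 / p) ^ k) * ?g z
            + (\<Sum>k\<le>N. ?C k z * (1 / p) ^ k))) * deriv \<Phi> x) (at x)"
        by (rule DERIV_chain2[where f = ?g and g = \<Phi>])
           (use \<psi>_eq[OF Gq[OF zG(1)] pL] holomorphic_derivI[OF \<Phi>(1)[folded U1_def] oU1 x1] in \<open>simp_all add: z_def\<close>)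
      then have "deriv (\<lambda>y. Borel_sum F0 \<phi> (y, h)) x =
         (p * ((\<Sum>k\<le>N. ?A k z * h ^ k) * Fv\<^sup>2 + (\<Sum>k\<le>N. ?B k z * h ^ k) * Fv
            + (\<Sum>k\<le>N. ?C k z * h ^ k))) * deriv \<Phi> x"
        unfolding fg gz ph(1) by (rule DERIV_imp_deriv)
      moreover have "(\<Sum>k\<le>N. deriv \<Psi> z * coeff (q (\<Psi> z)) k * h ^ k) = deriv \<Psi> z * poly (q x) h"
        if "degree (q x) \<le> N" for q :: "complex \<Rightarrow> complex poly"
        by (simp add: zG(2) poly_sum_degree[OF that] sum_distrib_left mult.assoc)
      then have "(\<Sum>k\<le>N. ?A k z * h ^ k) = deriv \<Psi> z * poly (a x) h" "(\<Sum>k\<le>N. ?B k z * h ^ k) = deriv \<Psi> z * poly (b x) h"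
        "(\<Sum>k\<le>N. ?C k z * h ^ k) = deriv \<Psi> z * poly (c x) h"
        using N[of x] x1 U1X by blast+
      ultimately have "h * deriv (\<lambda>y. Borel_sum F0 \<phi> (y, h)) x =
         (h * p) * (deriv \<Psi> z * deriv \<Phi> x) * (poly (a x) h * Fv\<^sup>2 + poly (b x) h * Fv + poly (c x) h)"
        by (simp add: algebra_simps)
      then show "h * deriv (\<lambda>y. Borel_sum F0 \<phi> (y, h)) x = poly (a x) h * (Borel_sum F0 \<phi> (x, h))\<^sup>2
          + poly (b x) h * Borel_sum F0 \<phi> (x, h) + poly (c x) h"
        unfolding ph(2) dz Fv_def by simp
    qed
    let ?f0 = "\<lambda>x. (- coeff (b x) 0 + sqD x) / (2 * coeff (a x) 0)"
    have formal: "formal_Riccati_solution a b c U ?f0 (Borel_coeff F0 \<phi>)"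
    proof (rule formal_Riccati_solution_of_Gevrey[OF R(1) U(1) Ric BD.Borel_sum_Gevrey BD.Borel_coeff_holomorphic])
      show "Borel_coeff F0 \<phi> 0 x = ?f0 x" if "x \<in> U" for x
        using F0_eq[of x] that U by (auto simp: Borel_coeff_def)
    qed
    have "2 * coeff (a x) 0 * ?f0 x + coeff (b x) 0 \<noteq> 0" if x: "x \<in> U" for x
    proof -
      have x1: "x \<in> U1" using x U by auto
      have "coeff (a x) 0 \<noteq> 0" using a0 \<Phi>G[OF x1] GS SH by force
      then have "2 * coeff (a x) 0 * ?f0 x + coeff (b x) 0 = sqD x" by simp
      moreover have "sqD x \<noteq> 0" using inV(2)[OF x1] by auto
      ultimately show ?thesis by simp
    qed
    then have "the_formal_Riccati_solution a b c U ?f0 (Borel_coeff F0 \<phi>)"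
      unfolding the_formal_Riccati_solution_def
      using formal formal_Riccati_solution_unique[OF U(1) formal] by blast
    then show "the_formal_Riccati_solution a b c U ?f0 (Borel_coeff F0 \<phi>) \<and>
       Riccati_solution a b c U (Borel_disc R) (Borel_sum F0 \<phi>) \<and>
       Gevrey_asymptotic (Borel_sum F0 \<phi>) (Borel_coeff F0 \<phi>) U (Borel_disc R) \<and>
       uniform_Borel_resummation (Borel_sum F0 \<phi>) (Borel_coeff F0 \<phi>) U (Borel_disc R)"
      using Ric BD.Borel_sum_Gevrey BD.Borel_sum_resummation by blast
  qed
qed

section \<open>Both branches\<close>

lemma derivative_of_uniformization:
  assumes V: "open V" "x0 \<in> V" "sqD holomorphic_on V"
    and Phi: "\<forall>\<^sub>F x in nhds x0. \<Phi> x = contour_integral (linepath x0 x) sqD"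
    and H: "open H" "0 \<in> H" "\<Psi> holomorphic_on H" "\<Psi> 0 = x0"
    and inv: "\<forall>\<^sub>F z in nhds 0. \<Phi> (\<Psi> z) = z"
  shows "\<forall>\<^sub>F z in nhds 0. sqD (\<Psi> z) * deriv \<Psi> z = 1"
proof -
  obtain d where d: "d > 0" "ball x0 d \<subseteq> V" using V open_contains_ball by blast
  obtain P where P: "\<And>x. x \<in> ball x0 d \<Longrightarrow> (P has_field_derivative sqD x) (at x within ball x0 d)"
    by (rule holomorphic_convex_primitive'[OF convex_ball open_ball holomorphic_on_subset[OF V(3) d(2)]]) (rule that)
  have prim: "contour_integral (linepath x0 x) sqD = P x - P x0" if x: "x \<in> ball x0 d" for x
  proof -
    have "path_image (linepath x0 x) \<subseteq> ball x0 d"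
      unfolding path_image_linepath by (rule closed_segment_subset) (use x d in auto)
    from contour_integral_primitive[OF P _ this] show ?thesis
      by (auto intro: contour_integral_unique)
  qed
  have "(\<Psi> \<longlongrightarrow> x0) (nhds 0)"
  proof -
    have "isCont \<Psi> 0"
      using holomorphic_on_imp_continuous_on[OF H(3)] continuous_on_eq_continuous_at[OF H(1)] H(2) by blast
    then show ?thesis using H(4) by (simp add: tendsto_nhds_iff isCont_def)
  qed
  then have lim: "filterlim \<Psi> (nhds x0) (nhds 0)" .
  have "\<forall>\<^sub>F x in nhds x0. x \<in> ball x0 d \<and> \<Phi> x = contour_integral (linepath x0 x) sqD"
    using Phi eventually_nhds_in_open[OF open_ball, of x0 x0 d] d(1) by (auto elim: eventually_elim2)
  from filterlim_iff[THEN iffD1, OF lim, rule_format, OF this] inv eventually_nhds_in_open[OF H(1,2)]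
  have "\<forall>\<^sub>F z in nhds 0. \<Psi> z \<in> ball x0 d \<and> P (\<Psi> z) - P x0 = z \<and> z \<in> H"
    by eventually_elim (use prim in auto)
  then have "\<forall>\<^sub>F z in nhds 0. \<forall>\<^sub>F w in nhds z. \<Psi> w \<in> ball x0 d \<and> P (\<Psi> w) - P x0 = w \<and> w \<in> H"
    by (simp add: eventually_eventually)
  then show ?thesis
  proof eventually_elim
    case (elim z)
    then have z: "\<Psi> z \<in> ball x0 d" "z \<in> H" by (auto dest: eventually_nhds_x_imp_x)
    have "((\<lambda>w. P (\<Psi> w) - P x0) has_field_derivative sqD (\<Psi> z) * deriv \<Psi> z - 0) (at z)"
      by (intro DERIV_diff DERIV_const DERIV_chain2[where f = P and g = \<Psi>] holomorphic_derivI[OF H(3,1) z(2)])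
         (use P[OF z(1)] at_within_open[OF z(1) open_ball] in simp)
    moreover have "\<forall>\<^sub>F w in nhds z. P (\<Psi> w) - P x0 = w" using elim by (auto elim: eventually_mono)
    ultimately have "((\<lambda>w. w) has_field_derivative sqD (\<Psi> z) * deriv \<Psi> z) (at z)"
      using DERIV_cong_ev[OF refl _ refl] by fastforce
    from DERIV_unique[OF this DERIV_ident] show ?case .
  qed
qed

theorem theorem210822125944:
  fixes X S V W :: "complex set"
    and a b c :: "complex \<Rightarrow> complex poly"
    and x0 :: complex
    and sqD \<Phi> :: "complex \<Rightarrow> complex"
    and r :: real
  assumes X: "open X" "connected X"
    and S: "sectorial_domain S (- pi / 2) (pi / 2)"
    and S_Borel: "\<exists>R>0. Borel_disc R \<subseteq> S"
    and coeffs: "holomorphic_poly_on a X" "holomorphic_poly_on b X" "holomorphic_poly_on c X"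
    and D0_nonzero: "\<exists>x\<in>X. disc0 a b c x \<noteq> 0"
    and x0: "x0 \<in> X" "disc0 a b c x0 \<noteq> 0"
    and branch: "open V" "x0 \<in> V" "V \<subseteq> X" "sqD holomorphic_on V"
                "\<forall>x\<in>V. (sqD x)\<^sup>2 = disc0 a b c x"
    and Phi: "\<forall>\<^sub>F x in nhds x0. \<Phi> x = contour_integral (linepath x0 x) sqD"
    and strip: "0 < r" "mapped_onto X \<Phi> x0 W (horizontal_strip r)"
    and a0: "\<forall>x\<in>W. coeff (a x) 0 \<noteq> 0"
    and bdd: "\<forall>k. bounded ((\<lambda>x. norm (coeff (a x) k / csqrt (disc0 a b c x))) ` W)"
             "\<forall>k. bounded ((\<lambda>x. norm (coeff (b x) k / csqrt (disc0 a b c x))) ` W)"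
             "\<forall>k. bounded ((\<lambda>x. norm (coeff (c x) k / csqrt (disc0 a b c x))) ` W)"
  shows "\<exists>U0 S0 Fp Fm fp fm.
     open U0 \<and> x0 \<in> U0 \<and> U0 \<subseteq> V \<and>
     S0 \<subseteq> S \<and> sectorial_domain S0 (- pi / 2) (pi / 2) \<and>
     the_formal_Riccati_solution a b c U0
       (\<lambda>x. (- coeff (b x) 0 + sqD x) / (2 * coeff (a x) 0)) Fp \<and>
     the_formal_Riccati_solution a b c U0
       (\<lambda>x. (- coeff (b x) 0 - sqD x) / (2 * coeff (a x) 0)) Fm \<and>
     (Riccati_solution a b c U0 S0 fp \<and> Gevrey_asymptotic fp Fp U0 S0 \<and>
      Riccati_solution a b c U0 S0 fm \<and> Gevrey_asymptotic fm Fm U0 S0) \<and>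
     (\<forall>gp gm.
        Riccati_solution a b c U0 S0 gp \<and> Gevrey_asymptotic gp Fp U0 S0 \<and>
        Riccati_solution a b c U0 S0 gm \<and> Gevrey_asymptotic gm Fm U0 S0 \<longrightarrow>
        (\<forall>p\<in>U0 \<times> S0. gp p = fp p \<and> gm p = fm p)) \<and>
     uniform_Borel_resummation fp Fp U0 S0 \<and>
     uniform_Borel_resummation fm Fm U0 S0"
proof -
  obtain \<Psi> where \<Psi>: "\<Psi> holomorphic_on horizontal_strip r" "\<Psi> ` horizontal_strip r \<subseteq> X" "\<Psi> 0 = x0"
    "\<forall>\<^sub>F z in nhds 0. \<Phi> (\<Psi> z) = z" "W = \<Psi> ` horizontal_strip r"
    using strip(2) unfolding mapped_onto_def by blast
  have zH: "0 \<in> horizontal_strip r" using strip(1) by (simp add: horizontal_strip_def)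
  have d\<Psi>: "\<forall>\<^sub>F z in nhds 0. sqD (\<Psi> z) * deriv \<Psi> z = 1"
    by (rule derivative_of_uniformization[OF branch(1,2,4) Phi open_horizontal_strip zH \<Psi>(1,3,4)])
  obtain U1 R1 Fp fp where p: "open U1" "x0 \<in> U1" "U1 \<subseteq> V" "R1 > 0"
    and p_sol: "\<And>U R. open U \<Longrightarrow> U \<subseteq> U1 \<Longrightarrow> 0 < R \<Longrightarrow> R \<le> R1 \<Longrightarrow>
       the_formal_Riccati_solution a b c U (\<lambda>x. (- coeff (b x) 0 + sqD x) / (2 * coeff (a x) 0)) Fp \<and>
       Riccati_solution a b c U (Borel_disc R) fp \<and> Gevrey_asymptotic fp Fp U (Borel_disc R) \<and>
       uniform_Borel_resummation fp Fp U (Borel_disc R)"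
    by (rule one_sided_solution[OF strip(1) X(1) coeffs \<Psi>(1-3) branch(1,2,4,5) d\<Psi>
          a0[unfolded \<Psi>(5)] bdd[unfolded \<Psi>(5)]]) (rule that)
  define \<Psi>m where "\<Psi>m = (\<lambda>z. \<Psi> (- z))"
  have im: "\<Psi>m ` horizontal_strip r = \<Psi> ` horizontal_strip r"
  proof -
    have sym: "- z \<in> horizontal_strip r" if "z \<in> horizontal_strip r" for z
      using that by (auto simp: horizontal_strip_def)
    have "\<Psi>m z \<in> \<Psi> ` horizontal_strip r" "\<Psi> z \<in> \<Psi>m ` horizontal_strip r" if "z \<in> horizontal_strip r" for z
      using imageI[OF sym[OF that], of \<Psi>] imageI[OF sym[OF that], of \<Psi>m] by (simp_all add: \<Psi>m_def)
    then show ?thesis by blast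
  qed
  have holm: "\<Psi>m holomorphic_on horizontal_strip r"
    unfolding \<Psi>m_def
    by (rule holomorphic_on_compose_gen[OF _ \<Psi>(1), unfolded o_def])
       (auto intro!: holomorphic_intros simp: horizontal_strip_def)
  have dm: "\<forall>\<^sub>F z in nhds 0. - sqD (\<Psi>m z) * deriv \<Psi>m z = 1"
  proof -
    have "filterlim (\<lambda>z::complex. - z) (nhds 0) (nhds 0)"
      using tendsto_minus[OF filterlim_ident[of "nhds (0::complex)"]] by simp
    from filterlim_iff[THEN iffD1, OF this, rule_format, OF d\<Psi>]
      eventually_nhds_in_open[OF open_horizontal_strip zH]
    show ?thesis
    proof eventually_elim
      case (elim z)
      have "- z \<in> horizontal_strip r" using elim(2) by (auto simp: horizontal_strip_def)
      from DERIV_chain2[OF holomorphic_derivI[OF \<Psi>(1) open_horizontal_strip this] DERIV_minus[OF DERIV_ident]]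
      have "deriv \<Psi>m z = deriv \<Psi> (- z) * (- 1)" unfolding \<Psi>m_def by (rule DERIV_imp_deriv)
      then show ?case using elim(1) by (simp add: \<Psi>m_def)
    qed
  qed
  have branchm: "(\<lambda>x. - sqD x) holomorphic_on V" "\<forall>x\<in>V. (- sqD x)\<^sup>2 = disc0 a b c x"
    using branch(4,5) by (auto intro: holomorphic_intros)
  have subm: "\<Psi>m ` horizontal_strip r \<subseteq> X" and zerom: "\<Psi>m 0 = x0"
    using \<Psi>(2,3) im by (simp_all add: \<Psi>m_def)
  obtain U2 R2 Fm fm where m: "open U2" "x0 \<in> U2" "U2 \<subseteq> V" "R2 > 0"
    and m_sol: "\<And>U R. open U \<Longrightarrow> U \<subseteq> U2 \<Longrightarrow> 0 < R \<Longrightarrow> R \<le> R2 \<Longrightarrow>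
       the_formal_Riccati_solution a b c U (\<lambda>x. (- coeff (b x) 0 + - sqD x) / (2 * coeff (a x) 0)) Fm \<and>
       Riccati_solution a b c U (Borel_disc R) fm \<and> Gevrey_asymptotic fm Fm U (Borel_disc R) \<and>
       uniform_Borel_resummation fm Fm U (Borel_disc R)"
    by (rule one_sided_solution[OF strip(1) X(1) coeffs holm subm zerom branch(1,2) branchm dm
          a0[unfolded \<Psi>(5), folded im] bdd[unfolded \<Psi>(5), folded im]]) (rule that)
  obtain RS where RS: "RS > 0" "Borel_disc RS \<subseteq> S" using S_Borel by blast
  define U0 where "U0 = U1 \<inter> U2"
  define R where "R = min (min R1 R2) RS"
  have R: "R > 0" "R \<le> R1" "R \<le> R2" "R \<le> RS" using p(4) m(4) RS(1) by (auto simp: R_def)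
  have U0: "open U0" "x0 \<in> U0" "U0 \<subseteq> U1" "U0 \<subseteq> U2" "U0 \<subseteq> V" using p m by (auto simp: U0_def)
  note ps = p_sol[OF U0(1,3) R(1,2)] and ms = m_sol[OF U0(1,4) R(1,3)]
  have S0: "Borel_disc R \<subseteq> S" using Borel_disc_mono[OF R(1,4)] RS(2) by blast
  have uniq: "g q = f q" if "Riccati_solution a b c U0 (Borel_disc R) f" "Gevrey_asymptotic f F U0 (Borel_disc R)"
    "Riccati_solution a b c U0 (Borel_disc R) g" "Gevrey_asymptotic g F U0 (Borel_disc R)" "q \<in> U0 \<times> Borel_disc R" for f g F q
    using Gevrey_asymptotic_unique[OF R(1), of g U0 f F "fst q" "snd q"] that
    by (auto simp: Riccati_solution_def)
  show ?thesis
  proof (rule exI[of _ U0], rule exI[of _ "Borel_disc R"], rule exI[of _ Fp], rule exI[of _ Fm],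
      rule exI[of _ fp], rule exI[of _ fm], intro conjI allI impI ballI)
    show "sectorial_domain (Borel_disc R) (- pi / 2) (pi / 2)" by (rule sectorial_domain_Borel_disc[OF R(1)])
    show "the_formal_Riccati_solution a b c U0 (\<lambda>x. (- coeff (b x) 0 - sqD x) / (2 * coeff (a x) 0)) Fm"
      using ms by simp
  next
    fix gp gm q
    assume g: "Riccati_solution a b c U0 (Borel_disc R) gp \<and> Gevrey_asymptotic gp Fp U0 (Borel_disc R) \<and>
        Riccati_solution a b c U0 (Borel_disc R) gm \<and> Gevrey_asymptotic gm Fm U0 (Borel_disc R)"
      and q: "q \<in> U0 \<times> Borel_disc R"
    show "gp q = fp q" by (rule uniq[of fp Fp gp q]) (use ps g q in auto)
    show "gm q = fm q" by (rule uniq[of fm Fm gm q]) (use ms g q in auto)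
  qed (use U0 S0 ps ms in auto)
qed

end
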